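(* Let $X$ be an Asplund space, let $p\in[1,+\infty)$ and $q=\frac{p}{p-1}$ (with $q=\infty$ if $p=1$). Let $f\colon T\times X\to\overline{\mathbb{R}}$ be an admissible integrand such that $\mathcal{I}_f(u)<+\infty$ for some $u\in L^p(T,X)$, and regard $\mathcal{I}_f$ as a functional on $L^p(T,X)$, whose dual is identified with $L^q(T,X^\ast)$. Then for every $x^\ast\in L^q(T,X^\ast)$ $$(\mathcal{I}_f)^\ast(x^\ast)=\mathcal{I}_{f^\ast}(x^\ast),$$ and for every $\epsilon\ge0$ and every $x\in L^p(T,X)$ at which $\mathcal{I}_f(x)$ is finite, $$\partial_\epsilon\mathcal{I}_f(x)=\bigcup_{\eta\in\mathcal{Z}(\epsilon)}\big\{x^\ast\in L^q(T,X^\ast): x^\ast(t)\in\partial_{\eta(t)}f_t(x(t))\ \text{ for } \mu\text{-a.e. } t\big\},$$ where $\mathcal{Z}(\epsilon):=\{\ell\in L^1(T):\ \ell\ge0\ \mu\text{-a.e. and }\int_T\ell(t)\,d\mu\le\epsilon\}$.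
   Context: Standing assumptions: $X$ is a (not necessarily separable) Banach space with dual $X^\ast$, $(T,d)$ is a metric space, and $(T,\mathcal{A},\mu)$ is a complete $\sigma$-finite measure space with $\mathcal{A}$ containing the Borel $\sigma$-algebra of $T$; $\mu$ is inner regular, meaning that for all $\varepsilon>0$ and $B\in\mathcal{A}$ of finite measure there is a compact $K\subset B$ with $\mu(B\setminus K)<\varepsilon$. Notation: $\overline{\mathbb{R}}=[-\infty,\infty]$; $f_t(x):=f(t,x)$; $\operatorname{epi} g:=\{(x,\alpha)\in X\times\mathbb{R}: g(x)\le\alpha\}$; $g^\ast(x^\ast):=\sup_{x}\{\langle x^\ast,x\rangle-g(x)\}$ is the conjugate; $\mathcal{I}_f(x):=\int_T f_t(x(t))\,d\mu$, $\mathcal{I}_{f^\ast}(x^\ast):=\int_T f^\ast_t(x^\ast(t))\,d\mu$. Integrals are upper integrals: $\int_T g\,d\mu:=\int_T\max\{g,0\}\,d\mu+\int_T\min\{g,0\}\,d\mu$ with $+\infty+(-\infty)=+\infty$. $L^p(T,X)$ is the space of (strongly measurable) $p$-integrable functions. For a function $g\colon Z\to\overline{\mathbb{R}}$ on a Banach space $Z$, $\epsilon\ge0$ and $z$ with $|g(z)|<\infty$: $\partial_\epsilon g(z):=\{z^\ast\in Z^\ast:\langle z^\ast,y-z\rangle\le g(y)-g(z)+\epsilon\ \forall y\in Z\}$; $\partial_\epsilon g(z):=\emptyset$ if $|g(z)|=\infty$. A multifunction $\Phi$ is lower semicontinuous (lsc) at $t$ if for every open $V$ with $\Phi(t)\cap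 V\ne\emptyset$ there is a neighbourhood $U$ of $t$ with $\Phi(s)\cap V\neq\emptyset$ for all $s\in U$; it is lsc if it is lsc at every point where its value is nonempty. A family $(f^i\colon T\times X\to\overline{\mathbb{R}})_{i\in I}$ is a uniform Lusin family if for every $\varepsilon>0$ and every $A\in\mathcal{A}$ of finite measure there is a compact $B\subset A$ with $\mu(A\setminus B)<\varepsilon$ such that $B\ni t\rightrightarrows\operatorname{epi} f^i_t$ is lsc for all $i\in I$. $\Gamma(X)$ is the set of convex lower semicontinuous functions $X\to\overline{\mathbb{R}}$ (not necessarily proper). $f$ is an admissible integrand if there is a uniform Lusin family $(f^i)_{i\in I}$ with $f^i_t\in\Gamma(X)$ for all $i\in I$, $t\in T$, and $\operatorname{epi} f_t=\operatorname{cl}\big(\operatorname{epi}(\inf_{i\in I}f^i_t)\big)$ for all $t\in T$. *)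

theory Defs
  imports "HOL-Analysis.Analysis"
begin

section \<open>Extended-real-valued functions on a normed space\<close>

definition epi :: "('x \<Rightarrow> ereal) \<Rightarrow> ('x \<times> real) set" where
  "epi g = {(x, \<alpha>). g x \<le> ereal \<alpha>}"

definition conjugate :: "('x::real_normed_vector \<Rightarrow> ereal) \<Rightarrow> ('x \<Rightarrow>\<^sub>L real) \<Rightarrow> ereal" where
  "conjugate g x' = (SUP x. ereal (blinfun_apply x' x) - g x)"

definition eps_subdifferential ::
  "('x::real_normed_vector \<Rightarrow> ereal) \<Rightarrow> real \<Rightarrow> 'x \<Rightarrow> ('x \<Rightarrow>\<^sub>L real) set" where
  "eps_subdifferential g \<epsilon> z =
     (if \<bar>g z\<bar> = \<infinity> then {}
      else {z'. \<forall>y. ereal (blinfun_apply z' (y - z)) \<le> g y - g z + ereal \<epsilon>})"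

definition lower_semicontinuous :: "('x::topological_space \<Rightarrow> ereal) \<Rightarrow> bool" where
  "lower_semicontinuous g \<longleftrightarrow> (\<forall>x. \<forall>c<g x. \<forall>\<^sub>F y in nhds x. c < g y)"

text \<open>Convexity of a possibly improper function is convexity of its epigraph.\<close>

definition convex_lsc_functions :: "('x::real_normed_vector \<Rightarrow> ereal) set" where
  "convex_lsc_functions = {g. convex (epi g) \<and> lower_semicontinuous g}"

text \<open>\<^const>\<open>differentiable\<close> is Frechet differentiability.\<close>

definition asplund_space :: "'x::banach itself \<Rightarrow> bool" where
  "asplund_space _ \<longleftrightarrow>
     (\<forall>(U::'x set) (h::'x \<Rightarrow> real). open U \<longrightarrow> convex U \<longrightarrow> convex_on U h \<longrightarrow> continuous_on U h \<longrightarrow>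
        (\<exists>G. gdelta_in (top_of_set U) G \<and> U \<subseteq> closure G \<and> (\<forall>x\<in>G. h differentiable (at x))))"


section \<open>Admissible integrands\<close>

definition inner_regular :: "'t::topological_space measure \<Rightarrow> bool" where
  "inner_regular M \<longleftrightarrow>
     (\<forall>\<epsilon>>0. \<forall>B\<in>sets M. emeasure M B < \<infinity> \<longrightarrow>
        (\<exists>K. compact K \<and> K \<subseteq> B \<and> emeasure M (B - K) < ennreal \<epsilon>))"

text \<open>Neighbourhoods are taken in the subspace \<open>B\<close>. Where \<open>\<Phi> t\<close> is empty the condition at \<open>t\<close>
  is vacuous.\<close>

definition lsc_multifunction_on ::
  "'t::topological_space set \<Rightarrow> ('t \<Rightarrow> 'z::topological_space set) \<Rightarrow> bool" where
  "lsc_multifunction_on B \<Phi> \<longleftrightarrow>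
     (\<forall>t\<in>B. \<forall>V. open V \<longrightarrow> \<Phi> t \<inter> V \<noteq> {} \<longrightarrow>
        (\<exists>U. openin (top_of_set B) U \<and> t \<in> U \<and> (\<forall>s\<in>U. \<Phi> s \<inter> V \<noteq> {})))"

definition uniform_Lusin_family ::
  "'t::topological_space measure \<Rightarrow> 'i set \<Rightarrow> ('i \<Rightarrow> 't \<Rightarrow> 'x::topological_space \<Rightarrow> ereal) \<Rightarrow> bool" where
  "uniform_Lusin_family M I F \<longleftrightarrow>
     (\<forall>\<epsilon>>0. \<forall>A\<in>sets M. emeasure M A < \<infinity> \<longrightarrow>
        (\<exists>B. compact B \<and> B \<subseteq> A \<and> emeasure M (A - B) < ennreal \<epsilon> \<and>
             (\<forall>i\<in>I. lsc_multifunction_on B (\<lambda>t. epi (F i t)))))"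

text \<open>The index type is chosen so that no generality is lost: all conditions depend only on the
  set of functions \<open>F ` I\<close>, so a family over any index type can be indexed by its own members.\<close>

definition admissible_integrand ::
  "'t::topological_space measure \<Rightarrow> ('t \<Rightarrow> 'x::real_normed_vector \<Rightarrow> ereal) \<Rightarrow> bool" where
  "admissible_integrand M f \<longleftrightarrow>
     (\<exists>(I :: ('t \<Rightarrow> 'x \<Rightarrow> ereal) set) F.
        uniform_Lusin_family M I F \<and>
        (\<forall>i\<in>I. \<forall>t. F i t \<in> convex_lsc_functions) \<and>
        (\<forall>t. epi (f t) = closure (epi (\<lambda>x. INF i\<in>I. F i t x))))"


section \<open>Integral functionals\<close>

text \<open>In \<^typ>\<open>ereal\<close>, \<open>\<infinity> + (-\<infinity>) = \<infinity>\<close>, and \<^const>\<open>e2ennreal\<close> sends negative numbers to 0, so the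
  two terms are the integrals of \<open>max g 0\<close> and \<open>min g 0\<close>. (For a non-measurable integrand
  \<^const>\<open>nn_integral\<close> is a lower integral; the functions \<open>t \<mapsto> f t (x t)\<close> and
  \<open>t \<mapsto> conjugate (f t) (x' t)\<close> are measurable when \<open>f\<close> is an admissible integrand and \<open>x\<close>, \<open>x'\<close>
  are strongly measurable, provided the measure is complete, sigma-finite and inner regular and
  measures all Borel sets.)\<close>

definition ext_integral :: "'t measure \<Rightarrow> ('t \<Rightarrow> ereal) \<Rightarrow> ereal" where
  "ext_integral M g =
     enn2ereal (\<integral>\<^sup>+t. e2ennreal (g t) \<partial>M) + (- enn2ereal (\<integral>\<^sup>+t. e2ennreal (- g t) \<partial>M))"

definition integral_functional :: "'t measure \<Rightarrow> ('t \<Rightarrow> 'z \<Rightarrow> ereal) \<Rightarrow> ('t \<Rightarrow> 'z) \<Rightarrow> ereal" where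
  "integral_functional M f x = ext_integral M (\<lambda>t. f t (x t))"


section \<open>Lebesgue-Bochner spaces and their duals\<close>

text \<open>The library's Bochner integral is restricted to second countable spaces; strong measurability
  is needed here with values in an arbitrary Banach space.\<close>

definition strongly_measurable :: "'t measure \<Rightarrow> ('t \<Rightarrow> 'z::topological_space) \<Rightarrow> bool" where
  "strongly_measurable M x \<longleftrightarrow>
     (\<exists>s. (\<forall>n::nat. simple_function M (s n)) \<and> (AE t in M. (\<lambda>n. s n t) \<longlonglongrightarrow> x t))"

text \<open>Elements of \<open>L\<^sup>p\<close> are represented by functions, not by classes modulo almost everywhere
  equality.\<close>

definition Lp :: "'t measure \<Rightarrow> ereal \<Rightarrow> ('t \<Rightarrow> 'z::real_normed_vector) set" where
  "Lp M p = {x. strongly_measurable M x \<and>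
     (if p = \<infinity> then \<exists>C. AE t in M. norm (x t) \<le> C
      else (\<integral>\<^sup>+t. ennreal (norm (x t) powr real_of_ereal p) \<partial>M) < \<infinity>)}"

definition Lp_norm :: "'t measure \<Rightarrow> real \<Rightarrow> ('t \<Rightarrow> 'z::real_normed_vector) \<Rightarrow> real" where
  "Lp_norm M p x = enn2real (\<integral>\<^sup>+t. ennreal (norm (x t) powr p) \<partial>M) powr (1 / p)"

text \<open>The dual of \<open>L\<^sup>p\<close> for finite \<open>p\<close>: the linear functionals bounded by a multiple of the
  (semi)norm. Boundedness makes them invariant under almost everywhere equality;
  \<^const>\<open>extensional\<close> makes a functional determined by its values on \<open>L\<^sup>p\<close>.\<close>

definition Lp_dual :: "'t measure \<Rightarrow> real \<Rightarrow> (('t \<Rightarrow> 'z::real_normed_vector) \<Rightarrow> real) set" where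
  "Lp_dual M p = {\<phi> \<in> extensional (Lp M (ereal p)).
     (\<forall>x\<in>Lp M (ereal p). \<forall>y\<in>Lp M (ereal p). \<phi> (\<lambda>t. x t + y t) = \<phi> x + \<phi> y) \<and>
     (\<forall>c. \<forall>x\<in>Lp M (ereal p). \<phi> (\<lambda>t. c *\<^sub>R x t) = c * \<phi> x) \<and>
     (\<exists>C. \<forall>x\<in>Lp M (ereal p). \<bar>\<phi> x\<bar> \<le> C * Lp_norm M p x)}"

text \<open>The canonical map from \<open>L\<^sup>q(T, X\<^sup>*)\<close> into the dual of \<open>L\<^sup>p(T, X)\<close>, through which the two are
  identified.\<close>

definition Lp_functional ::
  "'t measure \<Rightarrow> real \<Rightarrow> ('t \<Rightarrow> ('z::real_normed_vector \<Rightarrow>\<^sub>L real)) \<Rightarrow> (('t \<Rightarrow> 'z) \<Rightarrow> real)" where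
  "Lp_functional M p x' =
     restrict (\<lambda>x. \<integral>t. blinfun_apply (x' t) (x t) \<partial>M) (Lp M (ereal p))"

definition Lp_conjugate ::
  "'t measure \<Rightarrow> real \<Rightarrow> (('t \<Rightarrow> 'z::real_normed_vector) \<Rightarrow> ereal) \<Rightarrow> (('t \<Rightarrow> 'z) \<Rightarrow> real) \<Rightarrow> ereal" where
  "Lp_conjugate M p \<Psi> \<phi> = (SUP x\<in>Lp M (ereal p). ereal (\<phi> x) - \<Psi> x)"

definition Lp_eps_subdifferential ::
  "'t measure \<Rightarrow> real \<Rightarrow> (('t \<Rightarrow> 'z::real_normed_vector) \<Rightarrow> ereal) \<Rightarrow> real \<Rightarrow> ('t \<Rightarrow> 'z) \<Rightarrow>
   (('t \<Rightarrow> 'z) \<Rightarrow> real) set" where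
  "Lp_eps_subdifferential M p \<Psi> \<epsilon> x =
     (if \<bar>\<Psi> x\<bar> = \<infinity> then {}
      else {\<phi> \<in> Lp_dual M p.
              \<forall>y\<in>Lp M (ereal p). ereal (\<phi> (\<lambda>t. y t - x t)) \<le> \<Psi> y - \<Psi> x + ereal \<epsilon>})"

definition error_functions :: "'t measure \<Rightarrow> real \<Rightarrow> ('t \<Rightarrow> real) set" where
  "error_functions M \<epsilon> = {l. integrable M l \<and> (AE t in M. 0 \<le> l t) \<and> (\<integral>t. l t \<partial>M) \<le> \<epsilon>}"

end

theory Submission
  imports Defs
begin

text \<open>
  Both claims rest on the interchange of supremum and integral,
  \<open>sup \<integral> (x' t (x t) - f t (x t)) = \<integral> sup (x' t z - f t z)\<close>, where the first supremum is over \<open>x\<close> in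
  \<open>L\<^sup>p\<close> and the second one, for each \<open>t\<close>, over vectors \<open>z\<close>. The inequality \<open>\<le>\<close> is the integrated
  Fenchel--Young inequality (\<open>pairing_minus_integrand_le_conjugate\<close>). For \<open>\<ge>\<close>, take an integrable
  function \<open>\<beta>\<close> strictly below the conjugate whose integral is nearly the same
  (\<open>integrable_strict_minorant\<close>), choose \<open>x t\<close> measurably with \<open>x' t (x t) - f t (x t) \<ge> \<beta> t\<close>
  (\<open>conjugate_selection\<close>), and cut \<open>x\<close> off to an element of \<open>L\<^sup>p\<close> by means of the given \<open>u\<close>, at which
  the functional is not \<open>\<infinity>\<close> (\<open>less_conjugate_attained\<close>).

  The range space need not be separable, so the classical selection theorems do not apply. The
  following substitute works. The epigraphs of an admissible integrand are lower semicontinuous on large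
  compact sets, since lower semicontinuity passes from the members of the Lusin family to the closed
  union. Inner regularity then yields a Lindelof property: from every family of open sets countably
  many already meet the epigraph at almost every \<open>t\<close> at which some member of the family does
  (\<open>lindelof_measurable_if_Lusin_lsc\<close>). This is enough to construct a measurable selection as a limit
  of centres of nested balls, each depending on \<open>t\<close> through countably many values
  (\<open>lindelof_measurable_selection\<close>).

  The description of the \<open>\<epsilon>\<close>-subgradients of the form \<open>x'\<close> in \<open>L\<^sup>q\<close> follows from the conjugate formula,
  because the slack in the Fenchel--Young inequality at \<open>(x t, x' t)\<close> is the smallest admissible
  \<open>\<eta> t\<close> (\<open>Lp_functional_eps_subgradient_iff\<close>). It remains to see that every bounded functional on \<open>L\<^sup>p\<close>
  is of this form. A functional induces a vector measure with values in the dual space. In the dual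
  of an Asplund space every bounded set has slices, cut by a vector of the space itself, of
  arbitrarily small diameter (\<open>asplund_small_slice\<close>), and with an exhaustion argument this turns into
  partitions on which the vector measure has a nearly constant density
  (\<open>nearly_constant_density_partition\<close>). The limit of these densities represents the functional and is
  \<open>q\<close>-integrable (\<open>Lp_dual_representation\<close>).
\<close>

section \<open>Strong measurability\<close>
locale complete_sigma_finite_measure = sigma_finite_measure M + complete_measure M
  for M :: "'t measure" +
  assumes space_UNIV [simp]: "space M = UNIV"

text \<open>Every measurable choice below is among countably many alternatives, and is made by taking the
  first admissible one in an enumeration.\<close>
lemma countable_measurable_choice:
  assumes Q: "countable Q" "Q \<noteq> {}"
    and A: "\<And>q. q \<in> Q \<Longrightarrow> A q \<in> sets M" and sp: "space M = UNIV"
  obtains j where "j \<in> measurable M (count_space UNIV)" "range j \<subseteq> Q"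
    "\<And>t q. q \<in> Q \<Longrightarrow> t \<in> A q \<Longrightarrow> t \<in> A (j t)"
proof -
  define e where "e = from_nat_into Q"
  have eQ: "e n \<in> Q" for n unfolding e_def by (simp add: Q from_nat_into)
  define L where "L t = (LEAST n. t \<in> A (e n))" for t
  have [measurable]: "(\<lambda>t. t \<in> A (e n)) \<in> measurable M (count_space UNIV)" for n
    using A[OF eQ[of n]] sp by (simp add: pred_def)
  have L: "L \<in> measurable M (count_space UNIV)"
    unfolding L_def by measurable
  show ?thesis
  proof
    show "(\<lambda>t. e (L t)) \<in> measurable M (count_space UNIV)"
      using L by (rule measurable_compose) simp
    show "range (\<lambda>t. e (L t)) \<subseteq> Q" using eQ by auto
    fix t q assume "q \<in> Q" "t \<in> A q"
    then obtain n where "t \<in> A (e n)"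
      using from_nat_into_surj[OF Q(1)] unfolding e_def by metis
    then show "t \<in> A (e (L t))" unfolding L_def by (rule LeastI)
  qed
qed

lemma strongly_measurable_simple: "simple_function M s \<Longrightarrow> strongly_measurable M s"
  unfolding strongly_measurable_def by (intro exI[of _ "\<lambda>_. s"]) auto

lemma strongly_measurable_const [simp]: "strongly_measurable M (\<lambda>_. c)"
  by (rule strongly_measurable_simple) simp

lemma strongly_measurable_cong_AE:
  assumes "strongly_measurable M x" "AE t in M. x t = y t"
  shows "strongly_measurable M y"
proof -
  obtain s where "\<forall>n::nat. simple_function M (s n)" "AE t in M. (\<lambda>n. s n t) \<longlonglongrightarrow> x t"
    using assms(1) unfolding strongly_measurable_def by blast
  moreover from this(2) assms(2) have "AE t in M. (\<lambda>n. s n t) \<longlonglongrightarrow> y t"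
    by eventually_elim simp
  ultimately show ?thesis unfolding strongly_measurable_def by blast
qed

lemma strongly_measurable_continuous:
  assumes "strongly_measurable M x" "continuous_on UNIV g"
  shows "strongly_measurable M (\<lambda>t. g (x t))"
proof -
  obtain s where s: "\<forall>n::nat. simple_function M (s n)" "AE t in M. (\<lambda>n. s n t) \<longlonglongrightarrow> x t"
    using assms(1) unfolding strongly_measurable_def by blast
  from s(2) have "AE t in M. (\<lambda>n. g (s n t)) \<longlonglongrightarrow> g (x t)"
    by eventually_elim (rule continuous_on_tendsto_compose[OF assms(2)], auto)
  moreover have "\<forall>n. simple_function M (\<lambda>t. g (s n t))"
    using s(1) by (auto intro: simple_function_compose1)
  ultimately show ?thesis unfolding strongly_measurable_def by (intro exI[of _ "\<lambda>n t. g (s n t)"]) blast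
qed

lemma strongly_measurable_Pair:
  assumes "strongly_measurable M x" "strongly_measurable M y"
  shows "strongly_measurable M (\<lambda>t. (x t, y t))"
proof -
  obtain s where s: "\<forall>n::nat. simple_function M (s n)" "AE t in M. (\<lambda>n. s n t) \<longlonglongrightarrow> x t"
    using assms(1) unfolding strongly_measurable_def by blast
  obtain r where r: "\<forall>n::nat. simple_function M (r n)" "AE t in M. (\<lambda>n. r n t) \<longlonglongrightarrow> y t"
    using assms(2) unfolding strongly_measurable_def by blast
  from s(2) r(2) have "AE t in M. (\<lambda>n. (s n t, r n t)) \<longlonglongrightarrow> (x t, y t)"
    by eventually_elim (rule tendsto_Pair)
  moreover have "\<forall>n. simple_function M (\<lambda>t. (s n t, r n t))"
    using s(1) r(1) by (auto intro: simple_function_Pair)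
  ultimately show ?thesis unfolding strongly_measurable_def by (intro exI[of _ "\<lambda>n t. (s n t, r n t)"]) blast
qed

lemma strongly_measurable_continuous2:
  assumes "strongly_measurable M x" "strongly_measurable M y"
    "continuous_on UNIV (\<lambda>z. g (fst z) (snd z))"
  shows "strongly_measurable M (\<lambda>t. g (x t) (y t))"
  using strongly_measurable_continuous[OF strongly_measurable_Pair[OF assms(1,2)] assms(3)] by simp

lemma strongly_measurable_If:
  fixes x y :: "'t \<Rightarrow> 'z::topological_space"
  assumes "strongly_measurable M x" "strongly_measurable M y" "{t\<in>space M. P t} \<in> sets M"
  shows "strongly_measurable M (\<lambda>t. if P t then x t else y t)"
proof -
  obtain s where s: "\<forall>n::nat. simple_function M (s n)" "AE t in M. (\<lambda>n. s n t) \<longlonglongrightarrow> x t"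
    using assms(1) unfolding strongly_measurable_def by blast
  obtain r where r: "\<forall>n::nat. simple_function M (r n)" "AE t in M. (\<lambda>n. r n t) \<longlonglongrightarrow> y t"
    using assms(2) unfolding strongly_measurable_def by blast
  from s(2) r(2) have "AE t in M. (\<lambda>n. if P t then s n t else r n t) \<longlonglongrightarrow> (if P t then x t else y t)"
    by eventually_elim auto
  moreover have "\<forall>n. simple_function M (\<lambda>t. if P t then s n t else r n t)"
    using s(1) r(1) assms(3) by (auto intro: simple_function_If)
  ultimately show ?thesis unfolding strongly_measurable_def by (intro exI[of _ "\<lambda>n t. if P t then s n t else r n t"]) blast
qed

lemma strongly_measurable_essentially_separable:
  assumes "strongly_measurable M (x :: 't \<Rightarrow> 'z::metric_space)"
  obtains C where "countable C" "C \<noteq> {}" "AE t in M. x t \<in> closure C"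
proof -
  obtain s where s: "\<forall>n::nat. simple_function M (s n)" "AE t in M. (\<lambda>n. s n t) \<longlonglongrightarrow> x t"
    using assms unfolding strongly_measurable_def by blast
  define C where "C = insert undefined (\<Union>n. s n ` space M)"
  have "countable C"
    unfolding C_def using s(1) by (intro countable_insert countable_UN) (auto intro: countable_finite simp: simple_function_def)
  moreover have "AE t in M. x t \<in> closure C"
    using s(2) AE_space
  proof eventually_elim
    case (elim t)
    have "\<forall>n. s n t \<in> C" using elim(2) unfolding C_def by auto
    with elim(1) show ?case unfolding closure_sequential by (intro exI[of _ "\<lambda>n. s n t"]) auto
  qed
  moreover have "C \<noteq> {}" unfolding C_def by simp
  ultimately show ?thesis using that by blast
qed

context complete_sigma_finite_measure
begin

lemma sets_cong_AE: "A \<in> sets M \<Longrightarrow> AE t in M. t \<in> A \<longleftrightarrow> t \<in> B \<Longrightarrow> B \<in> sets M"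
  by (rule in_sets_AE[of A B]) auto

lemma measurable_cong_AE':
  fixes x y :: "'t \<Rightarrow> 'z::topological_space"
  assumes "x \<in> borel_measurable M" "AE t in M. x t = y t" shows "y \<in> borel_measurable M"
proof (rule borel_measurableI)
  fix S :: "'z set" assume "open S"
  then have "x -` S \<in> sets M" using assms(1) by (auto simp: measurable_def)
  moreover from assms(2) have "AE t in M. t \<in> x -` S \<longleftrightarrow> t \<in> y -` S"
    by eventually_elim auto
  ultimately have "y -` S \<in> sets M" by (rule sets_cong_AE)
  then show "y -` S \<inter> space M \<in> sets M" by simp
qed

lemma borel_measurable_LIMSEQ_AE:
  fixes x :: "'t \<Rightarrow> 'z::metric_space"
  assumes s: "\<And>n. s n \<in> borel_measurable M" and lim: "AE t in M. (\<lambda>n. s n t) \<longlonglongrightarrow> x t"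
  shows "x \<in> borel_measurable M"
proof -
  define N where "N = {t. \<not> (\<lambda>n. s n t) \<longlonglongrightarrow> x t}"
  have N: "N \<in> null_sets M" using lim unfolding AE_iff_null_sets N_def by simp
  then have [measurable]: "N \<in> sets M" by auto
  define x' where "x' t = (if t \<in> N then undefined else x t)" for t
  have "x' \<in> borel_measurable M"
  proof (rule borel_measurable_LIMSEQ_metric)
    show "(\<lambda>t. if t \<in> N then undefined else s n t) \<in> borel_measurable M" for n
      using s[of n] by measurable
    show "(\<lambda>n. if t \<in> N then undefined else s n t) \<longlonglongrightarrow> x' t" for t
      unfolding x'_def N_def by auto
  qed
  moreover have "AE t in M. x' t = x t"
    using AE_not_in[OF N] by eventually_elim (simp add: x'_def)
  ultimately show ?thesis by (rule measurable_cong_AE')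
qed

lemma strongly_measurable_borel:
  fixes x :: "'t \<Rightarrow> 'z::metric_space"
  assumes "strongly_measurable M x" shows "x \<in> borel_measurable M"
proof -
  obtain s where s: "\<forall>n::nat. simple_function M (s n)" "AE t in M. (\<lambda>n. s n t) \<longlonglongrightarrow> x t"
    using assms unfolding strongly_measurable_def by blast
  show ?thesis
    by (rule borel_measurable_LIMSEQ_AE[OF borel_measurable_simple_function s(2)]) (use s(1) in blast)
qed

text \<open>Together with \<open>strongly_measurable_borel\<close> and
  \<open>strongly_measurable_essentially_separable\<close>, this characterizes strong measurability as Borel
  measurability with essentially separable range. The approximating simple functions send \<open>t\<close> to
  the nearest one of the first \<open>n\<close> points of \<open>C\<close>.\<close>
lemma strongly_measurableI:
  fixes x :: "'t \<Rightarrow> 'z::metric_space"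
  assumes x[measurable]: "x \<in> borel_measurable M" and C: "countable C" "AE t in M. x t \<in> closure C"
  shows "strongly_measurable M x"
proof (cases "C = {}")
  case True
  with C(2) have "AE t in M. False" by simp
  then have "AE t in M. undefined = x t" by eventually_elim simp
  then show ?thesis by (rule strongly_measurable_cong_AE[rotated]) simp
next
  case False
  define c where "c = from_nat_into C"
  define s where "s = rec_nat (\<lambda>t. c 0)
    (\<lambda>n sn t. if dist (x t) (c (Suc n)) < dist (x t) (sn t) then c (Suc n) else sn t)"
  have s0: "s 0 = (\<lambda>t. c 0)" and
    sS: "s (Suc n) = (\<lambda>t. if dist (x t) (c (Suc n)) < dist (x t) (s n t) then c (Suc n) else s n t)" for n
    unfolding s_def by auto
  have dc: "(\<lambda>t. dist (x t) z) \<in> borel_measurable M" for z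
    by (rule borel_measurable_continuous_on[OF _ x]) (intro continuous_intros)
  have ds: "simple_function M (s n) \<and> (\<lambda>t. dist (x t) (s n t)) \<in> borel_measurable M" for n
  proof (induction n)
    case 0 then show ?case unfolding s0 using dc by simp
  next
    case (Suc n)
    have [measurable]: "(\<lambda>t. dist (x t) (s n t)) \<in> borel_measurable M"
      "(\<lambda>t. dist (x t) (c (Suc n))) \<in> borel_measurable M" using Suc dc by auto
    have "simple_function M (s (Suc n))"
      unfolding sS
    proof (intro simple_function_If)
      show "{t \<in> space M. dist (x t) (c (Suc n)) < dist (x t) (s n t)} \<in> sets M" by measurable
    qed (use Suc in auto)
    moreover have "(\<lambda>t. min (dist (x t) (c (Suc n))) (dist (x t) (s n t))) \<in> borel_measurable M"
      by measurable
    then have "(\<lambda>t. dist (x t) (s (Suc n) t)) \<in> borel_measurable M"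
      by (rule measurable_cong[THEN iffD1, rotated]) (auto simp: sS)
    ultimately show ?case by blast
  qed
  have dle: "dist (x t) (s (n + k) t) \<le> dist (x t) (c n)" for n k t
  proof (induction k)
    case 0 then show ?case by (cases n) (auto simp: s0 sS)
  next
    case (Suc k) then show ?case by (auto simp: sS)
  qed
  have "AE t in M. (\<lambda>n. s n t) \<longlonglongrightarrow> x t"
    using C(2)
  proof eventually_elim
    case (elim t)
    show ?case
    proof (rule metric_LIMSEQ_I)
      fix e :: real assume "e > 0"
      then obtain z where "z \<in> C" "dist z (x t) < e"
        using elim unfolding closure_approachable by auto
      moreover then obtain n where "z = c n"
        unfolding c_def using from_nat_into_surj[OF C(1)] by metis
      ultimately have "dist (s m t) (x t) < e" if "m \<ge> n" for m
        using dle[of t n "m - n"] that by (simp add: dist_commute)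
      then show "\<exists>no. \<forall>n\<ge>no. dist (s n t) (x t) < e" by blast
    qed
  qed
  then show ?thesis unfolding strongly_measurable_def using ds by blast
qed

lemma strongly_measurable_countable:
  fixes x :: "'t \<Rightarrow> 'z::metric_space"
  assumes "x \<in> measurable M (count_space UNIV)" "countable (range x)"
  shows "strongly_measurable M x"
proof (rule strongly_measurableI[OF _ assms(2)])
  show "x \<in> borel_measurable M"
    using assms(1) by (auto simp: measurable_def)
  show "AE t in M. x t \<in> closure (range x)"
    by (rule AE_I2) (use closure_subset[of "range x"] in auto)
qed

lemma strongly_measurable_LIMSEQ:
  fixes x :: "'t \<Rightarrow> 'z::metric_space"
  assumes s: "\<And>n. strongly_measurable M (s n)" and lim: "AE t in M. (\<lambda>n. s n t) \<longlonglongrightarrow> x t"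
  shows "strongly_measurable M x"
proof -
  have "\<forall>n. \<exists>C. countable C \<and> (AE t in M. s n t \<in> closure C)"
    using strongly_measurable_essentially_separable[OF s] by metis
  then obtain C where C: "\<And>n. countable (C n)" "\<And>n. AE t in M. s n t \<in> closure (C n)" by metis
  show ?thesis
  proof (rule strongly_measurableI)
    show "x \<in> borel_measurable M"
      by (rule borel_measurable_LIMSEQ_AE[OF strongly_measurable_borel[OF s] lim])
    show "countable (\<Union>n. C n)" using C by auto
    from C(2) have "AE t in M. \<forall>n. s n t \<in> closure (C n)" by (simp add: AE_all_countable)
    with lim show "AE t in M. x t \<in> closure (\<Union>n. C n)"
    proof eventually_elim
      case (elim t)
      have "s n t \<in> closure (\<Union>n. C n)" for n
        using elim(2) closure_mono[of "C n" "\<Union>n. C n"] by auto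
      then show ?case by (rule closed_sequentially[OF closed_closure _ elim(1)])
    qed
  qed
qed

end

section \<open>Measurable selections without separability\<close>

text \<open>A condition on multifunctions that replaces separability of the range space. The first part is
  weak measurability. The second part, a Lindelof property up to null sets, is what makes countably
  many open sets suffice in the construction of selections.\<close>
definition lindelof_measurable :: "'t measure \<Rightarrow> ('t \<Rightarrow> 'z::topological_space set) \<Rightarrow> bool" where
  "lindelof_measurable M \<Phi> \<longleftrightarrow>
     (\<forall>V. open V \<longrightarrow> {t. \<Phi> t \<inter> V \<noteq> {}} \<in> sets M) \<and>
     (\<forall>\<V>. (\<forall>V\<in>\<V>. open V) \<longrightarrow>
        (\<exists>\<V>'\<subseteq>\<V>. countable \<V>' \<and>
           (AE t in M. (\<exists>V\<in>\<V>. \<Phi> t \<inter> V \<noteq> {}) \<longrightarrow> (\<exists>V\<in>\<V>'. \<Phi> t \<inter> V \<noteq> {}))))"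

text \<open>An open set \<open>W\<close> in a product is covered, over a separable set of first coordinates, by countably
  many products: the second factor is the largest open set whose product with a given small ball is
  contained in \<open>W\<close>.\<close>
lemma countable_cover_by_rectangles:
  fixes y :: "'y::metric_space" and W :: "('y \<times> 'z::metric_space) set"
  assumes W: "open W" "(y, z) \<in> W" and y: "y \<in> closure C"
  obtains c n where "c \<in> C" "y \<in> ball c (1 / real (Suc n))"
    "z \<in> \<Union>{G. open G \<and> ball c (1 / real (Suc n)) \<times> G \<subseteq> W}"
proof -
  obtain A B where AB: "open A" "open B" "(y, z) \<in> A \<times> B" "A \<times> B \<subseteq> W"
    using open_prod_elim[OF W] by metis
  then obtain e where e: "e > 0" "ball y e \<subseteq> A" using openE by blast
  obtain n where n: "inverse (real (Suc n)) < e / 2"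
    using reals_Archimedean[of "e/2"] e by auto
  then have n': "1 / real (Suc n) < e / 2" by (simp add: inverse_eq_divide)
  obtain c where c: "c \<in> C" "dist c y < 1 / real (Suc n)"
    using y unfolding closure_approachable by (metis of_nat_0_less_iff zero_less_Suc zero_less_divide_1_iff)
  have "ball c (1 / real (Suc n)) \<subseteq> ball y e"
  proof
    fix w assume "w \<in> ball c (1 / real (Suc n))"
    then have "dist c w < 1 / real (Suc n)" by simp
    with c n' dist_triangle[of y w c] show "w \<in> ball y e" by (simp add: dist_commute)
  qed
  then have "ball c (1 / real (Suc n)) \<times> B \<subseteq> W" using e AB by blast
  with AB c show ?thesis by (intro that[of c n]) auto
qed

context complete_sigma_finite_measure
begin

text \<open>One step in the construction of a selection. The open set \<open>V t\<close>, which meets \<open>\<Phi> t\<close>, is replaced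
  by a small ball inside it that still meets \<open>\<Phi> t\<close>. As \<open>V\<close> takes countably many values, the Lindelof
  property offers countably many balls to choose from.\<close>
lemma lindelof_measurable_shrink:
  fixes \<Phi> :: "'t \<Rightarrow> 'z::metric_space set"
  assumes \<Phi>: "lindelof_measurable M \<Phi>"
    and V: "V \<in> measurable M (count_space UNIV)" "countable (range V)" "\<And>t. open (V t)"
    and ne: "AE t in M. t \<in> E \<longrightarrow> \<Phi> t \<inter> V t \<noteq> {}" and e: "0 < (\<epsilon>::real)"
  obtains c r where "(\<lambda>t. (c t, r t)) \<in> measurable M (count_space UNIV)" "countable (range (\<lambda>t. (c t, r t)))"
    "AE t in M. t \<in> E \<longrightarrow>
       cball (c t) (r t) \<subseteq> V t \<and> r t \<le> \<epsilon> \<and> \<Phi> t \<inter> ball (c t) (r t) \<noteq> {}"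
proof -
  define P where "P U = {(c, r). r \<le> \<epsilon> \<and> cball c r \<subseteq> U}" for U :: "'z set"
  have "\<exists>P'\<subseteq>P U. countable P' \<and> (AE t in M. (\<exists>(c, r)\<in>P U. \<Phi> t \<inter> ball c r \<noteq> {}) \<longrightarrow>
           (\<exists>(c, r)\<in>P'. \<Phi> t \<inter> ball c r \<noteq> {}))" for U
  proof -
    let ?b = "\<lambda>(c, r). ball c r"
    have "open V" if "V \<in> ?b ` P U" for V using that by auto
    then obtain \<V> where \<V>: "\<V> \<subseteq> ?b ` P U" "countable \<V>"
      "AE t in M. (\<exists>V\<in>?b ` P U. \<Phi> t \<inter> V \<noteq> {}) \<longrightarrow> (\<exists>V\<in>\<V>. \<Phi> t \<inter> V \<noteq> {})"
      using \<Phi>[unfolded lindelof_measurable_def, THEN conjunct2, rule_format, of "?b ` P U"] by blast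
    obtain P' where P': "P' \<subseteq> P U" "countable P'" "\<V> = ?b ` P'"
      using iffD1[OF countable_subset_image[of \<V> ?b "P U"], OF conjI[OF \<V>(2,1)]] by metis
    from \<V>(3) have "AE t in M. (\<exists>(c, r)\<in>P U. \<Phi> t \<inter> ball c r \<noteq> {}) \<longrightarrow>
           (\<exists>(c, r)\<in>P'. \<Phi> t \<inter> ball c r \<noteq> {})"
      unfolding P'(3) by eventually_elim (simp add: case_prod_beta)
    with P'(1,2) show ?thesis by (intro exI[of _ P'] conjI)
  qed
  then have "\<exists>P'. \<forall>U. P' U \<subseteq> P U \<and> countable (P' U) \<and>
      (AE t in M. (\<exists>(c, r)\<in>P U. \<Phi> t \<inter> ball c r \<noteq> {}) \<longrightarrow>
           (\<exists>(c, r)\<in>P' U. \<Phi> t \<inter> ball c r \<noteq> {}))"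
    by (intro choice allI)
  then obtain P' where P'0: "\<forall>U. P' U \<subseteq> P U \<and> countable (P' U) \<and>
      (AE t in M. (\<exists>(c, r)\<in>P U. \<Phi> t \<inter> ball c r \<noteq> {}) \<longrightarrow>
           (\<exists>(c, r)\<in>P' U. \<Phi> t \<inter> ball c r \<noteq> {}))" ..
  note P' = P'0[rule_format, THEN conjunct1] P'0[rule_format, THEN conjunct2, THEN conjunct1]
    P'0[rule_format, THEN conjunct2, THEN conjunct2]
  \<comment> \<open>A ball of radius 0 is empty; it makes the index set nonempty.\<close>
  define Q where "Q = insert (UNIV, undefined, 0) (SIGMA U:range V. P' U)"
  define A where "A = (\<lambda>(U, c, r). {t. V t = U} \<inter> {t. \<Phi> t \<inter> ball c r \<noteq> {}})"
  have Q: "countable Q" "Q \<noteq> {}" unfolding Q_def using V P' by auto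
  have A: "A q \<in> sets M" for q
  proof -
    obtain U c r where q: "q = (U, c, r)" by (cases q)
    have "V -` {U} \<inter> space M \<in> sets M" by (rule measurable_sets[OF V(1)]) simp
    moreover have "V -` {U} = {t. V t = U}" by auto
    moreover have "{t. \<Phi> t \<inter> ball c r \<noteq> {}} \<in> sets M"
      using \<Phi> unfolding lindelof_measurable_def by blast
    ultimately show ?thesis unfolding A_def q by auto
  qed
  obtain j where j: "j \<in> measurable M (count_space UNIV)" "range j \<subseteq> Q"
    "\<And>t q. q \<in> Q \<Longrightarrow> t \<in> A q \<Longrightarrow> t \<in> A (j t)"
    using countable_measurable_choice[of Q A M, OF Q A space_UNIV] by metis
  define c where "c t = fst (snd (j t))" for t
  define r where "r t = snd (snd (j t))" for t
  have cr: "(\<lambda>t. (c t, r t)) = (\<lambda>t. snd (j t))" unfolding c_def r_def by auto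
  show ?thesis
  proof
    show "(\<lambda>t. (c t, r t)) \<in> measurable M (count_space UNIV)"
      unfolding cr using j(1) by (rule measurable_compose) simp
    have "range (\<lambda>t. (c t, r t)) \<subseteq> snd ` Q" unfolding cr using j(2) by auto
    then show "countable (range (\<lambda>t. (c t, r t)))" using Q(1) countable_subset by blast
    have "AE t in M. \<forall>U\<in>range V. (\<exists>(c, r)\<in>P U. \<Phi> t \<inter> ball c r \<noteq> {}) \<longrightarrow>
            (\<exists>(c, r)\<in>P' U. \<Phi> t \<inter> ball c r \<noteq> {})"
      by (rule AE_ball_countable'[OF _ V(2)]) (rule P'(3))
    with ne show "AE t in M. t \<in> E \<longrightarrow>
       cball (c t) (r t) \<subseteq> V t \<and> r t \<le> \<epsilon> \<and> \<Phi> t \<inter> ball (c t) (r t) \<noteq> {}"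
    proof (eventually_elim, intro impI)
      fix t assume h: "t \<in> E \<longrightarrow> \<Phi> t \<inter> V t \<noteq> {}"
        "\<forall>U\<in>range V. (\<exists>(c, r)\<in>P U. \<Phi> t \<inter> ball c r \<noteq> {}) \<longrightarrow> (\<exists>(c, r)\<in>P' U. \<Phi> t \<inter> ball c r \<noteq> {})"
        and "t \<in> E"
      then obtain z where z: "z \<in> \<Phi> t" "z \<in> V t" by auto
      obtain d where d: "d > 0" "cball z d \<subseteq> V t" using open_contains_cball V(3) z by metis
      have "(z, min d \<epsilon>) \<in> P (V t)" unfolding P_def using d by auto
      moreover have "\<Phi> t \<inter> ball z (min d \<epsilon>) \<noteq> {}" using z d e by auto
      ultimately have "\<exists>(c, r)\<in>P' (V t). \<Phi> t \<inter> ball c r \<noteq> {}" using h(2) by blast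
      then obtain c' r' where "(c', r') \<in> P' (V t)" "\<Phi> t \<inter> ball c' r' \<noteq> {}" by auto
      then have "(V t, c', r') \<in> Q" "t \<in> A (V t, c', r')" unfolding Q_def A_def by auto
      then have jt: "t \<in> A (j t)" by (rule j(3))
      obtain U where U: "j t = (U, c t, r t)" unfolding c_def r_def by (cases "j t") auto
      have ball: "V t = U" "\<Phi> t \<inter> ball (c t) (r t) \<noteq> {}" using jt unfolding U A_def by auto
      then have "r t \<noteq> 0" by auto
      moreover have "j t \<in> Q" using j(2) by auto
      ultimately have "(c t, r t) \<in> P' (V t)" using U ball unfolding Q_def by auto
      then have "(c t, r t) \<in> P (V t)" using P' by auto
      then show "cball (c t) (r t) \<subseteq> V t \<and> r t \<le> \<epsilon> \<and> \<Phi> t \<inter> ball (c t) (r t) \<noteq> {}"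
        using ball unfolding P_def by auto
    qed
  qed
qed

text \<open>Iterated shrinking gives nested balls that meet \<open>\<Phi> t\<close>. Their centres depend on \<open>t\<close> through
  countably many values and converge; the limit belongs to \<open>\<Phi> t\<close>, which is closed, and stays in the
  first closed ball, hence in \<open>V t\<close>.\<close>
lemma lindelof_measurable_selection_open:
  fixes \<Phi> :: "'t \<Rightarrow> 'z::complete_space set"
  assumes \<Phi>: "lindelof_measurable M \<Phi>" and cl: "\<And>t. closed (\<Phi> t)"
    and V: "V \<in> measurable M (count_space UNIV)" "countable (range V)" "\<And>t. open (V t)"
    and ne: "AE t in M. t \<in> E \<longrightarrow> \<Phi> t \<inter> V t \<noteq> {}" and E: "E \<in> sets M"
  obtains z where "strongly_measurable M z" "AE t in M. t \<in> E \<longrightarrow> z t \<in> \<Phi> t \<inter> V t"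
proof -
  define P where "P n q \<longleftrightarrow> q \<in> measurable M (count_space UNIV) \<and> countable (range q) \<and>
     (AE t in M. t \<in> E \<longrightarrow> cball (fst (q t)) (snd (q t)) \<subseteq> V t \<and> snd (q t) \<le> (1/2)^n \<and>
        \<Phi> t \<inter> ball (fst (q t)) (snd (q t)) \<noteq> {})" for n :: nat and q :: "'t \<Rightarrow> 'z \<times> real"
  define R where "R (n::nat) q q' \<longleftrightarrow>
     (AE t in M. t \<in> E \<longrightarrow> cball (fst (q' t)) (snd (q' t)) \<subseteq> ball (fst (q t)) (snd (q t)))"
    for n and q q' :: "'t \<Rightarrow> 'z \<times> real"
  have "\<exists>q. \<forall>n. P n (q n) \<and> R n (q n) (q (Suc n))"
  proof (rule dependent_nat_choice)
    obtain c r where "(\<lambda>t. (c t, r t)) \<in> measurable M (count_space UNIV)"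
      "countable (range (\<lambda>t. (c t, r t)))"
      "AE t in M. t \<in> E \<longrightarrow> cball (c t) (r t) \<subseteq> V t \<and> r t \<le> (1/2)^0 \<and> \<Phi> t \<inter> ball (c t) (r t) \<noteq> {}"
      by (rule lindelof_measurable_shrink[OF \<Phi> V ne, of "(1/2)^0"]) auto
    then show "\<exists>q. P 0 q" unfolding P_def by (intro exI[of _ "\<lambda>t. (c t, r t)"]) auto
  next
    fix q and n :: nat assume q: "P n q"
    have 1: "(\<lambda>t. ball (fst (q t)) (snd (q t))) \<in> measurable M (count_space UNIV)"
      using q unfolding P_def by (auto intro: measurable_compose)
    have 2: "countable (range (\<lambda>t. ball (fst (q t)) (snd (q t))))"
    proof -
      have "range (\<lambda>t. ball (fst (q t)) (snd (q t))) = (\<lambda>p. ball (fst p) (snd p)) ` range q" by auto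
      then show ?thesis using q unfolding P_def by simp
    qed
    have 3: "AE t in M. t \<in> E \<longrightarrow> \<Phi> t \<inter> ball (fst (q t)) (snd (q t)) \<noteq> {}"
      using q unfolding P_def by auto
    obtain c r where cr: "(\<lambda>t. (c t, r t)) \<in> measurable M (count_space UNIV)"
      "countable (range (\<lambda>t. (c t, r t)))"
      "AE t in M. t \<in> E \<longrightarrow> cball (c t) (r t) \<subseteq> ball (fst (q t)) (snd (q t)) \<and> r t \<le> (1/2)^Suc n \<and>
         \<Phi> t \<inter> ball (c t) (r t) \<noteq> {}"
      by (rule lindelof_measurable_shrink[OF \<Phi> 1 2 _ 3, of "(1/2)^Suc n"]) auto
    have "AE t in M. t \<in> E \<longrightarrow> cball (fst (q t)) (snd (q t)) \<subseteq> V t" using q unfolding P_def by auto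
    with cr(3) have "AE t in M. t \<in> E \<longrightarrow> cball (c t) (r t) \<subseteq> V t \<and> r t \<le> (1/2)^Suc n \<and>
         \<Phi> t \<inter> ball (c t) (r t) \<noteq> {}"
      by eventually_elim (use ball_subset_cball in blast)
    with cr show "\<exists>q'. P (Suc n) q' \<and> R n q q'"
      unfolding P_def R_def by (intro exI[of _ "\<lambda>t. (c t, r t)"]) auto
  qed
  then obtain q where q: "\<And>n. P n (q n)" "\<And>n. R n (q n) (q (Suc n))" by blast
  define c where "c n t = fst (q n t)" for n t
  define r where "r n t = snd (q n t)" for n t
  have c: "strongly_measurable M (c n)" for n
  proof (rule strongly_measurable_countable)
    show "c n \<in> measurable M (count_space UNIV)"
      using q(1)[of n] unfolding P_def c_def by (auto intro: measurable_compose)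
    have "range (c n) = fst ` range (q n)" unfolding c_def by auto
    then show "countable (range (c n))" using q(1)[of n] unfolding P_def by simp
  qed
  have "AE t in M. \<forall>n. t \<in> E \<longrightarrow> cball (c n t) (r n t) \<subseteq> V t \<and> r n t \<le> (1/2)^n \<and>
          \<Phi> t \<inter> ball (c n t) (r n t) \<noteq> {}"
    unfolding AE_all_countable using q(1) unfolding P_def c_def r_def by auto
  moreover have "AE t in M. \<forall>n. t \<in> E \<longrightarrow> cball (c (Suc n) t) (r (Suc n) t) \<subseteq> ball (c n t) (r n t)"
    unfolding AE_all_countable using q(2) unfolding R_def c_def r_def by auto
  ultimately have ae: "AE t in M. t \<in> E \<longrightarrow>
      (\<exists>z. (\<lambda>n. c n t) \<longlonglongrightarrow> z \<and> z \<in> \<Phi> t \<inter> V t)"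
  proof (eventually_elim, intro impI)
    fix t assume h: "\<forall>n. t \<in> E \<longrightarrow> cball (c n t) (r n t) \<subseteq> V t \<and> r n t \<le> (1/2)^n \<and>
          \<Phi> t \<inter> ball (c n t) (r n t) \<noteq> {}"
      "\<forall>n. t \<in> E \<longrightarrow> cball (c (Suc n) t) (r (Suc n) t) \<subseteq> ball (c n t) (r n t)" and t: "t \<in> E"
    define B where "B n = cball (c n t) (r n t)" for n
    have h1: "\<And>n. B n \<subseteq> V t" "\<And>n. r n t \<le> (1/2)^n" "\<And>n. \<Phi> t \<inter> ball (c n t) (r n t) \<noteq> {}"
      "\<And>n. B (Suc n) \<subseteq> B n" using h t ball_subset_cball unfolding B_def by blast+
    have decr: "B m \<subseteq> B n" if "n \<le> m" for n m
      using lift_Suc_antimono_le[of B, OF h1(4) that] .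
    have rpos: "0 < r n t" for n
    proof (rule ccontr)
      assume "\<not> 0 < r n t" then have "ball (c n t) (r n t) = {}" by simp
      with h1(3)[of n] show False by auto
    qed
    then have cB: "c m t \<in> B n" if "n \<le> m" for n m
      using subsetD[OF decr[OF that], of "c m t"] rpos[of m] unfolding B_def by simp
    have "Cauchy (\<lambda>n. c n t)"
    proof (rule metric_CauchyI)
      fix e :: real assume "e > 0"
      then obtain N where N: "(1/2)^N < e / 2" using real_arch_pow_inv[of "e/2" "1/2"] by auto
      have "dist (c m t) (c n t) < e" if "N \<le> m" "N \<le> n" for m n
      proof -
        have "dist (c N t) (c m t) \<le> r N t" "dist (c N t) (c n t) \<le> r N t"
          using cB[OF that(1)] cB[OF that(2)] unfolding B_def by simp_all
        with dist_triangle3[of "c m t" "c n t" "c N t"] N h1(2)[of N] show ?thesis by linarith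
      qed
      then show "\<exists>N. \<forall>m\<ge>N. \<forall>n\<ge>N. dist (c m t) (c n t) < e" by blast
    qed
    then obtain z where z: "(\<lambda>n. c n t) \<longlonglongrightarrow> z" using Cauchy_convergent_iff convergent_def by blast
    have "z \<in> B 0" unfolding B_def
      by (rule closed_sequentially[OF closed_cball _ z]) (use cB in \<open>auto simp: B_def\<close>)
    then have "z \<in> V t" using h1(1) by blast
    have "\<forall>n. \<exists>w. w \<in> \<Phi> t \<and> dist (c n t) w < r n t" using h1(3) by (auto simp: ball_def)
    then obtain w where w: "\<And>n. w n \<in> \<Phi> t" "\<And>n. dist (c n t) (w n) < r n t" by metis
    have "(\<lambda>n. dist (c n t) (w n)) \<longlonglongrightarrow> 0"
    proof (rule tendsto_sandwich[OF _ _ tendsto_const])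
      show "(\<lambda>n. (1/2)^n :: real) \<longlonglongrightarrow> 0" by (rule LIMSEQ_power_zero) simp
      show "\<forall>\<^sub>F n in sequentially. dist (c n t) (w n) \<le> (1/2)^n"
        using w(2) h1(2) by (intro always_eventually allI) (meson less_imp_le order_trans)
    qed auto
    then have "(\<lambda>n. dist (c n t) (w n) + dist (c n t) z) \<longlonglongrightarrow> 0"
      using z by (intro tendsto_add_zero) (simp_all add: tendsto_dist_iff[symmetric])
    then have "w \<longlonglongrightarrow> z"
      unfolding tendsto_dist_iff[of w]
      by (rule tendsto_0_le[where K = 1])
        (auto intro!: always_eventually simp: dist_triangle3[of _ _ "c _ t"])
    then have "z \<in> \<Phi> t" by (rule closed_sequentially[OF cl w(1)])
    with \<open>z \<in> V t\<close> z show "\<exists>z. (\<lambda>n. c n t) \<longlonglongrightarrow> z \<and> z \<in> \<Phi> t \<inter> V t" by blast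
  qed
  define z where "z t = (if t \<in> E then lim (\<lambda>n. c n t) else undefined)" for t
  show ?thesis
  proof
    have 1: "strongly_measurable M (\<lambda>t. if t \<in> E then c n t else undefined)" for n
      by (rule strongly_measurable_If) (use c E in auto)
    show "strongly_measurable M z"
    proof (rule strongly_measurable_LIMSEQ[OF 1])
      from ae show "AE t in M. (\<lambda>n. if t \<in> E then c n t else undefined) \<longlonglongrightarrow> z t"
        by eventually_elim (auto simp: z_def limI)
    qed
    from ae show "AE t in M. t \<in> E \<longrightarrow> z t \<in> \<Phi> t \<inter> V t"
      by eventually_elim (auto simp: z_def limI)
  qed
qed

text \<open>A condition on the pair \<open>(y t, z)\<close> is turned into countably many conditions on \<open>z\<close> alone, because
  the range of \<open>y\<close> is essentially separable.\<close>
lemma rectangle_index: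
  fixes \<Phi> :: "'t \<Rightarrow> 'z::metric_space set" and y :: "'t \<Rightarrow> 'y::metric_space"
  assumes \<Phi>: "lindelof_measurable M \<Phi>" and y: "strongly_measurable M y" and W: "open W"
  obtains Q :: "('y \<times> nat) set" and A :: "'y \<times> nat \<Rightarrow> 't set" and U :: "'y \<times> nat \<Rightarrow> 'z set"
  where "countable Q" "Q \<noteq> {}" "\<And>q. A q \<in> sets M" "\<And>q. open (U q)"
    "\<And>q t. t \<in> A q \<Longrightarrow> \<Phi> t \<inter> U q \<noteq> {}" "\<And>q t z. t \<in> A q \<Longrightarrow> z \<in> U q \<Longrightarrow> (y t, z) \<in> W"
    "AE t in M. (\<exists>z\<in>\<Phi> t. (y t, z) \<in> W) \<longrightarrow> (\<exists>q\<in>Q. t \<in> A q)"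
proof -
  obtain C where C: "countable C" "C \<noteq> {}" "AE t in M. y t \<in> closure C"
    using strongly_measurable_essentially_separable[OF y] by metis
  define b where "b = (\<lambda>(c::'y, n). ball c (1 / real (Suc n)))"
  define U where "U q = \<Union>{G. open G \<and> b q \<times> G \<subseteq> W}" for q
  define A where "A q = {t. y t \<in> b q} \<inter> {t. \<Phi> t \<inter> U q \<noteq> {}}" for q
  have U: "open (U q)" for q unfolding U_def by auto
  show ?thesis
  proof (rule that[of "C \<times> UNIV" A U])
    show "A q \<in> sets M" for q
    proof -
      have "y -` b q \<inter> space M \<in> sets M"
        by (rule measurable_sets[OF strongly_measurable_borel[OF y]]) (auto simp: b_def split: prod.split)
      moreover have "{t. \<Phi> t \<inter> U q \<noteq> {}} \<in> sets M"
        using \<Phi> U unfolding lindelof_measurable_def by blast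
      ultimately show ?thesis unfolding A_def vimage_def by auto
    qed
    show "AE t in M. (\<exists>z\<in>\<Phi> t. (y t, z) \<in> W) \<longrightarrow> (\<exists>q\<in>C \<times> UNIV. t \<in> A q)"
      using C(3)
    proof (eventually_elim, intro impI)
      fix t assume "y t \<in> closure C" "\<exists>z\<in>\<Phi> t. (y t, z) \<in> W"
      then obtain z where z: "z \<in> \<Phi> t" "(y t, z) \<in> W" by blast
      obtain c n where "c \<in> C" "y t \<in> b (c, n)" "z \<in> U (c, n)"
        using countable_cover_by_rectangles[OF W z(2) \<open>y t \<in> closure C\<close>] unfolding b_def U_def by auto
      with z show "\<exists>q\<in>C \<times> UNIV. t \<in> A q" unfolding A_def by blast
    qed
  qed (use C U in \<open>auto simp: A_def U_def\<close>)
qed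

lemma lindelof_measurable_parametric_hit:
  fixes \<Phi> :: "'t \<Rightarrow> 'z::metric_space set" and y :: "'t \<Rightarrow> 'y::metric_space"
  assumes \<Phi>: "lindelof_measurable M \<Phi>" and y: "strongly_measurable M y" and W: "open W"
  shows "{t. \<exists>z\<in>\<Phi> t. (y t, z) \<in> W} \<in> sets M"
proof -
  obtain Q :: "('y \<times> nat) set" and A :: "'y \<times> nat \<Rightarrow> 't set" and U :: "'y \<times> nat \<Rightarrow> 'z set"
    where Q: "countable Q" "Q \<noteq> {}" "\<And>q. A q \<in> sets M" "\<And>q. open (U q)"
    "\<And>q t. t \<in> A q \<Longrightarrow> \<Phi> t \<inter> U q \<noteq> {}" "\<And>q t z. t \<in> A q \<Longrightarrow> z \<in> U q \<Longrightarrow> (y t, z) \<in> W"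
    "AE t in M. (\<exists>z\<in>\<Phi> t. (y t, z) \<in> W) \<longrightarrow> (\<exists>q\<in>Q. t \<in> A q)"
    using rectangle_index[OF assms] by blast
  have "(\<Union>q\<in>Q. A q) \<in> sets M" using Q by (intro sets.countable_UN') auto
  then show ?thesis
  proof (rule sets_cong_AE)
    show "AE t in M. t \<in> (\<Union>q\<in>Q. A q) \<longleftrightarrow> t \<in> {t. \<exists>z\<in>\<Phi> t. (y t, z) \<in> W}"
      using Q(7)
    proof eventually_elim
      case (elim t)
      have "\<exists>z\<in>\<Phi> t. (y t, z) \<in> W" if "t \<in> A q" for q
        using Q(5)[OF that] Q(6)[OF that] by blast
      with elim show ?case by blast
    qed
  qed
qed

theorem lindelof_measurable_selection:
  fixes \<Phi> :: "'t \<Rightarrow> 'z::complete_space set" and y :: "'t \<Rightarrow> 'y::metric_space"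
  assumes \<Phi>: "lindelof_measurable M \<Phi>" and cl: "\<And>t. closed (\<Phi> t)"
    and y: "strongly_measurable M y" and W: "open W" and E: "E \<in> sets M"
    and ne: "AE t in M. t \<in> E \<longrightarrow> (\<exists>z\<in>\<Phi> t. (y t, z) \<in> W)"
  obtains z where "strongly_measurable M z" "AE t in M. t \<in> E \<longrightarrow> z t \<in> \<Phi> t \<and> (y t, z t) \<in> W"
proof -
  obtain Q :: "('y \<times> nat) set" and A :: "'y \<times> nat \<Rightarrow> 't set" and U :: "'y \<times> nat \<Rightarrow> 'z set"
    where Q: "countable Q" "Q \<noteq> {}" "\<And>q. A q \<in> sets M" "\<And>q. open (U q)"
    "\<And>q t. t \<in> A q \<Longrightarrow> \<Phi> t \<inter> U q \<noteq> {}" "\<And>q t z. t \<in> A q \<Longrightarrow> z \<in> U q \<Longrightarrow> (y t, z) \<in> W"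
    "AE t in M. (\<exists>z\<in>\<Phi> t. (y t, z) \<in> W) \<longrightarrow> (\<exists>q\<in>Q. t \<in> A q)"
    using rectangle_index[OF \<Phi> y W] by blast
  obtain j where j: "j \<in> measurable M (count_space UNIV)" "range j \<subseteq> Q"
    "\<And>t q. q \<in> Q \<Longrightarrow> t \<in> A q \<Longrightarrow> t \<in> A (j t)"
    using countable_measurable_choice[of Q A M, OF Q(1,2,3) space_UNIV] by metis
  have 1: "(\<lambda>t. U (j t)) \<in> measurable M (count_space UNIV)"
    using j(1) by (rule measurable_compose) simp
  have 2: "countable (range (\<lambda>t. U (j t)))"
  proof (rule countable_subset)
    show "range (\<lambda>t. U (j t)) \<subseteq> U ` Q" using j(2) by auto
  qed (use Q in auto)
  from ne Q(7) have A: "AE t in M. t \<in> E \<longrightarrow> t \<in> A (j t)"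
    by eventually_elim (use j(3) in blast)
  then have 3: "AE t in M. t \<in> E \<longrightarrow> \<Phi> t \<inter> U (j t) \<noteq> {}"
    by eventually_elim (use Q(5) in blast)
  obtain z where z: "strongly_measurable M z" "AE t in M. t \<in> E \<longrightarrow> z t \<in> \<Phi> t \<inter> U (j t)"
    using lindelof_measurable_selection_open[OF \<Phi> cl 1 2 Q(4) 3 E] by metis
  from z(2) A have "AE t in M. t \<in> E \<longrightarrow> z t \<in> \<Phi> t \<and> (y t, z t) \<in> W"
    by eventually_elim (use Q(6) in blast)
  with z(1) show ?thesis by (rule that)
qed

end

section \<open>Epigraphs of integrands\<close>
lemma (in complete_sigma_finite_measure) null_sets_if_small:
  assumes "S \<in> sets M" "\<And>\<epsilon>::real. \<epsilon> > 0 \<Longrightarrow> emeasure M S < ennreal \<epsilon>"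
  shows "S \<in> null_sets M"
proof -
  have "emeasure M S \<le> 0"
  proof (rule ennreal_le_epsilon)
    fix e :: real assume "0 < e" then show "emeasure M S \<le> 0 + ennreal e"
      using assms(2) by (simp add: less_imp_le)
  qed
  then show ?thesis using assms(1) by (auto simp: null_sets_def)
qed

locale complete_Radon_measure = complete_sigma_finite_measure M
  for M :: "'t::metric_space measure" +
  assumes borel_sets: "sets borel \<subseteq> sets M" and inner_regular: "inner_regular M"
begin

lemma sets_closed: "closed K \<Longrightarrow> K \<in> sets M" and sets_open: "open K \<Longrightarrow> K \<in> sets M"
  using borel_sets borel_closed borel_open by blast+

text \<open>If \<open>\<Phi>\<close> is lower semicontinuous on a compact set \<open>B\<close>, then the points of \<open>B\<close> at which \<open>\<Phi>\<close> meets
  some member of \<open>\<V>\<close> form a relatively open set. By inner regularity compact sets exhaust it up to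
  a null set, and each of them needs only finitely many members of \<open>\<V>\<close>.\<close>
lemma lindelof_measurable_if_Lusin_lsc:
  fixes \<Phi> :: "'t \<Rightarrow> 'z::topological_space set"
  assumes Lusin: "\<And>\<epsilon> A. \<epsilon> > 0 \<Longrightarrow> A \<in> sets M \<Longrightarrow> emeasure M A < \<infinity> \<Longrightarrow>
     \<exists>B. compact B \<and> B \<subseteq> A \<and> emeasure M (A - B) < ennreal \<epsilon> \<and> lsc_multifunction_on B \<Phi>"
  shows "lindelof_measurable M \<Phi>"
proof -
  obtain A :: "nat \<Rightarrow> 't set" where A: "range A \<subseteq> sets M" "(\<Union>i. A i) = space M"
    "\<And>i. emeasure M (A i) \<noteq> \<infinity>" using sigma_finite by metis
  have "\<exists>B. compact B \<and> B \<subseteq> A j \<and> emeasure M (A j - B) < ennreal (1 / real (Suc k)) \<and>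
      lsc_multifunction_on B \<Phi>" for j k
    by (rule Lusin) (use A in \<open>auto simp: less_top\<close>)
  then have "\<forall>j k. \<exists>B. compact B \<and> B \<subseteq> A j \<and> emeasure M (A j - B) < ennreal (1 / real (Suc k)) \<and>
      lsc_multifunction_on B \<Phi>" by blast
  then obtain B where B: "\<And>j k. compact (B j k)" "\<And>j k. B j k \<subseteq> A j"
    "\<And>j k. emeasure M (A j - B j k) < ennreal (1 / real (Suc k))"
    "\<And>j k. lsc_multifunction_on (B j k) \<Phi>" by metis
  have Bs: "B j k \<in> sets M" for j k using B(1) by (intro sets_closed compact_imp_closed)
  have As: "A j \<in> sets M" for j using A by auto
  have "A j - (\<Union>k. B j k) \<in> null_sets M" for j
  proof (rule null_sets_if_small)
    fix e :: real assume "e > 0"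
    then obtain k where k: "1 / real (Suc k) < e" using nat_approx_posE by metis
    have "emeasure M (A j - (\<Union>k. B j k)) \<le> emeasure M (A j - B j k)"
      by (rule emeasure_mono) (use As Bs in auto)
    also have "\<dots> < ennreal (1 / real (Suc k))" by (rule B)
    also have "\<dots> \<le> ennreal e" using k by (intro ennreal_leI) simp
    finally show "emeasure M (A j - (\<Union>k. B j k)) < ennreal e" .
  qed (use As Bs in auto)
  then have "(\<Union>j. A j - (\<Union>k. B j k)) \<in> null_sets M" by auto
  then have "AE t in M. t \<notin> (\<Union>j. A j - (\<Union>k. B j k))" by (rule AE_not_in)
  then have cov: "AE t in M. \<exists>j k. t \<in> B j k"
  proof eventually_elim
    case (elim t)
    have "t \<in> (\<Union>i. A i)" using A(2) by simp
    then obtain j where "t \<in> A j" by blast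
    with elim show ?case by blast
  qed
  define H where "H \<V> j k = {t\<in>B j k. \<exists>V\<in>\<V>. \<Phi> t \<inter> V \<noteq> {}}" for \<V> j k
  have Ho: "openin (top_of_set (B j k)) (H \<V> j k)" if o: "\<And>V. V \<in> \<V> \<Longrightarrow> open V" for \<V> j k
  proof (subst openin_subopen, intro ballI)
    fix t assume "t \<in> H \<V> j k"
    then obtain V where V: "t \<in> B j k" "V \<in> \<V>" "\<Phi> t \<inter> V \<noteq> {}" unfolding H_def by blast
    obtain U where U: "openin (top_of_set (B j k)) U" "t \<in> U" "\<forall>s\<in>U. \<Phi> s \<inter> V \<noteq> {}"
      using B(4)[of j k] V o[OF V(2)] unfolding lsc_multifunction_on_def by metis
    moreover have "U \<subseteq> H \<V> j k" using openin_imp_subset[OF U(1)] U(3) V(2) unfolding H_def by blast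
    ultimately show "\<exists>T. openin (top_of_set (B j k)) T \<and> t \<in> T \<and> T \<subseteq> H \<V> j k" by blast
  qed
  have Hs: "H \<V> j k \<in> sets M" if o: "\<And>V. V \<in> \<V> \<Longrightarrow> open V" for \<V> j k
    using Ho[OF o, of \<V> j k] Bs[of j k] sets_open unfolding openin_open by auto
  show ?thesis unfolding lindelof_measurable_def
  proof (intro conjI allI impI)
    fix V :: "'z set" assume V: "open V"
    have "(\<Union>j k. H {V} j k) \<in> sets M"
      by (intro sets.countable_UN' sets.countable_nat_UN) (use Hs[of "{V}"] V in auto)
    then show "{t. \<Phi> t \<inter> V \<noteq> {}} \<in> sets M"
    proof (rule sets_cong_AE)
      from cov show "AE t in M. (t \<in> (\<Union>j k. H {V} j k)) = (t \<in> {t. \<Phi> t \<inter> V \<noteq> {}})"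
        by eventually_elim (auto simp: H_def)
    qed
  next
    fix \<V> :: "'z set set" assume \<V>: "\<forall>V\<in>\<V>. open V"
    have "\<exists>\<V>'\<subseteq>\<V>. finite \<V>' \<and> emeasure M (H \<V> j k - H \<V>' j k) < ennreal (1 / real (Suc n))" for j k n
    proof -
      have "emeasure M (H \<V> j k) \<le> emeasure M (A j)"
        by (rule emeasure_mono) (use B(2)[of j k] As in \<open>auto simp: H_def\<close>)
      then have "emeasure M (H \<V> j k) < \<infinity>" using A(3)[of j] by (simp add: less_top order_le_less_trans)
      then obtain K where K: "compact K" "K \<subseteq> H \<V> j k"
        "emeasure M (H \<V> j k - K) < ennreal (1 / real (Suc n))"
        using inner_regular Hs[of \<V> j k] \<V> unfolding inner_regular_def
        by (metis of_nat_0_less_iff zero_less_Suc zero_less_divide_1_iff)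
      have "\<forall>V\<in>\<V>. \<exists>T. open T \<and> H {V} j k = B j k \<inter> T"
        using Ho[of "{_}" j k] \<V> unfolding openin_open by blast
      then obtain T where T: "\<And>V. V \<in> \<V> \<Longrightarrow> open (T V)" "\<And>V. V \<in> \<V> \<Longrightarrow> H {V} j k = B j k \<inter> T V" by metis
      have "K \<subseteq> (\<Union>V\<in>\<V>. T V)"
      proof
        fix t assume "t \<in> K"
        then have "t \<in> H \<V> j k" using K by blast
        then obtain V where "V \<in> \<V>" "t \<in> H {V} j k" unfolding H_def by blast
        then show "t \<in> (\<Union>V\<in>\<V>. T V)" using T(2) by blast
      qed
      then obtain \<V>' where \<V>': "\<V>' \<subseteq> \<V>" "finite \<V>'" "K \<subseteq> (\<Union>V\<in>\<V>'. T V)"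
        using compactE_image[OF K(1), of \<V> T] T(1) by metis
      have "K \<subseteq> H \<V>' j k"
      proof
        fix t assume t: "t \<in> K"
        then obtain V where V: "V \<in> \<V>'" "t \<in> T V" using \<V>' by blast
        moreover have "t \<in> B j k" using t K unfolding H_def by blast
        ultimately have "t \<in> H {V} j k" using T(2) \<V>' by blast
        then show "t \<in> H \<V>' j k" using V unfolding H_def by blast
      qed
      then have "emeasure M (H \<V> j k - H \<V>' j k) \<le> emeasure M (H \<V> j k - K)"
        by (intro emeasure_mono) (use Hs[of \<V> j k] \<V> K(1) sets_closed[OF compact_imp_closed] in auto)
      with K(3) \<V>' show ?thesis by (meson order_le_less_trans)
    qed
    then have "\<forall>j k n. \<exists>\<V>'\<subseteq>\<V>. finite \<V>' \<and> emeasure M (H \<V> j k - H \<V>' j k) < ennreal (1 / real (Suc n))"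
      by blast
    then obtain W where W: "\<And>j k n. W j k n \<subseteq> \<V>" "\<And>j k n. finite (W j k n)"
      "\<And>j k n. emeasure M (H \<V> j k - H (W j k n) j k) < ennreal (1 / real (Suc n))" by metis
    define \<W> where "\<W> = (\<Union>j k n. W j k n)"
    have \<W>: "\<W> \<subseteq> \<V>" "countable \<W>" unfolding \<W>_def
      using W(1) by (blast, intro countable_UN) (auto intro: countable_finite W(2))
    have "AE t in M. t \<notin> H \<V> j k - H \<W> j k" for j k
    proof (rule AE_not_in, rule null_sets_if_small)
      have o: "\<And>V. V \<in> \<V> \<Longrightarrow> open V" "\<And>V. V \<in> \<W> \<Longrightarrow> open V" "\<And>V n. V \<in> W j k n \<Longrightarrow> open V"
        using \<V> subsetD[OF \<W>(1)] subsetD[OF W(1)] by simp_all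
      show "H \<V> j k - H \<W> j k \<in> sets M" using Hs[OF o(1)] Hs[OF o(2)] by blast
      fix e :: real assume "e > 0"
      then obtain n where n: "1 / real (Suc n) < e" using nat_approx_posE by metis
      have "H (W j k n) j k \<subseteq> H \<W> j k" unfolding H_def \<W>_def by blast
      then have "emeasure M (H \<V> j k - H \<W> j k) \<le> emeasure M (H \<V> j k - H (W j k n) j k)"
        by (intro emeasure_mono) (use Hs[OF o(1)] Hs[OF o(3)] in auto)
      also have "\<dots> < ennreal (1 / real (Suc n))" by (rule W)
      also have "\<dots> \<le> ennreal e" using n by (intro ennreal_leI) simp
      finally show "emeasure M (H \<V> j k - H \<W> j k) < ennreal e" .
    qed
    then have "AE t in M. \<forall>j k. t \<notin> H \<V> j k - H \<W> j k" by (simp add: AE_all_countable)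
    with cov have "AE t in M. (\<exists>V\<in>\<V>. \<Phi> t \<inter> V \<noteq> {}) \<longrightarrow> (\<exists>V\<in>\<W>. \<Phi> t \<inter> V \<noteq> {})"
    proof (eventually_elim, intro impI)
      fix t assume h: "\<exists>j k. t \<in> B j k" "\<forall>j k. t \<notin> H \<V> j k - H \<W> j k" "\<exists>V\<in>\<V>. \<Phi> t \<inter> V \<noteq> {}"
      then obtain j k where "t \<in> H \<V> j k" unfolding H_def by blast
      then have "t \<in> H \<W> j k" using h(2) by blast
      then show "\<exists>V\<in>\<W>. \<Phi> t \<inter> V \<noteq> {}" unfolding H_def by blast
    qed
    with \<W> show "\<exists>\<V>'\<subseteq>\<V>. countable \<V>' \<and>
        (AE t in M. (\<exists>V\<in>\<V>. \<Phi> t \<inter> V \<noteq> {}) \<longrightarrow> (\<exists>V\<in>\<V>'. \<Phi> t \<inter> V \<noteq> {}))"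
      by (intro exI[of _ \<W>] conjI)
  qed
qed

end

text \<open>An open set meets the closure of a set only if it meets the set, and lower semicontinuity is
  inherited by unions. The epigraph of an infimum is not quite the union of the epigraphs; moving up
  a little inside the open set makes the inequality strict and so reaches one of them.\<close>
lemma lsc_multifunction_on_epi_closure_INF:
  fixes F :: "'i \<Rightarrow> 't::topological_space \<Rightarrow> 'x::metric_space \<Rightarrow> ereal"
  assumes F: "\<And>i. i \<in> I \<Longrightarrow> lsc_multifunction_on B (\<lambda>t. epi (F i t))"
    and f: "\<And>t. epi (f t) = closure (epi (\<lambda>x. INF i\<in>I. F i t x))"
  shows "lsc_multifunction_on B (\<lambda>t. epi (f t))"
  unfolding lsc_multifunction_on_def
proof (intro ballI allI impI)
  fix t V assume t: "t \<in> B" and V: "open V" "epi (f t) \<inter> V \<noteq> {}"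
  have "V \<inter> epi (\<lambda>x. INF i\<in>I. F i t x) \<noteq> {}"
    using V open_Int_closure_eq_empty[OF V(1), of "epi (\<lambda>x. INF i\<in>I. F i t x)"] unfolding f by blast
  then obtain x \<alpha> where x: "(x, \<alpha>) \<in> V" "(INF i\<in>I. F i t x) \<le> ereal \<alpha>" unfolding epi_def by auto
  obtain C D where CD: "open C" "open D" "(x, \<alpha>) \<in> C \<times> D" "C \<times> D \<subseteq> V"
    using open_prod_elim[OF V(1) x(1)] by metis
  obtain d where d: "d > 0" "ball \<alpha> d \<subseteq> D" using CD openE by blast
  define \<alpha>' where "\<alpha>' = \<alpha> + d / 2"
  have "\<alpha>' \<in> ball \<alpha> d" using d unfolding \<alpha>'_def by (simp add: dist_real_def)
  then have "(x, \<alpha>') \<in> V" using CD d by auto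
  have "(INF i\<in>I. F i t x) < ereal \<alpha>'"
    using x(2) d unfolding \<alpha>'_def by (metis ereal_less_eq(3) half_gt_zero less_add_same_cancel1 less_ereal.simps(1) order_le_less_trans)
  then obtain i where i: "i \<in> I" "F i t x < ereal \<alpha>'" unfolding INF_less_iff by blast
  have "epi (F i t) \<inter> V \<noteq> {}" using i(2) \<open>(x, \<alpha>') \<in> V\<close> unfolding epi_def by (auto intro: less_imp_le)
  then obtain U where U: "openin (top_of_set B) U" "t \<in> U" "\<forall>s\<in>U. epi (F i s) \<inter> V \<noteq> {}"
    using F[OF i(1)] t V(1) unfolding lsc_multifunction_on_def by blast
  have sub: "epi (F i s) \<subseteq> epi (f s)" for s
  proof -
    have "epi (F i s) \<subseteq> epi (\<lambda>x. INF i\<in>I. F i s x)"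
      unfolding epi_def using INF_lower[OF i(1)] by (auto intro: order_trans)
    then show ?thesis unfolding f using closure_subset by blast
  qed
  have "epi (f s) \<inter> V \<noteq> {}" if "s \<in> U" for s
    using U(3) that sub[of s] by blast
  with U(1,2) show "\<exists>U. openin (top_of_set B) U \<and> t \<in> U \<and> (\<forall>s\<in>U. epi (f s) \<inter> V \<noteq> {})"
    by (intro exI[of _ U] conjI ballI)
qed

lemma ereal_Rats_dense:
  assumes "a < b" shows "\<exists>r\<in>\<rat>. a < ereal r \<and> ereal r < b"
proof -
  obtain r where "a < ereal (real_of_rat r)" "ereal (real_of_rat r) < b"
    using ereal_dense3[OF assms] by blast
  then show ?thesis by (intro bexI[of _ "real_of_rat r"]) auto
qed

lemma borel_measurable_ereal_if_greater_real:
  fixes g :: "'a \<Rightarrow> ereal"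
  assumes "\<And>c::real. {t \<in> space M. ereal c < g t} \<in> sets M"
  shows "g \<in> borel_measurable M"
proof (rule borel_measurableI_greater)
  fix a :: ereal
  have "{t \<in> space M. a < g t} = (\<Union>r\<in>{r\<in>\<rat>. a < ereal r}. {t \<in> space M. ereal r < g t})"
  proof (intro set_eqI iffI)
    fix t assume "t \<in> {t \<in> space M. a < g t}"
    then show "t \<in> (\<Union>r\<in>{r\<in>\<rat>. a < ereal r}. {t \<in> space M. ereal r < g t})"
      using ereal_Rats_dense[of a "g t"] by auto
  next
    fix t assume "t \<in> (\<Union>r\<in>{r\<in>\<rat>. a < ereal r}. {t \<in> space M. ereal r < g t})"
    then obtain r where "t \<in> space M" "a < ereal r" "ereal r < g t" by blast
    then show "t \<in> {t \<in> space M. a < g t}" by (simp add: less_trans)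
  qed
  also have "\<dots> \<in> sets M"
    using assms countable_rat by (intro sets.countable_UN') (auto intro: countable_subset)
  finally show "{t \<in> space M. a < g t} \<in> sets M" .
qed

text \<open>The conjugate exceeds \<open>c\<close> when the epigraph meets an open half-space. This is how the conjugate
  is handled by means of the multifunction of epigraphs; where \<open>g\<close> is \<open>-\<infinity>\<close>, some point of the
  epigraph far below will do.\<close>
lemma less_conjugate_iff:
  "ereal c < conjugate g x' \<longleftrightarrow> (\<exists>(x, \<alpha>)\<in>epi g. c < blinfun_apply x' x - \<alpha>)"
proof
  assume "ereal c < conjugate g x'"
  then obtain x where x: "ereal c < ereal (blinfun_apply x' x) - g x"
    unfolding conjugate_def less_SUP_iff by blast
  show "\<exists>(x, \<alpha>)\<in>epi g. c < blinfun_apply x' x - \<alpha>"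
  proof (cases "g x")
    case (real r)
    with x show ?thesis by (intro bexI[of _ "(x, r)"]) (auto simp: epi_def)
  next
    case MInf
    then show ?thesis by (intro bexI[of _ "(x, blinfun_apply x' x - c - 1)"]) (auto simp: epi_def)
  qed (use x in auto)
next
  assume "\<exists>(x, \<alpha>)\<in>epi g. c < blinfun_apply x' x - \<alpha>"
  then obtain x \<alpha> where x: "g x \<le> ereal \<alpha>" "c < blinfun_apply x' x - \<alpha>" unfolding epi_def by auto
  have "ereal c < ereal (blinfun_apply x' x) - ereal \<alpha>" using x by simp
  also have "\<dots> \<le> ereal (blinfun_apply x' x) - g x" by (rule ereal_minus_mono) (use x in auto)
  also have "\<dots> \<le> conjugate g x'" unfolding conjugate_def by (rule SUP_upper) simp
  finally show "ereal c < conjugate g x'" .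
qed

lemma continuous_on_blinfun_apply_fst_snd:
  "continuous_on UNIV (\<lambda>z. blinfun_apply (fst z) (snd z))"
  by (intro blinfun.continuous_on continuous_on_fst continuous_on_snd continuous_on_id)

context complete_Radon_measure
begin

lemma admissible_integrand_epi:
  fixes f :: "'t \<Rightarrow> 'x::banach \<Rightarrow> ereal"
  assumes "admissible_integrand M f"
  shows "lindelof_measurable M (\<lambda>t. epi (f t))" "closed (epi (f t))"
proof -
  obtain I :: "('t \<Rightarrow> 'x \<Rightarrow> ereal) set" and F where F: "uniform_Lusin_family M I F"
    "\<And>t. epi (f t) = closure (epi (\<lambda>x. INF i\<in>I. F i t x))"
    using assms unfolding admissible_integrand_def by blast
  show "closed (epi (f t))" unfolding F(2) by simp
  show "lindelof_measurable M (\<lambda>t. epi (f t))"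
  proof (rule lindelof_measurable_if_Lusin_lsc)
    fix \<epsilon> :: real and A assume "\<epsilon> > 0" "A \<in> sets M" "emeasure M A < \<infinity>"
    then obtain B where "compact B" "B \<subseteq> A" "emeasure M (A - B) < ennreal \<epsilon>"
      "\<And>i. i \<in> I \<Longrightarrow> lsc_multifunction_on B (\<lambda>t. epi (F i t))"
      using F(1) unfolding uniform_Lusin_family_def by metis
    moreover from this(4) have "lsc_multifunction_on B (\<lambda>t. epi (f t))"
      by (rule lsc_multifunction_on_epi_closure_INF[OF _ F(2)])
    ultimately show "\<exists>B. compact B \<and> B \<subseteq> A \<and> emeasure M (A - B) < ennreal \<epsilon> \<and>
        lsc_multifunction_on B (\<lambda>t. epi (f t))" by blast
  qed
qed

end

context complete_sigma_finite_measure
begin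

text \<open>As the epigraph is closed, \<open>f t (x t) \<le> c\<close> says that every ball around \<open>(x t, c)\<close> meets it.\<close>
lemma measurable_integrand:
  fixes f :: "'t \<Rightarrow> 'x::banach \<Rightarrow> ereal"
  assumes f: "lindelof_measurable M (\<lambda>t. epi (f t))" "\<And>t. closed (epi (f t))"
    and x: "strongly_measurable M x"
  shows "(\<lambda>t. f t (x t)) \<in> borel_measurable M"
proof -
  have real: "{t. f t (x t) \<le> ereal c} \<in> sets M" for c
  proof -
    define W where "W n = {w :: 'x \<times> 'x \<times> real. dist (snd w) (fst w, c) < 1 / real (Suc n)}" for n
    have W: "open (W n)" for n unfolding W_def by (intro open_Collect_less continuous_intros)
    have "f t (x t) \<le> ereal c \<longleftrightarrow> (\<forall>n. \<exists>z\<in>epi (f t). (x t, z) \<in> W n)" for t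
    proof -
      have "f t (x t) \<le> ereal c \<longleftrightarrow> (x t, c) \<in> closure (epi (f t))"
        using f(2)[of t] by (simp add: epi_def)
      also have "\<dots> \<longleftrightarrow> (\<forall>n. \<exists>z\<in>epi (f t). dist z (x t, c) < 1 / real (Suc n))"
      proof
        assume "(x t, c) \<in> closure (epi (f t))"
        then show "\<forall>n. \<exists>z\<in>epi (f t). dist z (x t, c) < 1 / real (Suc n)"
          unfolding closure_approachable by simp
      next
        assume h: "\<forall>n. \<exists>z\<in>epi (f t). dist z (x t, c) < 1 / real (Suc n)"
        show "(x t, c) \<in> closure (epi (f t))" unfolding closure_approachable
        proof (intro allI impI)
          fix e :: real assume "0 < e"
          then obtain k where "1 / real (Suc k) < e" using nat_approx_posE by metis
          with h show "\<exists>y\<in>epi (f t). dist y (x t, c) < e" by (meson less_trans)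
        qed
      qed
      finally show ?thesis unfolding W_def by simp
    qed
    then have "{t. f t (x t) \<le> ereal c} = (\<Inter>n. {t. \<exists>z\<in>epi (f t). (x t, z) \<in> W n})" by auto
    also have "\<dots> \<in> sets M"
      using lindelof_measurable_parametric_hit[OF f(1) x W] by (intro sets.countable_INT) auto
    finally show ?thesis .
  qed
  show ?thesis
  proof (rule borel_measurable_ereal_if_greater_real)
    fix c :: real
    have eq: "{t \<in> space M. ereal c < f t (x t)} = space M - {t. f t (x t) \<le> ereal c}" by auto
    show "{t \<in> space M. ereal c < f t (x t)} \<in> sets M" unfolding eq by (rule sets.compl_sets[OF real])
  qed
qed

lemma measurable_conjugate:
  fixes f :: "'t \<Rightarrow> 'x::banach \<Rightarrow> ereal"
  assumes f: "lindelof_measurable M (\<lambda>t. epi (f t))" and x': "strongly_measurable M x'"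
  shows "(\<lambda>t. conjugate (f t) (x' t)) \<in> borel_measurable M"
proof -
  have real: "{t. ereal c < conjugate (f t) (x' t)} \<in> sets M" for c
  proof -
    define W where "W = {w :: ('x \<Rightarrow>\<^sub>L real) \<times> 'x \<times> real. c < blinfun_apply (fst w) (fst (snd w)) - snd (snd w)}"
    have "open W" unfolding W_def
      by (intro open_Collect_less continuous_on_const continuous_on_diff blinfun.continuous_on
          continuous_on_fst continuous_on_snd continuous_on_id)
    moreover have "{t. ereal c < conjugate (f t) (x' t)} = {t. \<exists>z\<in>epi (f t). (x' t, z) \<in> W}"
      unfolding less_conjugate_iff W_def by (auto simp: case_prod_beta)
    ultimately show ?thesis using lindelof_measurable_parametric_hit[OF f x'] by simp
  qed
  then show ?thesis by (intro borel_measurable_ereal_if_greater_real) simp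
qed

lemma strongly_measurable_iff_borel:
  fixes x :: "'t \<Rightarrow> 'z::{metric_space, second_countable_topology}"
  shows "strongly_measurable M x \<longleftrightarrow> x \<in> borel_measurable M"
proof
  assume x: "x \<in> borel_measurable M"
  obtain D :: "'z set" where D: "countable D" "\<And>X. open X \<Longrightarrow> X \<noteq> {} \<Longrightarrow> \<exists>d\<in>D. d \<in> X"
    using countable_dense_setE by blast
  have "w \<in> closure D" for w
    unfolding closure_approachable
  proof (intro allI impI)
    fix e :: real assume "0 < e"
    then show "\<exists>y\<in>D. dist y w < e" using D(2)[of "ball w e"] by (auto simp: dist_commute)
  qed
  then show "strongly_measurable M x" by (intro strongly_measurableI[OF x D(1)]) simp
qed (rule strongly_measurable_borel)

text \<open>Points at which the supremum in the conjugate exceeds \<open>\<beta>\<close> can be chosen measurably: they are the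
  points of the epigraph in an open half-space that depends on the parameter \<open>(x' t, \<beta> t)\<close>.\<close>
lemma conjugate_selection:
  fixes f :: "'t \<Rightarrow> 'x::banach \<Rightarrow> ereal"
  assumes f: "lindelof_measurable M (\<lambda>t. epi (f t))" "\<And>t. closed (epi (f t))"
    and x': "strongly_measurable M x'" and b: "\<beta> \<in> borel_measurable M"
    and less: "AE t in M. ereal (\<beta> t) < conjugate (f t) (x' t)"
  obtains x where "strongly_measurable M x"
    "AE t in M. f t (x t) \<le> ereal (blinfun_apply (x' t) (x t) - \<beta> t)"
proof -
  define W where "W = {w :: (('x \<Rightarrow>\<^sub>L real) \<times> real) \<times> 'x \<times> real.
    snd (fst w) < blinfun_apply (fst (fst w)) (fst (snd w)) - snd (snd w)}"
  have W: "open W" unfolding W_def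
    by (intro open_Collect_less continuous_on_const continuous_on_diff blinfun.continuous_on
        continuous_on_fst continuous_on_snd continuous_on_id)
  have y: "strongly_measurable M (\<lambda>t. (x' t, \<beta> t))"
    by (rule strongly_measurable_Pair[OF x']) (use b in \<open>simp add: strongly_measurable_iff_borel\<close>)
  have ne: "AE t in M. t \<in> UNIV \<longrightarrow> (\<exists>z\<in>epi (f t). ((x' t, \<beta> t), z) \<in> W)"
    using less unfolding less_conjugate_iff by eventually_elim (simp add: W_def case_prod_beta)
  have U: "UNIV \<in> sets M" using sets.top[of M] by simp
  obtain z where z: "strongly_measurable M z"
    "AE t in M. t \<in> UNIV \<longrightarrow> z t \<in> epi (f t) \<and> ((x' t, \<beta> t), z t) \<in> W"
    using lindelof_measurable_selection[OF f y W U ne] by blast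
  show ?thesis
  proof
    show "strongly_measurable M (\<lambda>t. fst (z t))"
      by (rule strongly_measurable_continuous[OF z(1)]) (intro continuous_intros)
    from z(2) show "AE t in M. f t (fst (z t)) \<le> ereal (blinfun_apply (x' t) (fst (z t)) - \<beta> t)"
    proof eventually_elim
      case (elim t)
      obtain u a where u: "z t = (u, a)" by fastforce
      have "f t u \<le> ereal a" "a \<le> blinfun_apply (x' t) u - \<beta> t"
        using elim unfolding u W_def epi_def by auto
      then show ?case unfolding u by (metis ereal_less_eq(3) fst_conv order_trans)
    qed
  qed
qed

end

section \<open>Extended integrals\<close>
lemma ext_integral_mono_AE:
  assumes "AE t in M. g t \<le> h t" shows "ext_integral M g \<le> ext_integral M h"
proof -
  have "(\<integral>\<^sup>+t. e2ennreal (g t) \<partial>M) \<le> (\<integral>\<^sup>+t. e2ennreal (h t) \<partial>M)"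
    by (rule nn_integral_mono_AE) (use assms in \<open>eventually_elim, simp add: e2ennreal_mono\<close>)
  moreover have "(\<integral>\<^sup>+t. e2ennreal (- h t) \<partial>M) \<le> (\<integral>\<^sup>+t. e2ennreal (- g t) \<partial>M)"
    by (rule nn_integral_mono_AE) (use assms in \<open>eventually_elim, simp add: e2ennreal_mono\<close>)
  ultimately show ?thesis unfolding ext_integral_def
    by (intro add_mono) (simp_all add: less_eq_ennreal.rep_eq)
qed

lemma ext_integral_cong_AE:
  assumes "AE t in M. g t = h t" shows "ext_integral M g = ext_integral M h"
proof (rule antisym)
  show "ext_integral M g \<le> ext_integral M h"
    by (rule ext_integral_mono_AE) (use assms in \<open>eventually_elim, simp\<close>)
  show "ext_integral M h \<le> ext_integral M g"
    by (rule ext_integral_mono_AE) (use assms in \<open>eventually_elim, simp\<close>)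
qed

lemma ext_integral_real:
  assumes "integrable M g" shows "ext_integral M (\<lambda>t. ereal (g t)) = ereal (\<integral>t. g t \<partial>M)"
proof -
  have fin: "(\<integral>\<^sup>+t. ennreal (g t) \<partial>M) < \<infinity>" "(\<integral>\<^sup>+t. ennreal (- g t) \<partial>M) < \<infinity>"
    using assms unfolding real_integrable_def by (auto simp: less_top)
  then obtain a b where ab: "(\<integral>\<^sup>+t. ennreal (g t) \<partial>M) = ennreal a" "0 \<le> a"
    "(\<integral>\<^sup>+t. ennreal (- g t) \<partial>M) = ennreal b" "0 \<le> b"
    by (metis ennreal_cases infinity_ennreal_def less_irrefl)
  then show ?thesis
    unfolding ext_integral_def using ab by (simp add: e2ennreal_ereal real_lebesgue_integral_def[OF assms])
qed

lemma ext_integral_less_top: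
  assumes "ext_integral M g < \<infinity>" shows "(\<integral>\<^sup>+t. e2ennreal (g t) \<partial>M) < \<infinity>"
proof (rule ccontr)
  assume "\<not> (\<integral>\<^sup>+t. e2ennreal (g t) \<partial>M) < \<infinity>"
  then have "(\<integral>\<^sup>+t. e2ennreal (g t) \<partial>M) = top" by (simp add: not_less top_unique)
  with assms show False unfolding ext_integral_def by simp
qed

lemma enn2real_ennreal_max: "enn2real (ennreal r) = max 0 r"
  by (cases "0 \<le> r") (auto simp: ennreal_neg)

lemma integrable_enn2real:
  assumes [measurable]: "G \<in> borel_measurable M" and fin: "(\<integral>\<^sup>+t. G t \<partial>M) < \<infinity>"
  shows "integrable M (\<lambda>t. enn2real (G t))"
proof (rule integrableI_bounded)
  have "(\<integral>\<^sup>+t. ennreal (norm (enn2real (G t))) \<partial>M) \<le> (\<integral>\<^sup>+t. G t \<partial>M)"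
    by (rule nn_integral_mono) (simp add: ennreal_enn2real_if)
  with fin show "(\<integral>\<^sup>+t. ennreal (norm (enn2real (G t))) \<partial>M) < \<infinity>"
    by (rule order_le_less_trans[rotated])
qed measurable

lemma integrable_majorant_if_nn_integral_finite:
  assumes g[measurable]: "g \<in> borel_measurable M" and fin: "(\<integral>\<^sup>+t. e2ennreal (g t) \<partial>M) < \<infinity>"
  obtains r where "integrable M r" "AE t in M. g t \<le> ereal (r t)"
proof -
  have 1: "integrable M (\<lambda>t. enn2real (e2ennreal (g t)))"
    using fin by (intro integrable_enn2real) measurable
  have "AE t in M. e2ennreal (g t) \<noteq> \<infinity>"
    by (rule nn_integral_PInf_AE) (use fin in auto)
  then have 2: "AE t in M. g t \<le> ereal (enn2real (e2ennreal (g t)))"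
  proof eventually_elim
    case (elim t) then show ?case by (cases "g t") (auto simp: enn2real_ennreal_max)
  qed
  from 1 2 show ?thesis by (rule that)
qed

lemma integrable_majorant_if_ext_integral_less_top:
  assumes "g \<in> borel_measurable M" "ext_integral M g < \<infinity>"
  obtains r where "integrable M r" "AE t in M. g t \<le> ereal (r t)"
  using integrable_majorant_if_nn_integral_finite[OF assms(1) ext_integral_less_top[OF assms(2)]] that by blast

text \<open>A lower and an upper integrable bound make the integrand real valued and integrable; after this
  step the extended integral is an ordinary one and additive.\<close>
lemma real_if_ext_integral_less_top:
  assumes g[measurable]: "g \<in> borel_measurable M" and fin: "ext_integral M g < \<infinity>"
    and k: "integrable M k" "AE t in M. ereal (k t) \<le> g t"
  obtains g' where "integrable M g'" "AE t in M. g t = ereal (g' t)"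
proof -
  obtain r where r: "integrable M r" "AE t in M. g t \<le> ereal (r t)"
    using integrable_majorant_if_ext_integral_less_top[OF g fin] by blast
  have ae: "AE t in M. g t = ereal (real_of_ereal (g t))"
    using k(2) r(2)
  proof eventually_elim
    case (elim t) then show ?case by (cases "g t") auto
  qed
  have "integrable M (\<lambda>t. real_of_ereal (g t))"
  proof (rule Bochner_Integration.integrable_bound)
    show "integrable M (\<lambda>t. \<bar>r t\<bar> + \<bar>k t\<bar>)" using r k by auto
    from ae k(2) r(2) show "AE t in M. norm (real_of_ereal (g t)) \<le> norm (\<bar>r t\<bar> + \<bar>k t\<bar>)"
    proof eventually_elim
      case (elim t) then show ?case by (cases "g t") auto
    qed
  qed measurable
  with ae show ?thesis by (intro that)
qed

lemma real_if_ext_integral_finite: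
  assumes g[measurable]: "g \<in> borel_measurable M" and fin: "\<bar>ext_integral M g\<bar> \<noteq> \<infinity>"
  obtains g' where "integrable M g'" "AE t in M. g t = ereal (g' t)"
proof -
  have fin1: "(\<integral>\<^sup>+t. e2ennreal (g t) \<partial>M) < \<infinity>" by (rule ext_integral_less_top) (use fin in auto)
  have "(\<integral>\<^sup>+t. e2ennreal (- g t) \<partial>M) < \<infinity>"
  proof (rule ccontr)
    assume "\<not> (\<integral>\<^sup>+t. e2ennreal (- g t) \<partial>M) < \<infinity>"
    then have "(\<integral>\<^sup>+t. e2ennreal (- g t) \<partial>M) = top" by (simp add: not_less top_unique)
    with fin fin1 show False unfolding ext_integral_def
      by (cases "\<integral>\<^sup>+t. e2ennreal (g t) \<partial>M") auto
  qed
  then obtain k where k: "integrable M k" "AE t in M. - g t \<le> ereal (k t)"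
    using integrable_majorant_if_nn_integral_finite[of "\<lambda>t. - g t" M] by auto
  have "AE t in M. ereal (- k t) \<le> g t"
    using k(2)
  proof eventually_elim
    case (elim t) then show ?case by (cases "g t") auto
  qed
  moreover have "integrable M (\<lambda>t. - k t)" using k(1) by simp
  moreover have "ext_integral M g < \<infinity>" using fin by auto
  ultimately show ?thesis using real_if_ext_integral_less_top[OF g] that by blast
qed

text \<open>The integral of \<open>F\<close> is approximated by integrals of integrable functions that lie strictly below
  \<open>F\<close>. With an integrable weight \<open>w > 0\<close>, write \<open>F = k + G\<close>, truncate \<open>G\<close> at \<open>n * w\<close>, and subtract a
  small multiple of \<open>w\<close>.\<close>
lemma (in sigma_finite_measure) integrable_strict_minorant:
  assumes F[measurable]: "F \<in> borel_measurable M"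
    and k: "integrable M k" "AE t in M. ereal (k t) \<le> F t"
    and a: "ereal a < ext_integral M F"
  obtains \<beta> where "integrable M \<beta>" "AE t in M. ereal (\<beta> t) < F t" "a < (\<integral>t. \<beta> t \<partial>M)"
proof -
  obtain w :: "'a \<Rightarrow> real" where w: "w \<in> borel_measurable M" "\<And>t. w t > 0" "integrable M w"
    using obtain_positive_integrable_function by metis
  have [measurable]: "k \<in> borel_measurable M" "w \<in> borel_measurable M" using k w by auto
  define G where "G t = e2ennreal (F t - ereal (k t))" for t
  have Gm[measurable]: "G \<in> borel_measurable M" unfolding G_def by measurable
  have FG: "AE t in M. F t = ereal (k t) + enn2ereal (G t)"
    using k(2)
  proof eventually_elim
    case (elim t)
    then have "0 \<le> F t - ereal (k t)" by (simp add: ereal_diff_positive)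
    then have "enn2ereal (G t) = F t - ereal (k t)" unfolding G_def by (simp add: enn2ereal_e2ennreal)
    then show ?case by (cases "F t") auto
  qed
  have less: "ennreal (a - (\<integral>t. k t \<partial>M)) < (\<integral>\<^sup>+t. G t \<partial>M) \<or> a < (\<integral>t. k t \<partial>M)"
  proof (cases "(\<integral>\<^sup>+t. G t \<partial>M) = \<infinity>")
    case False
    then have "AE t in M. G t \<noteq> \<infinity>" by (intro nn_integral_PInf_AE) auto
    with FG have eq: "AE t in M. F t = ereal (k t + enn2real (G t))"
    proof eventually_elim
      case (elim t)
      then show ?case by (cases "G t") auto
    qed
    have G: "integrable M (\<lambda>t. enn2real (G t))"
      using False by (intro integrable_enn2real Gm) (simp add: top.not_eq_extremum)
    have "ext_integral M F = ereal (\<integral>t. k t + enn2real (G t) \<partial>M)"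
      using ext_integral_cong_AE[OF eq] ext_integral_real[OF Bochner_Integration.integrable_add[OF k(1) G]] by simp
    then have "a - (\<integral>t. k t \<partial>M) < (\<integral>t. enn2real (G t) \<partial>M)"
      using a by (simp add: Bochner_Integration.integral_add[OF k(1) G])
    moreover have "(\<integral>\<^sup>+t. ennreal (enn2real (G t)) \<partial>M) = ennreal (\<integral>t. enn2real (G t) \<partial>M)"
      by (rule nn_integral_eq_integral[OF G]) simp
    moreover have "(\<integral>\<^sup>+t. ennreal (enn2real (G t)) \<partial>M) \<le> (\<integral>\<^sup>+t. G t \<partial>M)"
      by (rule nn_integral_mono) (simp add: ennreal_enn2real_if)
    ultimately have le: "ennreal (\<integral>t. enn2real (G t) \<partial>M) \<le> (\<integral>\<^sup>+t. G t \<partial>M)"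
      and less: "a - (\<integral>t. k t \<partial>M) < (\<integral>t. enn2real (G t) \<partial>M)" by simp_all
    show ?thesis
    proof (cases "a < (\<integral>t. k t \<partial>M)")
      case False
      then have "ennreal (a - (\<integral>t. k t \<partial>M)) < ennreal (\<integral>t. enn2real (G t) \<partial>M)"
        using less by (intro ennreal_lessI) auto
      with le show ?thesis by (auto intro: order_less_le_trans)
    qed simp
  qed auto
  obtain n where n: "a < (\<integral>t. k t \<partial>M) + (\<integral>t. enn2real (min (G t) (ennreal (real n * w t))) \<partial>M)"
  proof -
    have gi: "(\<integral>\<^sup>+t. min (G t) (ennreal (real n * w t)) \<partial>M)
        = ennreal (\<integral>t. enn2real (min (G t) (ennreal (real n * w t))) \<partial>M)" for n
    proof -
      have fin: "min (G t) (ennreal (real n * w t)) = ennreal (enn2real (min (G t) (ennreal (real n * w t))))" for t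
        by (auto simp: ennreal_enn2real_if min_def top_unique)
      have "integrable M (\<lambda>t. enn2real (min (G t) (ennreal (real n * w t))))"
        by (rule Bochner_Integration.integrable_bound[of _ "\<lambda>t. real n * w t"])
          (use w(2,3) in \<open>auto intro!: AE_I2 enn2real_leI simp: less_imp_le\<close>)
      then show ?thesis by (subst fin, intro nn_integral_eq_integral) auto
    qed
    show ?thesis using less
    proof
      assume "a < (\<integral>t. k t \<partial>M)"
      then show ?thesis by (intro that[of 0]) simp
    next
      assume l: "ennreal (a - (\<integral>t. k t \<partial>M)) < (\<integral>\<^sup>+t. G t \<partial>M)"
      have "(\<integral>\<^sup>+t. G t \<partial>M) = (\<integral>\<^sup>+t. (SUP n. min (G t) (ennreal (real n * w t))) \<partial>M)"
      proof (rule nn_integral_cong)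
        fix t
        have "(SUP n. ennreal (real n * w t)) = (SUP n. of_nat n * ennreal (w t))"
          using w(2)[of t] by (simp add: ennreal_mult' ennreal_of_nat_eq_real_of_nat)
        also have "\<dots> = top"
          using w(2)[of t] by (simp add: SUP_mult_right_ennreal[symmetric] ennreal_SUP_of_nat_eq_top ennreal_top_mult)
        finally have top: "(SUP n. ennreal (real n * w t)) = top" .
        have "(SUP n. inf (G t) (ennreal (real n * w t))) = G t"
          unfolding inf_SUP[symmetric] by (simp only: top inf_top_right)
        then show "G t = (SUP n. min (G t) (ennreal (real n * w t)))" by (simp add: inf_min)
      qed
      also have "\<dots> = (SUP n. \<integral>\<^sup>+t. min (G t) (ennreal (real n * w t)) \<partial>M)"
      proof (rule nn_integral_monotone_convergence_SUP)
        show "incseq (\<lambda>n t. min (G t) (ennreal (real n * w t)))"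
          unfolding incseq_def le_fun_def
          using w(2) by (intro allI impI min.mono order_refl ennreal_leI mult_right_mono) (auto intro: less_imp_le)
      qed measurable
      finally obtain n where "ennreal (a - (\<integral>t. k t \<partial>M)) < (\<integral>\<^sup>+t. min (G t) (ennreal (real n * w t)) \<partial>M)"
        using l by (auto simp: less_SUP_iff)
      then have "a - (\<integral>t. k t \<partial>M) < (\<integral>t. enn2real (min (G t) (ennreal (real n * w t))) \<partial>M)"
        unfolding gi by (metis ennreal_leI not_le)
      then show ?thesis by (intro that[of n]) simp
    qed
  qed
  define g where "g t = enn2real (min (G t) (ennreal (real n * w t)))" for t
  have gw: "0 \<le> g t \<and> g t \<le> real n * w t" for t
    unfolding g_def using w(2)[of t] by (auto intro!: enn2real_leI simp: less_imp_le)
  have g: "integrable M g"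
  proof (rule Bochner_Integration.integrable_bound[of _ "\<lambda>t. real n * w t"])
    show "g \<in> borel_measurable M" unfolding g_def by measurable
    show "AE t in M. norm (g t) \<le> norm (real n * w t)"
      using gw by (intro AE_I2) (auto intro: order_trans[OF _ abs_ge_self])
  qed (use w(3) in simp)
  define W where "W = (\<integral>t. w t \<partial>M)"
  have W0: "W \<ge> 0" unfolding W_def by (rule integral_nonneg_AE) (use w(2) in \<open>auto intro: less_imp_le\<close>)
  define \<delta> where "\<delta> = ((\<integral>t. k t \<partial>M) + (\<integral>t. g t \<partial>M) - a) / (2 * (W + 1))"
  have \<delta>: "\<delta> > 0" "\<delta> * W < (\<integral>t. k t \<partial>M) + (\<integral>t. g t \<partial>M) - a"
  proof -
    let ?D = "(\<integral>t. k t \<partial>M) + (\<integral>t. g t \<partial>M) - a"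
    have D: "?D > 0" using n unfolding g_def by simp
    then show "\<delta> > 0" unfolding \<delta>_def using W0 by simp
    have "W / (2 * (W + 1)) < 1" using W0 by (simp add: field_simps)
    then have "?D * (W / (2 * (W + 1))) < ?D * 1" using D by (intro mult_strict_left_mono)
    then show "\<delta> * W < ?D" unfolding \<delta>_def by simp
  qed
  show ?thesis
  proof
    show "integrable M (\<lambda>t. k t + g t - \<delta> * w t)" using k g w by auto
    have "(\<integral>t. k t + g t - \<delta> * w t \<partial>M) = (\<integral>t. k t \<partial>M) + (\<integral>t. g t \<partial>M) - \<delta> * W"
      unfolding W_def using k g w by simp
    with \<delta> show "a < (\<integral>t. k t + g t - \<delta> * w t \<partial>M)" by simp
    from FG show "AE t in M. ereal (k t + g t - \<delta> * w t) < F t"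
    proof eventually_elim
      case (elim t)
      have "ereal (g t) \<le> enn2ereal (G t)"
      proof (cases "G t")
        case (real r)
        then have "g t \<le> r" unfolding g_def by (auto intro!: enn2real_leI)
        with real show ?thesis by simp
      qed simp
      then have "ereal (k t) + ereal (g t) \<le> F t" unfolding elim by (intro add_left_mono)
      moreover have "ereal (k t + g t - \<delta> * w t) < ereal (k t) + ereal (g t)"
        using \<delta>(1) w(2)[of t] by simp
      ultimately show ?case by (rule order_less_le_trans[rotated])
    qed
  qed
qed

section \<open>Lebesgue-Bochner spaces\<close>
lemma conjugate_exponent:
  fixes p :: real assumes "1 < p"
  shows "1 < p / (p - 1)" "1 / p + 1 / (p / (p - 1)) = 1"
  using assms by (auto simp: field_simps)

context complete_sigma_finite_measure
begin

lemma measurable_norm_strongly: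
  "strongly_measurable M x \<Longrightarrow> (\<lambda>t. norm (x t)) \<in> borel_measurable M"
  by (rule strongly_measurable_borel, rule strongly_measurable_continuous) (auto intro: continuous_intros)

lemma strongly_measurable_add:
  fixes x y :: "'t \<Rightarrow> 'z::real_normed_vector"
  assumes "strongly_measurable M x" "strongly_measurable M y"
  shows "strongly_measurable M (\<lambda>t. x t + y t)"
  by (rule strongly_measurable_continuous2[OF assms]) (intro continuous_intros)

lemma strongly_measurable_diff:
  fixes x y :: "'t \<Rightarrow> 'z::real_normed_vector"
  assumes "strongly_measurable M x" "strongly_measurable M y"
  shows "strongly_measurable M (\<lambda>t. x t - y t)"
  by (rule strongly_measurable_continuous2[OF assms]) (intro continuous_intros)

lemma strongly_measurable_scaleR:
  fixes y :: "'t \<Rightarrow> 'z::real_normed_vector"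
  assumes "c \<in> borel_measurable M" "strongly_measurable M y"
  shows "strongly_measurable M (\<lambda>t. c t *\<^sub>R y t)"
proof (rule strongly_measurable_continuous2[where g = "\<lambda>a b. a *\<^sub>R b"])
  show "strongly_measurable M c" using assms(1) by (simp add: strongly_measurable_iff_borel)
qed (use assms in \<open>auto intro!: continuous_intros\<close>)

lemma measurable_pairing:
  assumes "strongly_measurable M x'" "strongly_measurable M x"
  shows "(\<lambda>t. blinfun_apply (x' t) (x t)) \<in> borel_measurable M"
  by (rule strongly_measurable_borel, rule strongly_measurable_continuous2[OF assms])
    (rule continuous_on_blinfun_apply_fst_snd)

lemma Lp_iff:
  "x \<in> Lp M (ereal p) \<longleftrightarrow> strongly_measurable M x \<and> integrable M (\<lambda>t. norm (x t) powr p)"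
proof -
  have "(\<lambda>t. norm (x t) powr p) \<in> borel_measurable M" if "strongly_measurable M x"
    using measurable_norm_strongly[OF that] by measurable
  then show ?thesis unfolding Lp_def by (auto simp: integrable_iff_bounded)
qed

lemma Lp_dominated:
  assumes x: "strongly_measurable M x" and h: "integrable M h" "AE t in M. norm (x t) powr p \<le> h t"
  shows "x \<in> Lp M (ereal p)"
proof -
  have "(\<lambda>t. norm (x t) powr p) \<in> borel_measurable M"
    using measurable_norm_strongly[OF x] by measurable
  then have "integrable M (\<lambda>t. norm (x t) powr p)"
    by (rule Bochner_Integration.integrable_bound[OF h(1)])
      (use h(2) in \<open>eventually_elim, auto intro: order_trans[OF _ abs_ge_self]\<close>)
  with x show ?thesis unfolding Lp_iff by simp
qed

lemma Lp_bounded_finite_support: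
  assumes "strongly_measurable M x" "A \<in> sets M" "emeasure M A < \<infinity>"
    "AE t in M. norm (x t) \<le> K * indicator A t" "0 \<le> p"
  shows "x \<in> Lp M (ereal p)"
proof (rule Lp_dominated[OF assms(1)])
  show "integrable M (\<lambda>t. K powr p * indicator A t)" using assms by auto
  show "AE t in M. norm (x t) powr p \<le> K powr p * indicator A t"
    using assms(4)
  proof eventually_elim
    case (elim t)
    then show ?case using \<open>0 \<le> p\<close> by (cases "t \<in> A") (auto intro: powr_mono2)
  qed
qed

lemma powr_add_le:
  fixes a b p :: real assumes "0 \<le> a" "0 \<le> b" "0 \<le> p"
  shows "(a + b) powr p \<le> 2 powr p * (a powr p + b powr p)"
proof -
  have "(a + b) powr p \<le> (2 * max a b) powr p" using assms by (intro powr_mono2) auto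
  also have "\<dots> = 2 powr p * (max a b) powr p" using assms by (simp add: powr_mult)
  also have "\<dots> \<le> 2 powr p * (a powr p + b powr p)"
    by (intro mult_left_mono) (auto simp: max_def)
  finally show ?thesis .
qed

lemma Lp_add:
  assumes "x \<in> Lp M (ereal p)" "y \<in> Lp M (ereal p)" "0 \<le> p"
  shows "(\<lambda>t. x t + y t) \<in> Lp M (ereal p)"
proof (rule Lp_dominated)
  show "strongly_measurable M (\<lambda>t. x t + y t)" using assms strongly_measurable_add unfolding Lp_iff by blast
  show "integrable M (\<lambda>t. 2 powr p * (norm (x t) powr p + norm (y t) powr p))"
    using assms unfolding Lp_iff by auto
  have "norm (x t + y t) powr p \<le> 2 powr p * (norm (x t) powr p + norm (y t) powr p)" for t
    using powr_add_le[of "norm (x t)" "norm (y t)" p] powr_mono2[of p "norm (x t + y t)" "norm (x t) + norm (y t)"]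
      norm_triangle_ineq[of "x t" "y t"] assms(3) by simp
  then show "AE t in M. norm (x t + y t) powr p \<le> 2 powr p * (norm (x t) powr p + norm (y t) powr p)" by simp
qed

lemma Lp_scaleR:
  assumes "x \<in> Lp M (ereal p)" shows "(\<lambda>t. c *\<^sub>R x t) \<in> Lp M (ereal p)"
proof (rule Lp_dominated)
  show "strongly_measurable M (\<lambda>t. c *\<^sub>R x t)"
    using assms strongly_measurable_scaleR[of "\<lambda>_. c" x] unfolding Lp_iff by simp
  show "integrable M (\<lambda>t. \<bar>c\<bar> powr p * norm (x t) powr p)" using assms unfolding Lp_iff by auto
qed (simp add: powr_mult)

lemma Lp_diff:
  assumes "x \<in> Lp M (ereal p)" "y \<in> Lp M (ereal p)" "0 \<le> p"
  shows "(\<lambda>t. x t - y t) \<in> Lp M (ereal p)"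
  using Lp_add[OF assms(1) Lp_scaleR[OF assms(2), of "-1"] assms(3)] by simp

lemma Lp_If:
  assumes "x \<in> Lp M (ereal p)" "y \<in> Lp M (ereal p)" "{t. P t} \<in> sets M"
  shows "(\<lambda>t. if P t then x t else y t) \<in> Lp M (ereal p)"
proof (rule Lp_dominated)
  show "strongly_measurable M (\<lambda>t. if P t then x t else y t)"
    using assms by (intro strongly_measurable_If) (auto simp: Lp_iff)
  show "integrable M (\<lambda>t. norm (x t) powr p + norm (y t) powr p)" using assms unfolding Lp_iff by auto
qed auto

lemma Lp_zero: "(\<lambda>t. 0) \<in> Lp M (ereal p)"
  unfolding Lp_iff by simp

lemma Lp_norm_eq:
  assumes "x \<in> Lp M (ereal p)" shows "Lp_norm M p x = (\<integral>t. norm (x t) powr p \<partial>M) powr (1 / p)"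
proof -
  have "(\<integral>\<^sup>+t. ennreal (norm (x t) powr p) \<partial>M) = ennreal (\<integral>t. norm (x t) powr p \<partial>M)"
    by (rule nn_integral_eq_integral) (use assms in \<open>auto simp: Lp_iff\<close>)
  then show ?thesis unfolding Lp_norm_def by (simp add: integral_nonneg_AE)
qed

lemma Lp_norm_nonneg: "0 \<le> Lp_norm M p x" unfolding Lp_norm_def by simp

text \<open>A Hoelder inequality with an unspecified constant. For \<open>p > 1\<close> it follows
  from Young's inequality applied to \<open>x\<close> normalized in \<open>L\<^sup>p\<close>.\<close>
lemma Lp_pairing_bound:
  fixes x' :: "'t \<Rightarrow> 'w::real_normed_vector"
  assumes p: "1 \<le> p" and q: "q = (if p = 1 then \<infinity> else ereal (p / (p - 1)))" and x': "x' \<in> Lp M q"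
  obtains C where "0 \<le> C" "\<And>x::'t \<Rightarrow> 'z::real_normed_vector. x \<in> Lp M (ereal p) \<Longrightarrow>
      integrable M (\<lambda>t. norm (x' t) * norm (x t)) \<and> (\<integral>t. norm (x' t) * norm (x t) \<partial>M) \<le> C * Lp_norm M p x"
proof (cases "p = 1")
  case True
  then obtain C0 where sm: "strongly_measurable M x'" and C0: "AE t in M. norm (x' t) \<le> C0"
    using x' unfolding q Lp_def by auto
  define C where "C = max C0 0"
  have C: "AE t in M. norm (x' t) \<le> C" using C0 by eventually_elim (simp add: C_def)
  have "integrable M (\<lambda>t. norm (x' t) * norm (x t)) \<and> (\<integral>t. norm (x' t) * norm (x t) \<partial>M) \<le> C * Lp_norm M p x"
    if x: "x \<in> Lp M (ereal p)" for x :: "'t \<Rightarrow> 'z"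
  proof -
    have i: "integrable M (\<lambda>t. C * norm (x t))" using x unfolding Lp_iff True by simp
    have m: "(\<lambda>t. norm (x' t) * norm (x t)) \<in> borel_measurable M"
      using x unfolding Lp_iff by (intro borel_measurable_times measurable_norm_strongly sm) simp
    have le: "AE t in M. norm (x' t) * norm (x t) \<le> C * norm (x t)"
      using C by eventually_elim (simp add: mult_right_mono)
    have 1: "integrable M (\<lambda>t. norm (x' t) * norm (x t))"
      by (rule Bochner_Integration.integrable_bound[OF i m])
        (use C in \<open>eventually_elim, simp add: C_def abs_mult mult_right_mono\<close>)
    have "(\<integral>t. norm (x' t) * norm (x t) \<partial>M) \<le> (\<integral>t. C * norm (x t) \<partial>M)"
      by (rule integral_mono_AE[OF 1 i le])
    also have "\<dots> = C * Lp_norm M p x" using x unfolding True by (simp add: Lp_norm_eq integral_nonneg_AE)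
    finally show ?thesis using 1 by simp
  qed
  moreover have "0 \<le> C" unfolding C_def by simp
  ultimately show ?thesis using that by blast
next
  case False
  define r where "r = p / (p - 1)"
  have p1: "p > 1" using p False by simp
  have r: "1 < r" "1 / r + 1 / p = 1" using conjugate_exponent[OF p1] unfolding r_def by auto
  have x': "strongly_measurable M x'" "integrable M (\<lambda>t. norm (x' t) powr r)"
    using x' False unfolding q r_def[symmetric] by (simp_all add: Lp_iff)
  define C where "C = (\<integral>t. norm (x' t) powr r \<partial>M) / r + 1 / p"
  have C0: "0 \<le> C" unfolding C_def using r p1 by (auto intro!: add_nonneg_nonneg divide_nonneg_nonneg integral_nonneg_AE)
  have Y: "integrable M (\<lambda>t. norm (x' t) * norm (x t)) \<and> (\<integral>t. norm (x' t) * norm (x t) \<partial>M) \<le>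
      (\<integral>t. norm (x' t) powr r \<partial>M) / r + (\<integral>t. norm (x t) powr p \<partial>M) / p"
    if x: "x \<in> Lp M (ereal p)" for x :: "'t \<Rightarrow> 'z"
  proof -
    have x: "strongly_measurable M x" "integrable M (\<lambda>t. norm (x t) powr p)" using x unfolding Lp_iff by auto
    have m: "(\<lambda>t. norm (x' t) * norm (x t)) \<in> borel_measurable M"
      by (intro borel_measurable_times measurable_norm_strongly x x')
    have i: "integrable M (\<lambda>t. norm (x' t) powr r / r + norm (x t) powr p / p)" using x x' by auto
    have le: "norm (x' t) * norm (x t) \<le> norm (x' t) powr r / r + norm (x t) powr p / p" for t
      by (rule Youngs_inequality) (use r p1 in auto)
    have 1: "integrable M (\<lambda>t. norm (x' t) * norm (x t))"
      by (rule Bochner_Integration.integrable_bound[OF i m])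
        (use le in \<open>auto intro!: AE_I2 intro: order_trans[OF _ abs_ge_self] simp: abs_mult\<close>)
    have "(\<integral>t. norm (x' t) * norm (x t) \<partial>M) \<le> (\<integral>t. norm (x' t) powr r / r + norm (x t) powr p / p \<partial>M)"
      by (rule integral_mono[OF 1 i]) (use le in auto)
    also have "\<dots> = (\<integral>t. norm (x' t) powr r \<partial>M) / r + (\<integral>t. norm (x t) powr p \<partial>M) / p"
      using x x' by simp
    finally show ?thesis using 1 by simp
  qed
  have "(\<integral>t. norm (x' t) * norm (x t) \<partial>M) \<le> C * Lp_norm M p x"
    if x: "x \<in> Lp M (ereal p)" for x :: "'t \<Rightarrow> 'z"
  proof (cases "Lp_norm M p x = 0")
    case True
    have "(\<integral>t. norm (x t) powr p \<partial>M) = 0" using True p1 unfolding Lp_norm_eq[OF x] by simp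
    then have "AE t in M. norm (x t) powr p = 0"
      using x unfolding Lp_iff by (subst (asm) integral_nonneg_eq_0_iff_AE) auto
    then have "AE t in M. norm (x' t) * norm (x t) = 0" by eventually_elim simp
    then have "(\<integral>t. norm (x' t) * norm (x t) \<partial>M) = 0" by (rule integral_eq_zero_AE)
    with True show ?thesis by simp
  next
    case False
    define N where "N = Lp_norm M p x"
    have N: "N > 0" using False Lp_norm_nonneg[of p x] unfolding N_def by simp
    have I: "(\<integral>t. norm (x t) powr p \<partial>M) = N powr p"
      unfolding N_def Lp_norm_eq[OF x] using p1 by (simp add: powr_powr integral_nonneg_AE)
    have "(\<integral>t. norm (x' t) * norm ((1 / N) *\<^sub>R x t) \<partial>M) \<le>
       (\<integral>t. norm (x' t) powr r \<partial>M) / r + (\<integral>t. norm ((1 / N) *\<^sub>R x t) powr p \<partial>M) / p"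
      using Y[OF Lp_scaleR[OF x, of "1 / N"]] by blast
    also have "(\<integral>t. norm ((1 / N) *\<^sub>R x t) powr p \<partial>M) = (\<integral>t. (1 / N) powr p * norm (x t) powr p \<partial>M)"
      using N by (intro Bochner_Integration.integral_cong refl) (simp add: powr_mult[symmetric])
    also have "\<dots> = (1 / N) powr p * N powr p" by (simp only: integral_mult_right_zero I)
    also have "\<dots> = 1" using N by (simp add: powr_divide)
    also have "(\<integral>t. norm (x' t) * norm ((1 / N) *\<^sub>R x t) \<partial>M) = (1 / N) * (\<integral>t. norm (x' t) * norm (x t) \<partial>M)"
      using N by (simp add: field_simps flip: integral_mult_right_zero)
    finally have "(1 / N) * (\<integral>t. norm (x' t) * norm (x t) \<partial>M) \<le> C" unfolding C_def .
    then show ?thesis using N unfolding N_def[symmetric] by (simp add: field_simps)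
  qed
  with Y C0 show ?thesis using that by blast
qed

lemma integrable_pairing:
  fixes x :: "'t \<Rightarrow> 'z::real_normed_vector" and x' :: "'t \<Rightarrow> 'z \<Rightarrow>\<^sub>L real"
  assumes "strongly_measurable M x'" "strongly_measurable M x" "integrable M (\<lambda>t. norm (x' t) * norm (x t))"
  shows "integrable M (\<lambda>t. blinfun_apply (x' t) (x t))"
  by (rule Bochner_Integration.integrable_bound[OF assms(3) measurable_pairing[OF assms(1,2)]])
    (use norm_blinfun[of "x' _" "x _"] in \<open>simp add: abs_mult\<close>)

lemma Lp_pairing_integrable:
  fixes x :: "'t \<Rightarrow> 'z::real_normed_vector" and x' :: "'t \<Rightarrow> 'z \<Rightarrow>\<^sub>L real"
  assumes "1 \<le> p" "q = (if p = 1 then \<infinity> else ereal (p / (p - 1)))" "x' \<in> Lp M q" "x \<in> Lp M (ereal p)"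
  shows "integrable M (\<lambda>t. blinfun_apply (x' t) (x t))"
proof (rule integrable_pairing)
  obtain C where "\<And>x::'t \<Rightarrow> 'z. x \<in> Lp M (ereal p) \<Longrightarrow>
      integrable M (\<lambda>t. norm (x' t) * norm (x t)) \<and> (\<integral>t. norm (x' t) * norm (x t) \<partial>M) \<le> C * Lp_norm M p x"
    by (rule Lp_pairing_bound[OF assms(1-3), where 'z='z]) blast
  then show "integrable M (\<lambda>t. norm (x' t) * norm (x t))" using assms(4) by blast
qed (use assms in \<open>auto simp: Lp_def\<close>)

lemma Lp_functional_in_dual:
  fixes x' :: "'t \<Rightarrow> 'z::real_normed_vector \<Rightarrow>\<^sub>L real"
  assumes p: "1 \<le> p" and q: "q = (if p = 1 then \<infinity> else ereal (p / (p - 1)))" and x': "x' \<in> Lp M q"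
  shows "Lp_functional M p x' \<in> Lp_dual M p"
proof -
  note i = Lp_pairing_integrable[OF p q x']
  obtain C where C: "\<And>x::'t \<Rightarrow> 'z. x \<in> Lp M (ereal p) \<Longrightarrow>
      integrable M (\<lambda>t. norm (x' t) * norm (x t)) \<and> (\<integral>t. norm (x' t) * norm (x t) \<partial>M) \<le> C * Lp_norm M p x"
    by (rule Lp_pairing_bound[OF p q x', where 'z='z]) blast
  have F: "Lp_functional M p x' x = (\<integral>t. blinfun_apply (x' t) (x t) \<partial>M)" if "x \<in> Lp M (ereal p)" for x
    using that unfolding Lp_functional_def by simp
  show ?thesis unfolding Lp_dual_def
  proof (intro CollectI conjI ballI allI)
    show "Lp_functional M p x' \<in> extensional (Lp M (ereal p))" unfolding Lp_functional_def by simp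
    fix x :: "'t \<Rightarrow> 'z" assume x: "x \<in> Lp M (ereal p)"
    show "Lp_functional M p x' (\<lambda>t. c *\<^sub>R x t) = c * Lp_functional M p x' x" for c
      by (simp add: F x Lp_scaleR blinfun.scaleR_right)
    fix y :: "'t \<Rightarrow> 'z" assume y: "y \<in> Lp M (ereal p)"
    show "Lp_functional M p x' (\<lambda>t. x t + y t) = Lp_functional M p x' x + Lp_functional M p x' y"
      using p by (simp add: F x y Lp_add blinfun.add_right i)
  next
    have "\<bar>Lp_functional M p x' x\<bar> \<le> C * Lp_norm M p x" if x: "x \<in> Lp M (ereal p)" for x
    proof -
      have "\<bar>\<integral>t. blinfun_apply (x' t) (x t) \<partial>M\<bar> \<le> (\<integral>t. \<bar>blinfun_apply (x' t) (x t)\<bar> \<partial>M)"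
        by (rule integral_abs_bound)
      also have "\<dots> \<le> (\<integral>t. norm (x' t) * norm (x t) \<partial>M)"
        using C[OF x] i[OF x] by (intro integral_mono) (auto, metis norm_blinfun real_norm_def)
      finally show ?thesis using C[OF x] F[OF x] by simp
    qed
    then show "\<exists>C. \<forall>x\<in>Lp M (ereal p). \<bar>Lp_functional M p x' x\<bar> \<le> C * Lp_norm M p x" by blast
  qed
qed

context
  fixes p :: real and \<phi> :: "('t \<Rightarrow> 'z::real_normed_vector) \<Rightarrow> real"
  assumes p: "1 \<le> p" and \<phi>: "\<phi> \<in> Lp_dual M p"
begin

lemma Lp_dual_add: "x \<in> Lp M (ereal p) \<Longrightarrow> y \<in> Lp M (ereal p) \<Longrightarrow> \<phi> (\<lambda>t. x t + y t) = \<phi> x + \<phi> y"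
  and Lp_dual_scaleR: "x \<in> Lp M (ereal p) \<Longrightarrow> \<phi> (\<lambda>t. c *\<^sub>R x t) = c * \<phi> x"
  using \<phi> unfolding Lp_dual_def by auto

lemma Lp_dual_diff:
  assumes "x \<in> Lp M (ereal p)" "y \<in> Lp M (ereal p)" shows "\<phi> (\<lambda>t. x t - y t) = \<phi> x - \<phi> y"
  using Lp_dual_add[OF assms(1) Lp_scaleR[OF assms(2), of "-1"]] Lp_dual_scaleR[OF assms(2), of "-1"] by simp

lemma Lp_dual_zero: "\<phi> (\<lambda>t. 0) = 0"
  using Lp_dual_scaleR[OF Lp_zero, of 0] by simp

lemma Lp_dual_bound:
  obtains C where "0 \<le> C" "\<And>x. x \<in> Lp M (ereal p) \<Longrightarrow> \<bar>\<phi> x\<bar> \<le> C * (\<integral>t. norm (x t) powr p \<partial>M) powr (1 / p)"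
proof -
  obtain C where C: "\<And>x. x \<in> Lp M (ereal p) \<Longrightarrow> \<bar>\<phi> x\<bar> \<le> C * Lp_norm M p x"
    using \<phi> unfolding Lp_dual_def by blast
  have "\<bar>\<phi> x\<bar> \<le> max C 0 * (\<integral>t. norm (x t) powr p \<partial>M) powr (1 / p)" if x: "x \<in> Lp M (ereal p)" for x
  proof -
    have "\<bar>\<phi> x\<bar> \<le> C * Lp_norm M p x" by (rule C[OF x])
    also have "\<dots> \<le> max C 0 * Lp_norm M p x" by (intro mult_right_mono Lp_norm_nonneg) simp
    finally show ?thesis by (simp add: Lp_norm_eq[OF x])
  qed
  then show ?thesis by (intro that[of "max C 0"]) auto
qed

lemma Lp_dual_tendsto:
  assumes x: "x \<in> Lp M (ereal p)" and s: "\<And>n. strongly_measurable M (s n)"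
    and le: "\<And>n. AE t in M. norm (s n t) \<le> B * norm (x t)"
    and lim: "AE t in M. (\<lambda>n. s n t) \<longlonglongrightarrow> x t"
  shows "s n \<in> Lp M (ereal p)" "(\<lambda>n. \<phi> (s n)) \<longlonglongrightarrow> \<phi> x"
proof -
  have sx: "strongly_measurable M x" and ix: "integrable M (\<lambda>t. norm (x t) powr p)"
    using x unfolding Lp_iff by auto
  have pw: "(c * norm (x t)) powr p = \<bar>c\<bar> powr p * norm (x t) powr p" if "0 \<le> c" for c t
    using that by (simp add: powr_mult)
  show sL: "s n \<in> Lp M (ereal p)" for n
  proof (rule Lp_dominated[OF s])
    show "integrable M (\<lambda>t. \<bar>B\<bar> powr p * norm (x t) powr p)" using ix by simp
    show "AE t in M. norm (s n t) powr p \<le> \<bar>B\<bar> powr p * norm (x t) powr p"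
      using le[of n]
    proof eventually_elim
      case (elim t)
      have "norm (s n t) \<le> \<bar>B\<bar> * norm (x t)"
        using elim by (rule order_trans) (simp add: mult_right_mono)
      then have "norm (s n t) powr p \<le> (\<bar>B\<bar> * norm (x t)) powr p" using p by (intro powr_mono2) auto
      then show ?case by (simp add: pw)
    qed
  qed
  obtain C where C: "0 \<le> C" "\<And>x. x \<in> Lp M (ereal p) \<Longrightarrow> \<bar>\<phi> x\<bar> \<le> C * (\<integral>t. norm (x t) powr p \<partial>M) powr (1 / p)"
    using Lp_dual_bound by blast
  have "(\<lambda>n. \<integral>t. norm (s n t - x t) powr p \<partial>M) \<longlonglongrightarrow> (\<integral>t. 0 \<partial>M)"
  proof (rule integral_dominated_convergence)
    show "integrable M (\<lambda>t. (\<bar>B\<bar> + 1) powr p * norm (x t) powr p)" using ix by simp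
    show "(\<lambda>t. norm (s n t - x t) powr p) \<in> borel_measurable M" for n
      using measurable_norm_strongly[OF strongly_measurable_diff[OF s sx]] by measurable
    from lim show "AE t in M. (\<lambda>n. norm (s n t - x t) powr p) \<longlonglongrightarrow> 0"
    proof eventually_elim
      case (elim t)
      then have "(\<lambda>n. norm (s n t - x t)) \<longlonglongrightarrow> 0" by (simp add: LIM_zero tendsto_norm_zero)
      then show ?case by (rule tendsto_zero_powrI[OF _ tendsto_const]) (use p in auto)
    qed
    show "AE t in M. norm (norm (s n t - x t) powr p) \<le> (\<bar>B\<bar> + 1) powr p * norm (x t) powr p" for n
      using le[of n]
    proof eventually_elim
      case (elim t)
      have "B * norm (x t) \<le> \<bar>B\<bar> * norm (x t)" by (simp add: mult_right_mono)
      then have "norm (s n t - x t) \<le> (\<bar>B\<bar> + 1) * norm (x t)"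
        using elim norm_triangle_ineq4[of "s n t" "x t"] by (simp add: algebra_simps)
      then have "norm (s n t - x t) powr p \<le> ((\<bar>B\<bar> + 1) * norm (x t)) powr p" using p by (intro powr_mono2) auto
      then show ?case using pw[of "\<bar>B\<bar> + 1"] by simp
    qed
  qed auto
  then have "(\<lambda>n. C * (\<integral>t. norm (s n t - x t) powr p \<partial>M) powr (1 / p)) \<longlonglongrightarrow> C * 0"
    by (intro tendsto_mult tendsto_const tendsto_zero_powrI[OF _ tendsto_const])
      (use p in \<open>auto intro!: always_eventually integral_nonneg_AE\<close>)
  then have z: "(\<lambda>n. C * (\<integral>t. norm (s n t - x t) powr p \<partial>M) powr (1 / p)) \<longlonglongrightarrow> 0" by simp
  have "norm (\<phi> (s n) - \<phi> x) \<le> C * (\<integral>t. norm (s n t - x t) powr p \<partial>M) powr (1 / p)" for n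
    using C(2)[OF Lp_diff[OF sL x]] Lp_dual_diff[OF sL x] p by simp
  then have "(\<lambda>n. \<phi> (s n) - \<phi> x) \<longlonglongrightarrow> 0"
    by (intro Lim_null_comparison[OF always_eventually z]) simp
  then show "(\<lambda>n. \<phi> (s n)) \<longlonglongrightarrow> \<phi> x" by (rule LIM_zero_cancel)
qed

lemma Lp_dual_cong_AE:
  assumes "x \<in> Lp M (ereal p)" "y \<in> Lp M (ereal p)" "AE t in M. x t = y t" shows "\<phi> x = \<phi> y"
proof -
  obtain C where C: "0 \<le> C" "\<And>x. x \<in> Lp M (ereal p) \<Longrightarrow> \<bar>\<phi> x\<bar> \<le> C * (\<integral>t. norm (x t) powr p \<partial>M) powr (1 / p)"
    using Lp_dual_bound by blast
  have "AE t in M. norm (x t - y t) powr p = 0" using assms(3) by eventually_elim simp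
  then have "(\<integral>t. norm (x t - y t) powr p \<partial>M) = 0" by (rule integral_eq_zero_AE)
  with C(2)[OF Lp_diff[OF assms(1,2)]] show ?thesis using p Lp_dual_diff[OF assms(1,2)] by simp
qed

lemma Lp_dual_sum:
  assumes "finite I" "\<And>i. i \<in> I \<Longrightarrow> x i \<in> Lp M (ereal p)"
  shows "(\<lambda>t. \<Sum>i\<in>I. x i t) \<in> Lp M (ereal p) \<and> \<phi> (\<lambda>t. \<Sum>i\<in>I. x i t) = (\<Sum>i\<in>I. \<phi> (x i))"
  using assms
proof (induction I rule: finite_induct)
  case empty then show ?case using Lp_zero Lp_dual_zero by simp
next
  case (insert i I)
  then show ?case using Lp_add[of "x i" p "\<lambda>t. \<Sum>i\<in>I. x i t"] Lp_dual_add[of "x i" "\<lambda>t. \<Sum>i\<in>I. x i t"] p by auto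
qed

end

end

section \<open>Conjugates and subgradients of integral functionals\<close>
lemma conjugate_ge: "ereal (blinfun_apply x' x) - g x \<le> conjugate g x'"
  unfolding conjugate_def by (rule SUP_upper) simp

context complete_sigma_finite_measure
begin

lemma bounded_exhaustion:
  assumes x: "strongly_measurable M (x :: 't \<Rightarrow> 'z::real_normed_vector)"
  obtains A :: "nat \<Rightarrow> 't set" where "\<And>n. A n \<in> fmeasurable M" "incseq A" "(\<Union>n. A n) = UNIV"
    "\<And>n t. t \<in> A n \<Longrightarrow> norm (x t) \<le> real n"
proof -
  obtain S :: "nat \<Rightarrow> 't set" where S: "range S \<subseteq> sets M" "(\<Union>i. S i) = space M"
    "\<And>i. emeasure M (S i) \<noteq> \<infinity>" "incseq S" using sigma_finite_incseq by metis
  define A where "A n = S n \<inter> {t. norm (x t) \<le> real n}" for n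
  show ?thesis
  proof
    fix n
    have "(\<lambda>t. norm (x t)) -` {..real n} \<inter> space M \<in> sets M"
      by (rule measurable_sets[OF measurable_norm_strongly[OF x]]) simp
    moreover have "(\<lambda>t. norm (x t)) -` {..real n} = {t. norm (x t) \<le> real n}" by auto
    ultimately have "A n \<in> sets M" unfolding A_def using S(1) by (intro sets.Int) auto
    moreover have "S n \<in> fmeasurable M" using S(1,3) by (auto simp: fmeasurable_def less_top[symmetric])
    moreover have "A n \<subseteq> S n" unfolding A_def by blast
    ultimately show "A n \<in> fmeasurable M" using fmeasurableI2 by blast
  next
    show "incseq A"
    proof (rule incseq_SucI)
      fix n
      have "S n \<subseteq> S (Suc n)" using S(4) by (rule incseq_SucD)
      then show "A n \<subseteq> A (Suc n)" unfolding A_def by auto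
    qed
    show "(\<Union>n. A n) = UNIV"
    proof (intro equalityI subsetI UNIV_I)
      fix t
      obtain i where i: "t \<in> S i" using S(2) by auto
      obtain j where j: "norm (x t) \<le> real j" using real_arch_simple by blast
      have "S i \<subseteq> S (max i j)" using S(4) unfolding incseq_def by simp
      moreover have "norm (x t) \<le> real (max i j)" using j by linarith
      ultimately show "t \<in> (\<Union>n. A n)" unfolding A_def using i by blast
    qed
  qed (simp add: A_def)
qed

lemma Lp_sm: "x \<in> Lp M r \<Longrightarrow> strongly_measurable M x" unfolding Lp_def by simp

context
  fixes f :: "'t \<Rightarrow> 'x::banach \<Rightarrow> ereal" and p :: real and q :: ereal
    and x' :: "'t \<Rightarrow> 'x \<Rightarrow>\<^sub>L real"
  assumes f: "lindelof_measurable M (\<lambda>t. epi (f t))" "\<And>t. closed (epi (f t))"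
    and p: "1 \<le> p" and q: "q = (if p = 1 then \<infinity> else ereal (p / (p - 1)))"
    and x': "x' \<in> Lp M q"
begin

text \<open>The integrated Fenchel--Young inequality. If neither integral is \<open>\<infinity>\<close>, then the pointwise
  inequality bounds each of the two integrands from below by an integrable function, so both are
  real valued and integrable and the inequality can be integrated.\<close>
lemma pairing_minus_integrand_le_conjugate:
  assumes x: "x \<in> Lp M (ereal p)"
  shows "ereal (Lp_functional M p x' x) - integral_functional M f x
      \<le> integral_functional M (\<lambda>t. conjugate (f t)) x'"
proof (cases "integral_functional M f x < \<infinity> \<and> integral_functional M (\<lambda>t. conjugate (f t)) x' < \<infinity>")
  case False
  then show ?thesis by (cases "integral_functional M f x") auto
next
  case True
  define F where "F t = conjugate (f t) (x' t)" for t
  have Fm: "F \<in> borel_measurable M" unfolding F_def by (rule measurable_conjugate[OF f(1) Lp_sm[OF x']])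
  have fm: "(\<lambda>t. f t (x t)) \<in> borel_measurable M" by (rule measurable_integrand[OF f Lp_sm[OF x]])
  define a where "a t = blinfun_apply (x' t) (x t)" for t
  have a: "integrable M a" unfolding a_def by (rule Lp_pairing_integrable[OF p q x' x])
  have FY: "ereal (a t) - f t (x t) \<le> F t" for t unfolding a_def F_def by (rule conjugate_ge)
  have fin: "ext_integral M (\<lambda>t. f t (x t)) < \<infinity>" "ext_integral M F < \<infinity>"
    using True unfolding integral_functional_def F_def by auto
  obtain r where r: "integrable M r" "AE t in M. f t (x t) \<le> ereal (r t)"
    using integrable_majorant_if_ext_integral_less_top[OF fm fin(1)] by blast
  have ar: "integrable M (\<lambda>t. a t - r t)" using a r by simp
  have "AE t in M. ereal (a t - r t) \<le> F t"
    using r(2)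
  proof eventually_elim
    case (elim t)
    have "ereal (a t - r t) = ereal (a t) - ereal (r t)" by simp
    also have "\<dots> \<le> ereal (a t) - f t (x t)" by (rule ereal_minus_mono) (use elim in auto)
    also have "\<dots> \<le> F t" by (rule FY)
    finally show ?case .
  qed
  then obtain F' where F': "integrable M F'" "AE t in M. F t = ereal (F' t)"
    using real_if_ext_integral_less_top[OF Fm fin(2) ar] by blast
  have aF: "integrable M (\<lambda>t. a t - F' t)" using a F' by simp
  have "AE t in M. ereal (a t - F' t) \<le> f t (x t)"
    using F'(2)
  proof eventually_elim
    case (elim t) then show ?case using FY[of t] by (cases "f t (x t)") auto
  qed
  then obtain g where g: "integrable M g" "AE t in M. f t (x t) = ereal (g t)"
    using real_if_ext_integral_less_top[OF fm fin(1) aF] by blast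
  have "(\<integral>t. a t - g t \<partial>M) \<le> (\<integral>t. F' t \<partial>M)"
  proof (rule integral_mono_AE)
    from F'(2) g(2) show "AE t in M. a t - g t \<le> F' t"
    proof eventually_elim
      case (elim t) then show ?case using FY[of t] by simp
    qed
  qed (use a g F' in auto)
  moreover have "integral_functional M f x = ereal (\<integral>t. g t \<partial>M)"
    unfolding integral_functional_def using ext_integral_cong_AE[OF g(2)] ext_integral_real[OF g(1)] by simp
  moreover have "integral_functional M (\<lambda>t. conjugate (f t)) x' = ereal (\<integral>t. F' t \<partial>M)"
    unfolding integral_functional_def F_def[symmetric]
    using ext_integral_cong_AE[OF F'(2)] ext_integral_real[OF F'(1)] by simp
  moreover have "Lp_functional M p x' x = (\<integral>t. a t \<partial>M)"
    unfolding Lp_functional_def a_def using x by simp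
  ultimately show ?thesis using a g by simp
qed

text \<open>The interchange of supremum and integral. A measurable near maximizer \<open>x\<close> exists, but need not
  belong to \<open>L\<^sup>p\<close>. It is used on sets of finite measure on which it is bounded and replaced by \<open>u\<close>
  elsewhere; the error tends to 0 as these sets increase to the whole space.\<close>
lemma less_conjugate_attained:
  assumes u: "u \<in> Lp M (ereal p)" "integral_functional M f u < \<infinity>"
    and a: "ereal a < integral_functional M (\<lambda>t. conjugate (f t)) x'"
  shows "\<exists>x\<in>Lp M (ereal p). ereal a < ereal (Lp_functional M p x' x) - integral_functional M f x"
proof -
  define F where "F t = conjugate (f t) (x' t)" for t
  have Fm: "F \<in> borel_measurable M" unfolding F_def by (rule measurable_conjugate[OF f(1) Lp_sm[OF x']])
  have fu: "(\<lambda>t. f t (u t)) \<in> borel_measurable M" by (rule measurable_integrand[OF f Lp_sm[OF u(1)]])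
  obtain r where r: "integrable M r" "AE t in M. f t (u t) \<le> ereal (r t)"
    using integrable_majorant_if_ext_integral_less_top[OF fu] u(2) unfolding integral_functional_def by blast
  define k where "k t = blinfun_apply (x' t) (u t) - r t" for t
  have k: "integrable M k" unfolding k_def using r Lp_pairing_integrable[OF p q x' u(1)] by simp
  have kF: "AE t in M. ereal (k t) \<le> F t"
    using r(2)
  proof eventually_elim
    case (elim t)
    have "ereal (k t) = ereal (blinfun_apply (x' t) (u t)) - ereal (r t)" unfolding k_def by simp
    also have "\<dots> \<le> ereal (blinfun_apply (x' t) (u t)) - f t (u t)" by (rule ereal_minus_mono) (use elim in auto)
    also have "\<dots> \<le> F t" unfolding F_def by (rule conjugate_ge)
    finally show ?case .
  qed
  obtain \<beta> where \<beta>: "integrable M \<beta>" "AE t in M. ereal (\<beta> t) < F t" "a < (\<integral>t. \<beta> t \<partial>M)"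
    using integrable_strict_minorant[OF Fm k kF] a unfolding integral_functional_def F_def by metis
  obtain x where x: "strongly_measurable M x"
    "AE t in M. f t (x t) \<le> ereal (blinfun_apply (x' t) (x t) - \<beta> t)"
    using conjugate_selection[OF f Lp_sm[OF x'] borel_measurable_integrable[OF \<beta>(1)]] \<beta>(2) unfolding F_def by blast
  obtain A :: "nat \<Rightarrow> 't set" where A: "\<And>n. A n \<in> fmeasurable M" "incseq A" "(\<Union>n. A n) = UNIV"
    "\<And>n t. t \<in> A n \<Longrightarrow> norm (x t) \<le> real n" using bounded_exhaustion[OF x(1)] by metis
  have As: "A n \<in> sets M" for n using A(1) by (simp add: fmeasurable_def)
  define y where "y n t = (if t \<in> A n then x t else u t)" for n t
  have y: "y n \<in> Lp M (ereal p)" for n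
  proof -
    have "(\<lambda>t. if t \<in> A n then x t else 0) \<in> Lp M (ereal p)"
    proof (rule Lp_bounded_finite_support[OF _ As])
      show "strongly_measurable M (\<lambda>t. if t \<in> A n then x t else 0)"
        using x As by (intro strongly_measurable_If) auto
      show "emeasure M (A n) < \<infinity>" using A(1)[of n] by (simp add: fmeasurable_def)
      show "AE t in M. norm (if t \<in> A n then x t else 0) \<le> real n * indicator (A n) t"
        by (rule AE_I2) (auto simp: A(4))
    qed (use p in auto)
    from Lp_If[OF this u(1), of "\<lambda>t. t \<in> A n"] As[of n] have
      "(\<lambda>t. if t \<in> A n then if t \<in> A n then x t else 0 else u t) \<in> Lp M (ereal p)" by simp
    moreover have "(\<lambda>t. if t \<in> A n then if t \<in> A n then x t else 0 else u t) = y n" unfolding y_def by auto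
    ultimately show ?thesis by simp
  qed
  \<comment> \<open>An integrable lower bound of \<open>x' t (y n t) - f t (y n t)\<close>, as \<open>k t\<close> bounds \<open>x' t (u t) - f t (u t)\<close>.\<close>
  define h where "h n t = (if t \<in> A n then \<beta> t else k t)" for n t
  have hm: "h n \<in> borel_measurable M" for n
    unfolding h_def using \<beta>(1) k As[of n] by (intro measurable_If) auto
  have h: "integrable M (h n)" for n
    by (rule Bochner_Integration.integrable_bound[of _ "\<lambda>t. \<bar>\<beta> t\<bar> + \<bar>k t\<bar>", OF _ hm])
      (use \<beta>(1) k in \<open>auto simp: h_def\<close>)
  have "(\<lambda>n. \<integral>t. h n t \<partial>M) \<longlonglongrightarrow> (\<integral>t. \<beta> t \<partial>M)"
  proof (rule integral_dominated_convergence[where w = "\<lambda>t. \<bar>\<beta> t\<bar> + \<bar>k t\<bar>"])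
    show "AE t in M. (\<lambda>n. h n t) \<longlonglongrightarrow> \<beta> t"
    proof (rule AE_I2, rule tendsto_eventually)
      fix t
      obtain i where "t \<in> A i" using A(3) by blast
      then have "t \<in> A n" if "n \<ge> i" for n using A(2) that unfolding incseq_def by blast
      then have "h n t = \<beta> t" if "n \<ge> i" for n using that unfolding h_def by simp
      then show "\<forall>\<^sub>F n in sequentially. h n t = \<beta> t" unfolding eventually_sequentially by blast
    qed
    show "AE t in M. norm (h n t) \<le> \<bar>\<beta> t\<bar> + \<bar>k t\<bar>" for n by (rule AE_I2) (simp add: h_def)
  qed (use \<beta>(1) k hm in auto)
  then have "\<forall>\<^sub>F n in sequentially. a < (\<integral>t. h n t \<partial>M)" using \<beta>(3) by (rule order_tendstoD)
  then obtain n where n: "a < (\<integral>t. h n t \<partial>M)" unfolding eventually_sequentially by blast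
  define b where "b t = blinfun_apply (x' t) (y n t)" for t
  have b: "integrable M b" unfolding b_def by (rule Lp_pairing_integrable[OF p q x' y])
  have "AE t in M. f t (y n t) \<le> ereal (b t - h n t)"
    using x(2) r(2) by eventually_elim (auto simp: y_def b_def h_def k_def)
  then have "integral_functional M f (y n) \<le> ext_integral M (\<lambda>t. ereal (b t - h n t))"
    unfolding integral_functional_def by (rule ext_integral_mono_AE)
  also have "\<dots> = ereal ((\<integral>t. b t \<partial>M) - (\<integral>t. h n t \<partial>M))"
    using b h[of n] by (subst ext_integral_real) auto
  finally have le: "integral_functional M f (y n) \<le> ereal ((\<integral>t. b t \<partial>M) - (\<integral>t. h n t \<partial>M))" .
  have "Lp_functional M p x' (y n) = (\<integral>t. b t \<partial>M)"
    unfolding Lp_functional_def b_def using y[of n] by simp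
  then have "ereal a < ereal (Lp_functional M p x' (y n)) - integral_functional M f (y n)"
    using le n by (cases "integral_functional M f (y n)") auto
  with y show ?thesis by blast
qed

theorem Lp_conjugate_integral_functional:
  assumes u: "u \<in> Lp M (ereal p)" "integral_functional M f u < \<infinity>"
  shows "Lp_conjugate M p (integral_functional M f) (Lp_functional M p x') =
    integral_functional M (\<lambda>t. conjugate (f t)) x'"
proof (rule antisym)
  show "Lp_conjugate M p (integral_functional M f) (Lp_functional M p x')
      \<le> integral_functional M (\<lambda>t. conjugate (f t)) x'"
    unfolding Lp_conjugate_def by (rule SUP_least) (rule pairing_minus_integrand_le_conjugate)
  show "integral_functional M (\<lambda>t. conjugate (f t)) x'
      \<le> Lp_conjugate M p (integral_functional M f) (Lp_functional M p x')"
  proof (rule dense_le)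
    fix c assume c: "c < integral_functional M (\<lambda>t. conjugate (f t)) x'"
    show "c \<le> Lp_conjugate M p (integral_functional M f) (Lp_functional M p x')"
    proof (cases c)
      case (real a)
      obtain x where "x \<in> Lp M (ereal p)" "ereal a < ereal (Lp_functional M p x' x) - integral_functional M f x"
        using less_conjugate_attained[OF u] c unfolding real by blast
      then show ?thesis unfolding Lp_conjugate_def real by (intro SUP_upper2) auto
    qed (use c in auto)
  qed
qed

text \<open>By the conjugate formula \<open>x'\<close> is an \<open>\<epsilon>\<close>-subgradient at \<open>x\<close> when the integral of the slack
  \<open>conjugate (f t) (x' t) + f t (x t) - x' t (x t)\<close> of the Fenchel--Young inequality is at most \<open>\<epsilon>\<close>.
  The slack is nonnegative, and it is the least \<open>\<eta> t\<close> for which \<open>x' t\<close> is an \<open>\<eta> t\<close>-subgradient.\<close>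
theorem Lp_functional_eps_subgradient_iff:
  assumes x: "x \<in> Lp M (ereal p)" "\<bar>integral_functional M f x\<bar> \<noteq> \<infinity>"
  shows "(\<forall>y\<in>Lp M (ereal p). ereal (Lp_functional M p x' (\<lambda>t. y t - x t))
           \<le> integral_functional M f y - integral_functional M f x + ereal \<epsilon>) \<longleftrightarrow>
    (\<exists>\<eta>\<in>error_functions M \<epsilon>. AE t in M. x' t \<in> eps_subdifferential (f t) (\<eta> t) (x t))"
proof -
  let ?I = "integral_functional M f" and ?\<phi> = "Lp_functional M p x'"
  have fm: "(\<lambda>t. f t (y t)) \<in> borel_measurable M" if "y \<in> Lp M (ereal p)" for y :: "'t \<Rightarrow> 'x"
    by (rule measurable_integrand[OF f Lp_sm[OF that]])
  define a where "a y t = blinfun_apply (x' t) (y t)" for y :: "'t \<Rightarrow> 'x" and t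
  have a: "integrable M (a y)" if "y \<in> Lp M (ereal p)" for y :: "'t \<Rightarrow> 'x"
    unfolding a_def by (rule Lp_pairing_integrable[OF p q x' that])
  have \<phi>: "?\<phi> y = (\<integral>t. a y t \<partial>M)" if "y \<in> Lp M (ereal p)" for y :: "'t \<Rightarrow> 'x"
    unfolding Lp_functional_def a_def using that by simp
  have diff: "?\<phi> (\<lambda>t. y t - x t) = ?\<phi> y - ?\<phi> x" if "y \<in> Lp M (ereal p)" for y :: "'t \<Rightarrow> 'x"
    by (rule Lp_dual_diff[OF p Lp_functional_in_dual[OF p q x'] that x(1)])
  obtain g where g: "integrable M g" "AE t in M. f t (x t) = ereal (g t)"
    by (rule real_if_ext_integral_finite[OF fm[OF x(1)] x(2)[unfolded integral_functional_def]])
  define c where "c = (\<integral>t. g t \<partial>M)"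
  have Ix: "?I x = ereal c"
    unfolding integral_functional_def c_def using ext_integral_cong_AE[OF g(2)] ext_integral_real[OF g(1)] by simp
  show ?thesis
  proof
    assume sub: "\<forall>y\<in>Lp M (ereal p). ereal (?\<phi> (\<lambda>t. y t - x t)) \<le> ?I y - ?I x + ereal \<epsilon>"
    have le: "ereal (?\<phi> y) - ?I y \<le> ereal (?\<phi> x - c + \<epsilon>)" if y: "y \<in> Lp M (ereal p)" for y
      using bspec[OF sub y] unfolding diff[OF y] Ix by (cases "?I y") auto
    define F where "F t = conjugate (f t) (x' t)" for t
    have Fm: "F \<in> borel_measurable M" unfolding F_def by (rule measurable_conjugate[OF f(1) Lp_sm[OF x']])
    have "ext_integral M F = Lp_conjugate M p ?I ?\<phi>"
      using Lp_conjugate_integral_functional[OF x(1)] Ix unfolding integral_functional_def[of M _ x'] F_def by simp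
    also have "\<dots> \<le> ereal (?\<phi> x - c + \<epsilon>)" unfolding Lp_conjugate_def by (rule SUP_least) (rule le)
    finally have Fle: "ext_integral M F \<le> ereal (?\<phi> x - c + \<epsilon>)" .
    then have Ffin: "ext_integral M F < \<infinity>" by (rule order_le_less_trans) simp
    have FY: "ereal (blinfun_apply (x' t) z) - f t z \<le> F t" for t z unfolding F_def by (rule conjugate_ge)
    have ag: "integrable M (\<lambda>t. a x t - g t)" using a[OF x(1)] g by simp
    have agF: "AE t in M. ereal (a x t - g t) \<le> F t"
      using g(2)
    proof eventually_elim
      case (elim t) then show ?case using FY[of t "x t"] unfolding a_def by simp
    qed
    obtain F' where F': "integrable M F'" "AE t in M. F t = ereal (F' t)"
      using real_if_ext_integral_less_top[OF Fm Ffin ag agF] by blast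
    define \<eta> where "\<eta> t = F' t + g t - a x t" for t
    have "integrable M \<eta>" unfolding \<eta>_def using F' g a[OF x(1)] by simp
    moreover have "AE t in M. 0 \<le> \<eta> t" using F'(2) agF by eventually_elim (simp add: \<eta>_def)
    moreover have "(\<integral>t. \<eta> t \<partial>M) \<le> \<epsilon>"
    proof -
      have "(\<integral>t. \<eta> t \<partial>M) = (\<integral>t. F' t \<partial>M) + c - ?\<phi> x"
        unfolding \<eta>_def c_def \<phi>[OF x(1)] using F' g a[OF x(1)] by simp
      moreover have "ext_integral M F = ereal (\<integral>t. F' t \<partial>M)"
        using ext_integral_cong_AE[OF F'(2)] ext_integral_real[OF F'(1)] by simp
      ultimately show ?thesis using Fle by simp
    qed
    ultimately have "\<eta> \<in> error_functions M \<epsilon>" unfolding error_functions_def by simp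
    moreover have "AE t in M. x' t \<in> eps_subdifferential (f t) (\<eta> t) (x t)"
      using F'(2) g(2)
    proof eventually_elim
      case (elim t)
      have "ereal (blinfun_apply (x' t) (z - x t)) \<le> f t z - f t (x t) + ereal (\<eta> t)" for z
        using FY[of t z] elim
        by (cases "f t z") (auto simp: \<eta>_def a_def blinfun.diff_right)
      then show ?case unfolding eps_subdifferential_def using elim by simp
    qed
    ultimately show "\<exists>\<eta>\<in>error_functions M \<epsilon>. AE t in M. x' t \<in> eps_subdifferential (f t) (\<eta> t) (x t)"
      by blast
  next
    assume "\<exists>\<eta>\<in>error_functions M \<epsilon>. AE t in M. x' t \<in> eps_subdifferential (f t) (\<eta> t) (x t)"
    then obtain \<eta> where \<eta>: "integrable M \<eta>" "(\<integral>t. \<eta> t \<partial>M) \<le> \<epsilon>"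
      "AE t in M. x' t \<in> eps_subdifferential (f t) (\<eta> t) (x t)" unfolding error_functions_def by blast
    show "\<forall>y\<in>Lp M (ereal p). ereal (?\<phi> (\<lambda>t. y t - x t)) \<le> ?I y - ?I x + ereal \<epsilon>"
    proof
      fix y :: "'t \<Rightarrow> 'x" assume y: "y \<in> Lp M (ereal p)"
      show "ereal (?\<phi> (\<lambda>t. y t - x t)) \<le> ?I y - ?I x + ereal \<epsilon>"
      proof (cases "?I y < \<infinity>")
        case False then show ?thesis unfolding Ix by simp
      next
        case True
        have ge: "AE t in M. ereal (a y t - a x t + g t - \<eta> t) \<le> f t (y t)"
          using \<eta>(3) g(2)
        proof eventually_elim
          case (elim t)
          then have "ereal (blinfun_apply (x' t) (y t - x t)) \<le> f t (y t) - f t (x t) + ereal (\<eta> t)"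
            unfolding eps_subdifferential_def by (simp split: if_splits)
          then show ?case unfolding elim(2) by (cases "f t (y t)") (auto simp: a_def blinfun.diff_right)
        qed
        have i: "integrable M (\<lambda>t. a y t - a x t + g t - \<eta> t)" using a[OF y] a[OF x(1)] g \<eta> by simp
        obtain h where h: "integrable M h" "AE t in M. f t (y t) = ereal (h t)"
          using real_if_ext_integral_less_top[OF fm[OF y] _ i ge] True unfolding integral_functional_def by blast
        have Iy: "?I y = ereal (\<integral>t. h t \<partial>M)"
          unfolding integral_functional_def using ext_integral_cong_AE[OF h(2)] ext_integral_real[OF h(1)] by simp
        have "(\<integral>t. a y t - a x t + g t - \<eta> t \<partial>M) \<le> (\<integral>t. h t \<partial>M)"
          by (rule integral_mono_AE[OF i h(1)]) (use ge h(2) in \<open>eventually_elim, simp\<close>)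
        then have "?\<phi> y - ?\<phi> x + c - (\<integral>t. \<eta> t \<partial>M) \<le> (\<integral>t. h t \<partial>M)"
          unfolding \<phi>[OF y] \<phi>[OF x(1)] c_def using a[OF y] a[OF x(1)] g \<eta> by simp
        then show ?thesis unfolding Ix Iy diff[OF y] using \<eta>(2) by simp
      qed
    qed
  qed
qed

end

end

section \<open>Small slices in the dual of an Asplund space\<close>
lemma norm_blinfun_attained:
  fixes a :: "'x::real_normed_vector \<Rightarrow>\<^sub>L real"
  assumes "0 \<le> c" "c < norm a"
  obtains z where "norm z \<le> 1" "c < blinfun_apply a z"
proof -
  have "\<exists>z. \<not> norm (blinfun_apply a z) \<le> c * norm z"
    using norm_blinfun_bound[OF assms(1), of a] assms(2) by (meson not_le)
  then obtain w where w: "c * norm w < \<bar>blinfun_apply a w\<bar>" by (auto simp: not_le)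
  have w0: "w \<noteq> 0" using w by auto
  define z where "z = (sgn (blinfun_apply a w) / norm w) *\<^sub>R w"
  have "blinfun_apply a z = \<bar>blinfun_apply a w\<bar> / norm w"
    unfolding z_def by (simp add: blinfun.scaleR_right abs_sgn mult.commute)
  moreover have "c < \<bar>blinfun_apply a w\<bar> / norm w" using w w0 by (simp add: field_simps)
  moreover have "norm z \<le> 1" unfolding z_def using w0 by (simp add: abs_sgn_eq)
  ultimately show ?thesis using that by metis
qed

text \<open>The support function \<open>h\<close> of the bounded set \<open>A\<close> is convex and Lipschitz, hence Frechet
  differentiable at some \<open>z\<close>. If \<open>a\<close> nearly attains the supremum at \<open>z\<close>, then
  \<open>a (z + y) \<le> h (z + y)\<close> together with the differentiability estimate for \<open>y\<close> of a fixed small norm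
  shows that \<open>a\<close> is close to the derivative (Smulian's argument).\<close>
lemma asplund_small_slice:
  fixes A :: "('x::banach \<Rightarrow>\<^sub>L real) set"
  assumes asp: "asplund_space TYPE('x)" and ne: "A \<noteq> {}" and bd: "\<And>a. a \<in> A \<Longrightarrow> norm a \<le> K" and e: "0 < \<epsilon>"
  obtains z c v where "\<exists>a\<in>A. c < blinfun_apply a z"
    "\<And>a. a \<in> A \<Longrightarrow> c < blinfun_apply a z \<Longrightarrow> norm (a - v) \<le> \<epsilon>"
proof -
  define h where "h z = (SUP a\<in>A. blinfun_apply a z)" for z
  have le: "\<bar>blinfun_apply a z\<bar> \<le> K * norm z" if "a \<in> A" for a z
  proof -
    have "\<bar>blinfun_apply a z\<bar> \<le> norm a * norm z" using norm_blinfun[of a z] by simp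
    also have "\<dots> \<le> K * norm z" by (rule mult_right_mono[OF bd[OF that]]) simp
    finally show ?thesis .
  qed
  have bdd: "bdd_above ((\<lambda>a. blinfun_apply a z) ` A)" for z
    by (rule bdd_aboveI2[of _ _ "K * norm z"]) (use le in \<open>auto intro: order_trans[OF abs_ge_self]\<close>)
  have up: "blinfun_apply a z \<le> h z" if "a \<in> A" for a z
    unfolding h_def by (rule cSUP_upper[OF that bdd])
  have least: "h z \<le> c" if "\<And>a. a \<in> A \<Longrightarrow> blinfun_apply a z \<le> c" for z c
    unfolding h_def by (rule cSUP_least[OF ne that])
  have K0: "0 \<le> K" using ne bd norm_ge_zero by (metis all_not_in_conv order_trans)
  have lip: "h y \<le> h z + K * norm (y - z)" for y z
  proof (rule least)
    fix a assume a: "a \<in> A"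
    have "blinfun_apply a y = blinfun_apply a z + blinfun_apply a (y - z)" by (simp add: blinfun.diff_right)
    also have "\<dots> \<le> h z + K * norm (y - z)"
      using up[OF a, of z] le[OF a, of "y - z"] by linarith
    finally show "blinfun_apply a y \<le> h z + K * norm (y - z)" .
  qed
  have "K-lipschitz_on UNIV h"
  proof (rule lipschitz_onI[OF _ K0])
    fix y z :: 'x
    show "dist (h y) (h z) \<le> K * dist y z"
      using lip[of y z] lip[of z y] by (simp add: dist_real_def dist_norm norm_minus_commute abs_le_iff)
  qed
  then have cont: "continuous_on UNIV h" by (rule lipschitz_on_continuous_on)
  have conv: "convex_on UNIV h"
  proof (rule convex_onI)
    fix t :: real and y z :: 'x assume t: "0 < t" "t < 1"
    show "h ((1 - t) *\<^sub>R y + t *\<^sub>R z) \<le> (1 - t) * h y + t * h z"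
    proof (rule least)
      fix a assume a: "a \<in> A"
      have "(1 - t) * blinfun_apply a y \<le> (1 - t) * h y" "t * blinfun_apply a z \<le> t * h z"
        using t up[OF a] by (auto intro: mult_left_mono)
      then show "blinfun_apply a ((1 - t) *\<^sub>R y + t *\<^sub>R z) \<le> (1 - t) * h y + t * h z"
        by (simp add: blinfun.add_right blinfun.scaleR_right)
    qed
  qed simp
  obtain G where G: "UNIV \<subseteq> closure G" "\<forall>x\<in>G. h differentiable (at x)"
    using asp[unfolded asplund_space_def, rule_format, OF open_UNIV convex_UNIV conv cont] by blast
  have "G \<noteq> {}" using G(1) by auto
  then obtain z where "h differentiable (at z)" using G(2) by blast
  then obtain D where D: "(h has_derivative D) (at z)" unfolding differentiable_def by blast
  then have lin: "bounded_linear D" by (rule has_derivative_bounded_linear)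
  obtain d where d: "d > 0" "\<And>y. norm (y - z) < d \<Longrightarrow> norm (h y - h z - D (y - z)) \<le> (\<epsilon> / 2) * norm (y - z)"
    using D e unfolding has_derivative_at_alt by (meson half_gt_zero)
  define \<rho> where "\<rho> = d / 2"
  have \<rho>: "0 < \<rho>" "\<rho> < d" using d unfolding \<rho>_def by auto
  \<comment> \<open>The depth of the slice matches the differentiability error \<open>\<epsilon> / 2 * \<rho>\<close> on the sphere of radius \<open>\<rho>\<close>.\<close>
  define c where "c = h z - \<epsilon> * \<rho> / 2"
  have "c < h z" unfolding c_def using e \<rho> by simp
  then have "\<exists>a\<in>A. c < blinfun_apply a z"
    unfolding h_def using less_cSUP_iff[OF ne bdd] by blast
  moreover have "norm (a - Blinfun D) \<le> \<epsilon>" if a: "a \<in> A" "c < blinfun_apply a z" for a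
  proof (rule norm_blinfun_bound)
    have one: "blinfun_apply a w - D w \<le> \<epsilon> * norm w" for w
    proof (cases "w = 0")
      case True then show ?thesis using bounded_linear.linear[OF lin] by (simp add: linear_0)
    next
      case False
      define r where "r = \<rho> / norm w"
      have r: "0 < r" "r * norm w = \<rho>" unfolding r_def using False \<rho> by auto
      define y where "y = r *\<^sub>R w"
      have y: "norm y = \<rho>" unfolding y_def using r by simp
      have "\<bar>h (z + y) - h z - D y\<bar> \<le> (\<epsilon> / 2) * \<rho>" using d(2)[of "z + y"] y \<rho> by simp
      then have "h (z + y) - h z - D y \<le> (\<epsilon> / 2) * \<rho>" by linarith
      moreover have "blinfun_apply a z + blinfun_apply a y \<le> h (z + y)"
        using up[OF a(1), of "z + y"] by (simp add: blinfun.add_right)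
      ultimately have "blinfun_apply a y - D y \<le> \<epsilon> * \<rho>" using a(2) unfolding c_def by linarith
      moreover have "blinfun_apply a y - D y = r * (blinfun_apply a w - D w)"
        unfolding y_def using bounded_linear.linear[OF lin]
        by (simp add: blinfun.scaleR_right linear_cmul right_diff_distrib)
      ultimately have "r * (blinfun_apply a w - D w) \<le> r * (\<epsilon> * norm w)" using r by (simp add: algebra_simps)
      then show ?thesis using r(1) by (simp add: mult_le_cancel_left_pos)
    qed
    fix w
    have "D (- w) = - D w" using bounded_linear.linear[OF lin] by (rule linear_neg)
    then show "norm (blinfun_apply (a - Blinfun D) w) \<le> \<epsilon> * norm w"
      using one[of w] one[of "- w"]
      by (simp add: blinfun.diff_left bounded_linear_Blinfun_apply[OF lin] blinfun.minus_right abs_le_iff)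
  qed (use e in simp)
  ultimately show ?thesis by (rule that)
qed

section \<open>Exhaustion\<close>

text \<open>A greedy choice: \<open>B n\<close> is a set with property \<open>P\<close>, disjoint from the earlier ones, whose measure
  is at least half of the supremum of the possible ones. The measures tend to 0, as their sum is finite, so no
  set with property \<open>P\<close> and positive measure is left over. Measures are taken with respect to an
  equivalent finite measure.\<close>
lemma (in sigma_finite_measure) exhaustion:
  assumes E: "E \<in> sets M"
  obtains B :: "nat \<Rightarrow> 'a set" where "disjoint_family B" "\<And>i. B i \<in> sets M" "\<And>i. B i \<subseteq> E"
    "\<And>i. B i = {} \<or> P (B i)" "\<And>D. D \<in> sets M \<Longrightarrow> D \<subseteq> E - (\<Union>i. B i) \<Longrightarrow> P D \<Longrightarrow> D \<in> null_sets M"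
proof -
  obtain w :: "'a \<Rightarrow> real" where w: "w \<in> borel_measurable M" "\<And>t. w t > 0" "integrable M w"
    using obtain_positive_integrable_function by metis
  define N where "N = density M (\<lambda>t. ennreal (w t))"
  have sN [simp]: "sets N = sets M" unfolding N_def by simp
  have "emeasure N (space N) = (\<integral>\<^sup>+t. ennreal (w t) \<partial>M)"
    unfolding N_def using w by (simp add: emeasure_density nn_set_integral_space)
  also have "\<dots> < \<infinity>" using w(3,2) by (simp add: nn_integral_eq_integral less_imp_le)
  finally interpret N: finite_measure N by (intro finite_measureI) auto
  have null: "D \<in> null_sets M" if D: "D \<in> sets M" "measure N D = 0" for D
  proof -
    have "D \<in> null_sets N" using D by (simp add: null_sets_def N.emeasure_eq_measure)
    then have "AE t in M. t \<in> D \<longrightarrow> ennreal (w t) = 0"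
      unfolding N_def using w(1) by (simp add: null_sets_density_iff)
    then have "AE t in M. t \<notin> D"
    proof eventually_elim
      case (elim t) then show ?case using w(2)[of t] by (auto simp: ennreal_eq_0_iff)
    qed
    then show ?thesis using D(1) AE_iff_null_sets by blast
  qed
  define good where "good R B \<longleftrightarrow> B \<in> sets M \<and> B \<subseteq> R \<and> (B = {} \<or> P B) \<and>
     (\<forall>D\<in>sets M. D \<subseteq> R \<longrightarrow> P D \<longrightarrow> measure N D \<le> 2 * measure N B)" for R B
  have ex: "\<exists>B. good R B" for R
  proof -
    define S where "S = measure N ` {D \<in> sets M. D \<subseteq> R \<and> (D = {} \<or> P D)}"
    have bdd: "bdd_above S" unfolding S_def by (rule bdd_aboveI2) (rule N.bounded_measure)
    have ub: "measure N D \<le> Sup S" if "D \<in> sets M" "D \<subseteq> R" "P D" for D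
      by (rule cSup_upper[OF _ bdd]) (use that in \<open>auto simp: S_def\<close>)
    show ?thesis
    proof (cases "Sup S \<le> 0")
      case True
      have "good R {}" unfolding good_def using ub True by (auto intro: order_trans)
      then show ?thesis ..
    next
      case False
      have "S \<noteq> {}" unfolding S_def by auto
      moreover have "Sup S / 2 < Sup S" using False by simp
      ultimately obtain b where "b \<in> S" "Sup S / 2 < b" using less_cSup_iff[OF _ bdd] by blast
      then obtain B where B: "B \<in> sets M" "B \<subseteq> R" "B = {} \<or> P B" "Sup S / 2 < measure N B"
        unfolding S_def by auto
      have "good R B" unfolding good_def
      proof (intro conjI ballI impI B)
        fix D assume "D \<in> sets M" "D \<subseteq> R" "P D"
        then show "measure N D \<le> 2 * measure N B" using ub[of D] B(4) by linarith
      qed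
      then show ?thesis ..
    qed
  qed
  define pick where "pick R = (SOME B. good R B)" for R
  have pick: "good R (pick R)" for R unfolding pick_def by (rule someI_ex[OF ex])
  define R where "R = rec_nat E (\<lambda>_ R. R - pick R)"
  have R0: "R 0 = E" and RS: "R (Suc n) = R n - pick (R n)" for n unfolding R_def by auto
  define B where "B n = pick (R n)" for n
  have B: "B n \<in> sets M" "B n \<subseteq> R n" "B n = {} \<or> P (B n)"
    "\<And>D. D \<in> sets M \<Longrightarrow> D \<subseteq> R n \<Longrightarrow> P D \<Longrightarrow> measure N D \<le> 2 * measure N (B n)" for n
    using pick[of "R n"] unfolding good_def B_def by blast+
  have Rdec: "R n \<subseteq> R m" if "m \<le> n" for m n
    by (rule lift_Suc_antimono_le[of R, OF _ that]) (simp add: RS)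
  have RE: "R n \<subseteq> E" for n using Rdec[of 0 n] R0 by simp
  have Rrem: "E - (\<Union>i. B i) \<subseteq> R n" for n
    by (induction n) (auto simp: R0 RS B_def)
  have disj: "disjoint_family B"
  proof -
    have "B i \<inter> B j = {}" if "i < j" for i j
      using B(2)[of j] Rdec[of "Suc i" j] that unfolding RS B_def[symmetric] by auto
    then show ?thesis unfolding disjoint_family_on_def by (metis Int_commute linorder_neqE_nat)
  qed
  have "summable (\<lambda>n. measure N (B n))"
    by (rule sums_summable[OF measure_UNION[OF _ disj]]) (use B(1) in \<open>auto simp: N.emeasure_eq_measure\<close>)
  then have lim: "(\<lambda>n. 2 * measure N (B n)) \<longlonglongrightarrow> 2 * 0"
    by (intro tendsto_mult tendsto_const summable_LIMSEQ_zero)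
  show ?thesis
  proof
    show "B i \<subseteq> E" for i using B(2) RE by blast
    fix D assume D: "D \<in> sets M" "D \<subseteq> E - (\<Union>i. B i)" "P D"
    have "measure N D \<le> 2 * measure N (B n)" for n using D Rrem[of n] B(4)[of D n] by blast
    then have "measure N D \<le> 2 * 0" by (intro LIMSEQ_le_const[OF lim]) blast
    then have "measure N D = 0" using measure_nonneg[of N D] by linarith
    then show "D \<in> null_sets M" by (rule null[OF D(1)])
  qed (use disj B in blast)+
qed

section \<open>Densities of functionals\<close>
lemma sum_if_disjoint_family:
  fixes B :: "nat \<Rightarrow> 't set" and w :: "'b::comm_monoid_add"
  assumes B: "disjoint_family B"
  shows "(\<Sum>i<n. if t \<in> B i then w else 0) = (if t \<in> (\<Union>i<n. B i) then w else 0)"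
proof (cases "t \<in> (\<Union>i<n. B i)")
  case True
  then obtain i where i: "i < n" "t \<in> B i" by blast
  have "t \<notin> B j" if "j \<noteq> i" for j using B i(2) that unfolding disjoint_family_on_def by blast
  then have "(\<Sum>j<n. if t \<in> B j then w else 0) = (\<Sum>j<n. if j = i then w else 0)"
    by (intro sum.cong refl) (use i(2) in auto)
  then show ?thesis using True i(1) by simp
qed (simp add: sum.neutral)

context complete_sigma_finite_measure
begin

lemma fmeasurable_sub: "E \<in> fmeasurable M \<Longrightarrow> D \<in> sets M \<Longrightarrow> D \<subseteq> E \<Longrightarrow> D \<in> fmeasurable M"
  by (rule fmeasurableI2)

lemma measure_UN_sums:
  assumes "E \<in> fmeasurable M" "disjoint_family B" "\<And>i::nat. B i \<in> sets M" "\<And>i. B i \<subseteq> E"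
  shows "(\<lambda>i. measure M (B i)) sums measure M (\<Union>i. B i)"
proof (rule measure_UNION[OF _ assms(2)])
  have "(\<Union>i. B i) \<in> fmeasurable M" by (rule fmeasurable_sub[OF assms(1)]) (use assms in auto)
  then show "emeasure M (\<Union>i. B i) \<noteq> \<infinity>" by (auto simp: fmeasurable_def)
qed (use assms in auto)

lemma null_if_measure_zero: "E \<in> fmeasurable M \<Longrightarrow> measure M E = 0 \<Longrightarrow> E \<in> null_sets M"
  by (auto simp: fmeasurable_def null_sets_def emeasure_eq_ennreal_measure)

context
  fixes p :: real and \<phi> :: "('t \<Rightarrow> 'x::banach) \<Rightarrow> real"
  assumes p: "1 \<le> p" and \<phi>: "\<phi> \<in> Lp_dual M p"
begin

text \<open>The vector measure with values in the dual space that a functional on \<open>L\<^sup>p\<close> induces. Only its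
  values at sets of finite measure are meaningful, as only for these the step functions are in \<open>L\<^sup>p\<close>.\<close>
definition dual_measure :: "'t set \<Rightarrow> 'x \<Rightarrow>\<^sub>L real" where
  "dual_measure E = Blinfun (\<lambda>z. \<phi> (\<lambda>t. if t \<in> E then z else 0))"

lemma step_Lp:
  assumes "E \<in> fmeasurable M" shows "(\<lambda>t. if t \<in> E then z else 0) \<in> Lp M (ereal p)"
proof (rule Lp_bounded_finite_support[of _ E])
  show "strongly_measurable M (\<lambda>t. if t \<in> E then z else 0)"
    using assms by (intro strongly_measurable_If) (auto simp: fmeasurable_def)
qed (use assms p in \<open>auto simp: fmeasurable_def indicator_def intro!: AE_I2\<close>)

lemma dual_measure_bound:
  obtains C where "0 \<le> C" "\<And>x. x \<in> Lp M (ereal p) \<Longrightarrow> \<bar>\<phi> x\<bar> \<le> C * (\<integral>t. norm (x t) powr p \<partial>M) powr (1 / p)"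
    "\<And>E z. E \<in> fmeasurable M \<Longrightarrow> \<bar>\<phi> (\<lambda>t. if t \<in> E then z else 0)\<bar> \<le> C * measure M E powr (1 / p) * norm z"
proof -
  obtain C where C: "0 \<le> C" "\<And>x. x \<in> Lp M (ereal p) \<Longrightarrow> \<bar>\<phi> x\<bar> \<le> C * (\<integral>t. norm (x t) powr p \<partial>M) powr (1 / p)"
    using Lp_dual_bound[OF p \<phi>] by blast
  have "\<bar>\<phi> (\<lambda>t. if t \<in> E then z else 0)\<bar> \<le> C * measure M E powr (1 / p) * norm z" if E: "E \<in> fmeasurable M" for E z
  proof -
    have "(\<integral>t. norm (if t \<in> E then z else 0) powr p \<partial>M) = (\<integral>t. norm z powr p * indicator E t \<partial>M)"
      by (intro Bochner_Integration.integral_cong refl) (auto simp: indicator_def)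
    also have "\<dots> = norm z powr p * measure M E" using E by simp
    finally have "(\<integral>t. norm (if t \<in> E then z else 0) powr p \<partial>M) powr (1 / p) = norm z * measure M E powr (1 / p)"
      using p by (simp add: powr_mult powr_powr)
    with C(2)[OF step_Lp[OF E, of z]] show ?thesis by (simp add: mult_ac)
  qed
  with C show ?thesis by (rule that)
qed

lemma dual_measure_apply:
  assumes E: "E \<in> fmeasurable M"
  shows "blinfun_apply (dual_measure E) z = \<phi> (\<lambda>t. if t \<in> E then z else 0)"
proof -
  obtain C where C: "\<And>z. \<bar>\<phi> (\<lambda>t. if t \<in> E then z else 0)\<bar> \<le> C * measure M E powr (1 / p) * norm z"
    using dual_measure_bound E by metis
  have "bounded_linear (\<lambda>z. \<phi> (\<lambda>t. if t \<in> E then z else 0))"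
  proof (rule bounded_linear_intro)
    fix x y :: 'x and r :: real
    have "(\<lambda>t. if t \<in> E then x + y else 0) = (\<lambda>t. (if t \<in> E then x else 0) + (if t \<in> E then y else 0))" by auto
    then show "\<phi> (\<lambda>t. if t \<in> E then x + y else 0) = \<phi> (\<lambda>t. if t \<in> E then x else 0) + \<phi> (\<lambda>t. if t \<in> E then y else 0)"
      using Lp_dual_add[OF p \<phi> step_Lp[OF E] step_Lp[OF E]] by simp
    have "(\<lambda>t. if t \<in> E then r *\<^sub>R x else 0) = (\<lambda>t. r *\<^sub>R (if t \<in> E then x else 0))" by auto
    then show "\<phi> (\<lambda>t. if t \<in> E then r *\<^sub>R x else 0) = r *\<^sub>R \<phi> (\<lambda>t. if t \<in> E then x else 0)"
      using Lp_dual_scaleR[OF p \<phi> step_Lp[OF E]] by simp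
    show "norm (\<phi> (\<lambda>t. if t \<in> E then x else 0)) \<le> norm x * (C * measure M E powr (1 / p))"
      using C[of x] by (simp add: mult_ac)
  qed
  then show ?thesis unfolding dual_measure_def by (simp add: bounded_linear_Blinfun_apply)
qed

lemma dual_measure_null:
  assumes "E \<in> null_sets M" shows "dual_measure E = 0"
proof (rule blinfun_eqI)
  fix z :: 'x
  have E: "E \<in> fmeasurable M" using assms by (auto simp: fmeasurable_def null_sets_def)
  have "AE t in M. (if t \<in> E then z else 0) = 0"
    using AE_not_in[OF assms] by eventually_elim simp
  then have "\<phi> (\<lambda>t. if t \<in> E then z else 0) = \<phi> (\<lambda>t. 0)"
    by (rule Lp_dual_cong_AE[OF p \<phi> step_Lp[OF E] Lp_zero])
  then show "blinfun_apply (dual_measure E) z = blinfun_apply 0 z"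
    using Lp_dual_zero[OF p \<phi>] by (simp add: dual_measure_apply[OF E])
qed

lemma dual_measure_UN:
  fixes B :: "nat \<Rightarrow> 't set"
  assumes E: "E \<in> fmeasurable M" and B: "disjoint_family B" "\<And>i. B i \<in> sets M" "\<And>i. B i \<subseteq> E"
  shows "(\<lambda>i. blinfun_apply (dual_measure (B i)) w) sums blinfun_apply (dual_measure (\<Union>i. B i)) w"
proof -
  have Bf: "B i \<in> fmeasurable M" for i using fmeasurable_sub[OF E B(2,3)] .
  have U: "(\<Union>i. B i) \<in> fmeasurable M"
    by (rule fmeasurable_sub[OF E]) (use B in auto)
  note sum_eq = sum_if_disjoint_family[OF B(1)]
  define s where "s n t = (if t \<in> (\<Union>i<n. B i) then w else 0)" for n t
  have sL: "s n \<in> Lp M (ereal p) \<and> \<phi> (s n) = (\<Sum>i<n. blinfun_apply (dual_measure (B i)) w)" for n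
  proof -
    have "(\<lambda>t. \<Sum>i<n. if t \<in> B i then w else 0) = s n" unfolding s_def sum_eq ..
    with Lp_dual_sum[OF p \<phi> finite_lessThan[of n], of "\<lambda>i t. if t \<in> B i then w else 0", OF step_Lp[OF Bf]]
    show ?thesis by (simp add: dual_measure_apply[OF Bf])
  qed
  have "(\<lambda>n. \<phi> (s n)) \<longlonglongrightarrow> \<phi> (\<lambda>t. if t \<in> (\<Union>i. B i) then w else 0)"
  proof (rule Lp_dual_tendsto(2)[OF p \<phi> step_Lp[OF U], where B = 1])
    show "strongly_measurable M (s n)" for n using sL[of n] by (simp add: Lp_iff)
    show "AE t in M. norm (s n t) \<le> 1 * norm (if t \<in> (\<Union>i. B i) then w else 0)" for n
      by (rule AE_I2) (auto simp: s_def)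
    show "AE t in M. (\<lambda>n. s n t) \<longlonglongrightarrow> (if t \<in> (\<Union>i. B i) then w else 0)"
    proof (rule AE_I2, rule tendsto_eventually)
      fix t
      show "\<forall>\<^sub>F n in sequentially. s n t = (if t \<in> (\<Union>i. B i) then w else 0)"
      proof (cases "t \<in> (\<Union>i. B i)")
        case True
        then obtain i where "t \<in> B i" by blast
        then have "\<forall>n\<ge>Suc i. s n t = w" unfolding s_def by auto
        then show ?thesis using True unfolding eventually_sequentially by auto
      qed (simp add: s_def)
    qed
  qed
  then show ?thesis unfolding sums_def using sL by (simp add: dual_measure_apply[OF U])
qed

lemma dual_measure_Diff:
  assumes E: "E \<in> fmeasurable M" and D: "D \<in> sets M" "D \<subseteq> E"
  shows "dual_measure (E - D) = dual_measure E - dual_measure D"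
proof (rule blinfun_eqI)
  fix z :: 'x
  have f: "D \<in> fmeasurable M" "E - D \<in> fmeasurable M"
    using fmeasurable_sub[OF E D] E D by (auto intro: fmeasurable_Diff)
  have "(\<lambda>t. if t \<in> E - D then z else 0) = (\<lambda>t. (if t \<in> E then z else 0) - (if t \<in> D then z else 0))"
    by (rule ext) (use D(2) in auto)
  then show "blinfun_apply (dual_measure (E - D)) z = blinfun_apply (dual_measure E - dual_measure D) z"
    using Lp_dual_diff[OF p \<phi> step_Lp[OF E] step_Lp[OF f(1)], of z z]
    by (simp add: dual_measure_apply E f blinfun.diff_left)
qed

text \<open>Exhaust \<open>E\<close> by disjoint sets on which the average of the vector measure has norm more than \<open>N\<close>.
  A function that takes suitable vectors of norm at most 1 as values on these sets shows, by continuity of the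
  functional, that \<open>N\<close> times their total measure is at most \<open>C * measure M E powr (1 / p)\<close>. For large
  \<open>N\<close> they cannot fill \<open>E\<close>, and the remainder has the required property.\<close>
lemma bounded_average_range:
  assumes E: "E \<in> fmeasurable M" "E \<notin> null_sets M"
  obtains B N where "B \<in> sets M" "B \<subseteq> E" "B \<notin> null_sets M"
    "\<And>D. D \<in> sets M \<Longrightarrow> D \<subseteq> B \<Longrightarrow> norm (dual_measure D) \<le> N * measure M D"
proof -
  define e where "e = measure M E"
  have e: "e > 0" using E null_if_measure_zero measure_nonneg[of M E] unfolding e_def by (metis less_eq_real_def)
  obtain C where C: "0 \<le> C" "\<And>x. x \<in> Lp M (ereal p) \<Longrightarrow> \<bar>\<phi> x\<bar> \<le> C * (\<integral>t. norm (x t) powr p \<partial>M) powr (1 / p)"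
    using Lp_dual_bound[OF p \<phi>] by blast
  \<comment> \<open>Chosen such that \<open>N * e\<close> is larger than \<open>C * e powr (1 / p)\<close>.\<close>
  define N where "N = C * e powr (1 / p) / e + 1"
  have N0: "N > 0" unfolding N_def using C e by (intro add_nonneg_pos) auto
  obtain B :: "nat \<Rightarrow> 't set" where B: "disjoint_family B" "\<And>i. B i \<in> sets M" "\<And>i. B i \<subseteq> E"
    "\<And>i. B i = {} \<or> N * measure M (B i) < norm (dual_measure (B i))"
    "\<And>D. D \<in> sets M \<Longrightarrow> D \<subseteq> E - (\<Union>i. B i) \<Longrightarrow> N * measure M D < norm (dual_measure D) \<Longrightarrow> D \<in> null_sets M"
    using exhaustion[OF fmeasurableD[OF E(1)], where P = "\<lambda>D. N * measure M D < norm (dual_measure D)"] by blast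
  have Bf: "B i \<in> fmeasurable M" for i using fmeasurable_sub[OF E(1) B(2,3)] .
  have Us: "(\<Union>i. B i) \<in> sets M" "(\<Union>i. B i) \<subseteq> E" using B by auto
  have "E - (\<Union>i. B i) \<notin> null_sets M"
  proof
    assume nul: "E - (\<Union>i. B i) \<in> null_sets M"
    have "measure M (E - (\<Union>i. B i)) = 0" using nul by (simp add: null_sets_def measure_def)
    moreover have "measure M (E - (\<Union>i. B i)) = measure M E - measure M (\<Union>i. B i)"
      by (rule measure_Diff) (use E Us in \<open>auto simp: fmeasurable_def\<close>)
    ultimately have full: "measure M (\<Union>i. B i) = e" unfolding e_def by simp
    have "\<exists>z. norm z \<le> 1 \<and> N * measure M (B i) \<le> blinfun_apply (dual_measure (B i)) z" for i
    proof (cases "B i = {}")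
      case True then show ?thesis by (intro exI[of _ 0]) simp
    next
      case False
      then have "N * measure M (B i) < norm (dual_measure (B i))" using B(4) by blast
      moreover have "0 \<le> N * measure M (B i)" using N0 by simp
      ultimately show ?thesis using norm_blinfun_attained by (metis less_imp_le)
    qed
    then obtain z where z: "\<And>i. norm (z i) \<le> 1" "\<And>i. N * measure M (B i) \<le> blinfun_apply (dual_measure (B i)) (z i)"
      by metis
    have "(\<Sum>i<n. N * measure M (B i)) \<le> C * e powr (1 / p)" for n
    proof -
      define s where "s t = (\<Sum>i<n. if t \<in> B i then z i else 0)" for t
      have s: "s \<in> Lp M (ereal p)" "\<phi> s = (\<Sum>i<n. blinfun_apply (dual_measure (B i)) (z i))"
        using Lp_dual_sum[OF p \<phi> finite_lessThan[of n], of "\<lambda>i t. if t \<in> B i then z i else 0", OF step_Lp[OF Bf]]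
        unfolding s_def by (simp_all add: dual_measure_apply[OF Bf])
      have sle: "norm (s t) powr p \<le> indicator E t" for t
      proof -
        have "norm (s t) \<le> (\<Sum>i<n. if t \<in> B i then 1 else 0)"
          unfolding s_def by (rule sum_norm_le) (use z(1) in auto)
        also have "\<dots> \<le> indicator E t"
          unfolding sum_if_disjoint_family[OF B(1)] using B(3) by (auto simp: indicator_def)
        finally show ?thesis using p by (cases "t \<in> E") (auto simp: powr_le1)
      qed
      have "(\<integral>t. norm (s t) powr p \<partial>M) \<le> (\<integral>t. indicator E t \<partial>M)"
        by (rule integral_mono) (use s(1) E sle in \<open>auto simp: Lp_iff fmeasurable_def\<close>)
      then have le: "(\<integral>t. norm (s t) powr p \<partial>M) \<le> e" unfolding e_def by simp
      have "(\<Sum>i<n. N * measure M (B i)) \<le> \<phi> s" unfolding s(2) by (intro sum_mono z)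
      also have "\<dots> \<le> C * (\<integral>t. norm (s t) powr p \<partial>M) powr (1 / p)" using C(2)[OF s(1)] by linarith
      also have "\<dots> \<le> C * e powr (1 / p)"
        using C(1) le p by (intro mult_left_mono powr_mono2) (auto intro: integral_nonneg_AE)
      finally show ?thesis .
    qed
    moreover have "(\<lambda>n. \<Sum>i<n. N * measure M (B i)) \<longlonglongrightarrow> N * e"
      using sums_mult[OF measure_UN_sums[OF E(1) B(1,2,3)], of N] unfolding full sums_def .
    ultimately have "N * e \<le> C * e powr (1 / p)" by (intro LIMSEQ_le_const2) auto
    moreover have "N * e = C * e powr (1 / p) + e" unfolding N_def using e by (simp add: field_simps)
    ultimately show False using e by simp
  qed
  moreover have "norm (dual_measure D) \<le> N * measure M D" if "D \<in> sets M" "D \<subseteq> E - (\<Union>i. B i)" for D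
  proof (rule ccontr)
    assume "\<not> norm (dual_measure D) \<le> N * measure M D"
    moreover from this have "D \<in> null_sets M" using B(5)[OF that] by simp
    ultimately show False using dual_measure_null N0 by simp
  qed
  ultimately show ?thesis using E Us by (intro that[of "E - (\<Union>i. B i)" N]) (auto simp: fmeasurable_def)
qed

text \<open>The averages of the vector measure over subsets of \<open>B\<close> lie within \<open>\<epsilon>\<close> of \<open>v\<close>, in a form that
  makes sense for null sets as well.\<close>
definition nearly_constant_density :: "real \<Rightarrow> 't set \<Rightarrow> ('x \<Rightarrow>\<^sub>L real) \<Rightarrow> bool" where
  "nearly_constant_density \<epsilon> B v \<longleftrightarrow> B \<in> fmeasurable M \<and>
     (\<forall>D\<in>sets M. D \<subseteq> B \<longrightarrow> norm (dual_measure D - measure M D *\<^sub>R v) \<le> \<epsilon> * measure M D)"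

text \<open>The averages over subsets of \<open>E\<close> form a bounded set, which has a slice of small diameter, given
  by \<open>c < a z\<close>. Take \<open>D0\<close> whose average is in the slice and remove from it, by exhaustion, the subsets
  with average outside. The average over \<open>D0\<close> being larger than \<open>c\<close> at \<open>z\<close>, a set of positive
  measure remains, and all averages over its subsets belong to the slice.\<close>
lemma exists_nearly_constant_density_bounded:
  assumes asp: "asplund_space TYPE('x)" and e: "0 < \<epsilon>" and E: "E \<in> fmeasurable M" "E \<notin> null_sets M"
    and bd: "\<And>D. D \<in> sets M \<Longrightarrow> D \<subseteq> E \<Longrightarrow> norm (dual_measure D) \<le> N * measure M D"
  obtains B v where "B \<subseteq> E" "B \<notin> null_sets M" "nearly_constant_density \<epsilon> B v"
proof -
  define avg where "avg D = (1 / measure M D) *\<^sub>R dual_measure D" for D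
  define A where "A = avg ` {D \<in> sets M. D \<subseteq> E \<and> 0 < measure M D}"
  have "0 < measure M E" using E null_if_measure_zero measure_nonneg[of M E] by (metis less_eq_real_def)
  then have ne: "A \<noteq> {}" unfolding A_def using E by (auto simp: fmeasurable_def)
  have Abd: "norm a \<le> N" if a: "a \<in> A" for a
  proof -
    obtain D where aD: "a = avg D" and "D \<in> {D \<in> sets M. D \<subseteq> E \<and> 0 < measure M D}"
      using a unfolding A_def by (rule imageE)
    then have D: "D \<in> sets M" "D \<subseteq> E" "0 < measure M D" by simp_all
    show ?thesis unfolding aD using bd[OF D(1,2)] D(3) unfolding avg_def by (simp add: field_simps)
  qed
  obtain z c v where slice: "\<exists>a\<in>A. c < blinfun_apply a z"
    "\<And>a. a \<in> A \<Longrightarrow> c < blinfun_apply a z \<Longrightarrow> norm (a - v) \<le> \<epsilon>"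
    using asplund_small_slice[OF asp ne Abd e] by metis
  have avg_iff: "c < blinfun_apply (avg D) z \<longleftrightarrow> c * measure M D < blinfun_apply (dual_measure D) z"
    if "0 < measure M D" for D
    using that unfolding avg_def by (simp add: blinfun.scaleR_left field_simps)
  obtain D0 where D0: "D0 \<in> sets M" "D0 \<subseteq> E" "c * measure M D0 < blinfun_apply (dual_measure D0) z"
    using slice(1) avg_iff unfolding A_def by auto
  have D0f: "D0 \<in> fmeasurable M" by (rule fmeasurable_sub[OF E(1) D0(1,2)])
  obtain B :: "nat \<Rightarrow> 't set" where B: "disjoint_family B" "\<And>i. B i \<in> sets M" "\<And>i. B i \<subseteq> D0"
    "\<And>i. B i = {} \<or> blinfun_apply (dual_measure (B i)) z \<le> c * measure M (B i)"
    "\<And>D. D \<in> sets M \<Longrightarrow> D \<subseteq> D0 - (\<Union>i. B i) \<Longrightarrow> blinfun_apply (dual_measure D) z \<le> c * measure M D \<Longrightarrow> D \<in> null_sets M"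
    using exhaustion[OF D0(1), where P = "\<lambda>D. blinfun_apply (dual_measure D) z \<le> c * measure M D"]
    by metis
  define U where "U = (\<Union>i. B i)"
  have U: "U \<in> sets M" "U \<subseteq> D0" unfolding U_def using B by auto
  have Bf: "D0 - U \<in> fmeasurable M" using D0f U by (intro fmeasurable_Diff) auto
  have "blinfun_apply (dual_measure U) z \<le> c * measure M U"
  proof (rule sums_le)
    show "(\<lambda>i. blinfun_apply (dual_measure (B i)) z) sums blinfun_apply (dual_measure U) z"
      unfolding U_def by (rule dual_measure_UN[OF D0f B(1,2,3)])
    show "(\<lambda>i. c * measure M (B i)) sums (c * measure M U)"
      unfolding U_def by (rule sums_mult[OF measure_UN_sums[OF D0f B(1,2,3)]])
    show "blinfun_apply (dual_measure (B i)) z \<le> c * measure M (B i)" for i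
      using B(4)[of i] dual_measure_null[of "{}"] by auto
  qed
  moreover have "measure M (D0 - U) = measure M D0 - measure M U"
    by (rule measure_Diff) (use D0f U in \<open>auto simp: fmeasurable_def\<close>)
  then have "c * measure M (D0 - U) = c * measure M D0 - c * measure M U" by (simp add: right_diff_distrib)
  ultimately have "c * measure M (D0 - U) < blinfun_apply (dual_measure (D0 - U)) z"
    using D0(3) unfolding dual_measure_Diff[OF D0f U] blinfun.diff_left by linarith
  then have "D0 - U \<notin> null_sets M" using dual_measure_null[of "D0 - U"] by (auto simp: null_sets_def measure_def)
  moreover have "nearly_constant_density \<epsilon> (D0 - U) v"
    unfolding nearly_constant_density_def
  proof (intro conjI ballI impI Bf)
    fix D assume D: "D \<in> sets M" "D \<subseteq> D0 - U"
    have Df: "D \<in> fmeasurable M" by (rule fmeasurable_sub[OF Bf D])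
    show "norm (dual_measure D - measure M D *\<^sub>R v) \<le> \<epsilon> * measure M D"
    proof (cases "measure M D = 0")
      case True
      then show ?thesis using dual_measure_null[OF null_if_measure_zero[OF Df True]] by simp
    next
      case False
      then have pos: "0 < measure M D" using measure_nonneg[of M D] by linarith
      have "D \<notin> null_sets M" using False by (auto simp: null_sets_def measure_def)
      then have "c * measure M D < blinfun_apply (dual_measure D) z"
        using B(5)[OF D(1)] D(2) unfolding U_def by (meson not_le)
      then have "c < blinfun_apply (avg D) z" using avg_iff[OF pos] by simp
      moreover have "avg D \<in> A" unfolding A_def using D D0 pos by auto
      ultimately have "norm (avg D - v) \<le> \<epsilon>" using slice(2) by blast
      then have "measure M D * norm (avg D - v) \<le> measure M D * \<epsilon>" using pos by (intro mult_left_mono) auto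
      moreover have "measure M D * norm (avg D - v) = norm (measure M D *\<^sub>R (avg D - v))" using pos by simp
      moreover have "measure M D *\<^sub>R (avg D - v) = dual_measure D - measure M D *\<^sub>R v"
        unfolding avg_def using pos by (simp add: scaleR_diff_right)
      ultimately show ?thesis by (simp add: mult.commute)
    qed
  qed
  ultimately show ?thesis using D0 by (intro that[of "D0 - U" v]) auto
qed

lemma exists_nearly_constant_density:
  assumes asp: "asplund_space TYPE('x)" and e: "0 < \<epsilon>" and E: "E \<in> sets M" "E \<notin> null_sets M"
  obtains B v where "B \<subseteq> E" "B \<notin> null_sets M" "nearly_constant_density \<epsilon> B v"
proof -
  obtain S :: "nat \<Rightarrow> 't set" where S: "range S \<subseteq> sets M" "(\<Union>i. S i) = space M"
    "\<And>i. emeasure M (S i) \<noteq> \<infinity>" using sigma_finite by metis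
  have "\<exists>i. E \<inter> S i \<notin> null_sets M"
  proof (rule ccontr)
    assume "\<not> (\<exists>i. E \<inter> S i \<notin> null_sets M)"
    then have "(\<Union>i. E \<inter> S i) \<in> null_sets M" by (intro null_sets_UN) auto
    moreover have "(\<Union>i. E \<inter> S i) = E" using S(2) by auto
    ultimately show False using E(2) by simp
  qed
  then obtain i where i: "E \<inter> S i \<notin> null_sets M" ..
  have "S i \<in> fmeasurable M" using S(1,3) by (auto simp: fmeasurable_def less_top[symmetric])
  then have f: "E \<inter> S i \<in> fmeasurable M" by (rule fmeasurable_sub) (use E S in auto)
  obtain B N where B: "B \<in> sets M" "B \<subseteq> E \<inter> S i" "B \<notin> null_sets M"
    "\<And>D. D \<in> sets M \<Longrightarrow> D \<subseteq> B \<Longrightarrow> norm (dual_measure D) \<le> N * measure M D"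
    using bounded_average_range[OF f i] by metis
  obtain B' v where "B' \<subseteq> B" "B' \<notin> null_sets M" "nearly_constant_density \<epsilon> B' v"
    using exists_nearly_constant_density_bounded[OF asp e fmeasurable_sub[OF f B(1,2)] B(3,4)] by metis
  with B(2) show ?thesis by (intro that[of B' v]) auto
qed

lemma nearly_constant_density_partition:
  assumes asp: "asplund_space TYPE('x)" and e: "0 < \<epsilon>"
  obtains B v where "disjoint_family (B :: nat \<Rightarrow> 't set)" "\<And>i. nearly_constant_density \<epsilon> (B i) (v i)"
    "AE t in M. \<exists>i. t \<in> B i"
proof -
  have U: "UNIV \<in> sets M" using sets.top[of M] by simp
  obtain B :: "nat \<Rightarrow> 't set" where B: "disjoint_family B" "\<And>i. B i \<in> sets M" "\<And>i. B i \<subseteq> UNIV"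
    "\<And>i. B i = {} \<or> (\<exists>v. nearly_constant_density \<epsilon> (B i) v)"
    "\<And>D. D \<in> sets M \<Longrightarrow> D \<subseteq> UNIV - (\<Union>i. B i) \<Longrightarrow> (\<exists>v. nearly_constant_density \<epsilon> D v) \<Longrightarrow> D \<in> null_sets M"
    using exhaustion[OF U, where P = "\<lambda>B. \<exists>v. nearly_constant_density \<epsilon> B v"]
    by metis
  have "\<exists>v. nearly_constant_density \<epsilon> (B i) v" for i
  proof (cases "B i = {}")
    case True then show ?thesis
      unfolding nearly_constant_density_def using dual_measure_null[of "{}"] by (auto simp: subset_empty)
  qed (use B(4) in blast)
  then obtain v where v: "\<And>i. nearly_constant_density \<epsilon> (B i) (v i)" by metis
  have R: "UNIV - (\<Union>i. B i) \<in> sets M" using U B(2) by auto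
  have "UNIV - (\<Union>i. B i) \<in> null_sets M"
  proof (rule ccontr)
    assume "UNIV - (\<Union>i. B i) \<notin> null_sets M"
    then obtain D w where D: "D \<subseteq> UNIV - (\<Union>i. B i)" "D \<notin> null_sets M" "nearly_constant_density \<epsilon> D w"
      using exists_nearly_constant_density[OF asp e R] by metis
    moreover have "D \<in> sets M" using D(3) unfolding nearly_constant_density_def by (simp add: fmeasurable_def)
    ultimately show False using B(5)[of D] by blast
  qed
  then have "AE t in M. t \<notin> UNIV - (\<Union>i. B i)" by (rule AE_not_in)
  then have "AE t in M. \<exists>i. t \<in> B i" by eventually_elim auto
  with B(1) v show ?thesis by (rule that)
qed

lemma nearly_constant_density_unique:
  assumes "nearly_constant_density \<epsilon> B v" "nearly_constant_density \<delta> B' v'" "B \<inter> B' \<notin> null_sets M"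
  shows "norm (v - v') \<le> \<epsilon> + \<delta>"
proof -
  define D where "D = B \<inter> B'"
  have B: "B \<in> fmeasurable M" "B' \<in> fmeasurable M" using assms unfolding nearly_constant_density_def by auto
  have Ds: "D \<in> sets M" "D \<subseteq> B" "D \<subseteq> B'" unfolding D_def using B by (auto simp: fmeasurable_def)
  have "D \<in> fmeasurable M" by (rule fmeasurable_sub[OF B(1) Ds(1,2)])
  then have pos: "0 < measure M D"
    using assms(3) null_if_measure_zero measure_nonneg[of M D] unfolding D_def by (metis less_eq_real_def)
  have "norm (dual_measure D - measure M D *\<^sub>R v) \<le> \<epsilon> * measure M D"
    "norm (dual_measure D - measure M D *\<^sub>R v') \<le> \<delta> * measure M D"
    using assms(1,2) Ds unfolding nearly_constant_density_def by auto
  moreover have "measure M D *\<^sub>R (v - v') =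
      (dual_measure D - measure M D *\<^sub>R v') - (dual_measure D - measure M D *\<^sub>R v)"
    by (simp add: scaleR_diff_right)
  ultimately have "norm (measure M D *\<^sub>R (v - v')) \<le> (\<epsilon> + \<delta>) * measure M D"
    using norm_triangle_ineq4[of "dual_measure D - measure M D *\<^sub>R v'" "dual_measure D - measure M D *\<^sub>R v"]
    by (simp add: algebra_simps)
  then have "measure M D * norm (v - v') \<le> measure M D * (\<epsilon> + \<delta>)" using pos by (simp add: mult.commute)
  then show ?thesis using pos by (simp add: mult_le_cancel_left_pos)
qed

text \<open>For each \<open>n\<close> the space is partitioned into pieces with density \<open>v n i\<close> up to \<open>(1/2)^n\<close>. On
  overlaps of positive measure the values for different \<open>n\<close> agree up to the sum of the errors, so the
  functions with these values converge uniformly almost everywhere.\<close>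
lemma exists_density:
  assumes asp: "asplund_space TYPE('x)"
  obtains x' B v where "strongly_measurable M x'"
    "\<forall>n. disjoint_family (B n :: nat \<Rightarrow> 't set)" "\<forall>n i. nearly_constant_density ((1/2)^n) (B n i) (v n i)"
    "\<forall>n. AE t in M. \<exists>i. t \<in> B n i"
    "AE t in M. \<forall>n i. t \<in> B n i \<longrightarrow> norm (x' t - v n i) \<le> (1/2)^n"
proof -
  have "\<exists>B v. disjoint_family (B :: nat \<Rightarrow> 't set) \<and> (\<forall>i. nearly_constant_density ((1/2)^n) (B i) (v i)) \<and>
    (AE t in M. \<exists>i. t \<in> B i)" for n :: nat
  proof -
    obtain B v where "disjoint_family (B :: nat \<Rightarrow> 't set)" "\<And>i. nearly_constant_density ((1/2)^n) (B i) (v i)"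
      "AE t in M. \<exists>i. t \<in> B i" using nearly_constant_density_partition[OF asp, of "(1/2)^n"] by auto
    then show ?thesis by (intro exI[of _ B] exI[of _ v]) simp
  qed
  then have "\<forall>n. \<exists>B v. disjoint_family (B :: nat \<Rightarrow> 't set) \<and> (\<forall>i. nearly_constant_density ((1/2)^n) (B i) (v i)) \<and>
    (AE t in M. \<exists>i. t \<in> B i)" ..
  from choice[OF this] obtain B where "\<forall>n. \<exists>v. disjoint_family (B n :: nat \<Rightarrow> 't set) \<and>
    (\<forall>i. nearly_constant_density ((1/2)^n) (B n i) (v i)) \<and> (AE t in M. \<exists>i. t \<in> B n i)" ..
  from choice[OF this] obtain v where Bv: "\<forall>n. disjoint_family (B n :: nat \<Rightarrow> 't set) \<and>
    (\<forall>i. nearly_constant_density ((1/2)^n) (B n i) (v n i)) \<and> (AE t in M. \<exists>i. t \<in> B n i)" ..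
  have B: "\<And>n. disjoint_family (B n)" "\<And>n i. nearly_constant_density ((1/2)^n) (B n i) (v n i)"
    "\<And>n. AE t in M. \<exists>i. t \<in> B n i"
    using Bv by simp_all
  have Bs: "B n i \<in> sets M" for n i using B(2)[of n i] unfolding nearly_constant_density_def by (simp add: fmeasurable_def)
  have "\<exists>j. j \<in> measurable M (count_space UNIV) \<and> (\<forall>t i. t \<in> B n i \<longrightarrow> t \<in> B n (j t))" for n
  proof -
    obtain j where "j \<in> measurable M (count_space UNIV)" "range j \<subseteq> (UNIV::nat set)"
      "\<And>t i. i \<in> UNIV \<Longrightarrow> t \<in> B n i \<Longrightarrow> t \<in> B n (j t)"
      using countable_measurable_choice[of UNIV "B n" M, OF _ _ Bs space_UNIV] by auto
    then show ?thesis by (intro exI[of _ j]) simp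
  qed
  then have "\<forall>n. \<exists>j. j \<in> measurable M (count_space UNIV) \<and> (\<forall>t i. t \<in> B n i \<longrightarrow> t \<in> B n (j t))" ..
  from choice[OF this] obtain j where j: "\<And>n. j n \<in> measurable M (count_space UNIV)"
    "\<And>n t i. t \<in> B n i \<Longrightarrow> t \<in> B n (j n t)" by blast
  define x where "x n t = v n (j n t)" for n t
  have x: "strongly_measurable M (x n)" for n
  proof (rule strongly_measurable_countable)
    show "x n \<in> measurable M (count_space UNIV)"
      unfolding x_def using j(1) by (rule measurable_compose) simp
    have "range (x n) \<subseteq> range (v n)" unfolding x_def by auto
    then show "countable (range (x n))" by (rule countable_subset) simp
  qed
  have pair: "AE t in M. t \<in> B n i \<inter> B k l \<longrightarrow> norm (v n i - v k l) \<le> (1/2)^n + (1/2)^k" for n k i l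
  proof (cases "B n i \<inter> B k l \<in> null_sets M")
    case True
    show ?thesis using AE_not_in[OF True] by eventually_elim blast
  next
    case False
    show ?thesis using nearly_constant_density_unique[OF B(2) B(2) False] by simp
  qed
  have "AE t in M. \<forall>n k i l. t \<in> B n i \<inter> B k l \<longrightarrow> norm (v n i - v k l) \<le> (1/2)^n + (1/2)^k"
    unfolding AE_all_countable using pair by simp
  moreover have "AE t in M. \<forall>n. \<exists>i. t \<in> B n i" unfolding AE_all_countable using B(3) by simp
  ultimately have ae: "AE t in M. \<exists>y. (\<lambda>n. x n t) \<longlonglongrightarrow> y \<and> (\<forall>n i. t \<in> B n i \<longrightarrow> norm (y - v n i) \<le> (1/2)^n)"
  proof eventually_elim
    case (elim t)
    have half: "(\<lambda>k. (1/2)^k :: real) \<longlonglongrightarrow> 0" by (rule LIMSEQ_power_zero) simp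
    have xt: "t \<in> B n (j n t)" for n using elim(2) j(2) by blast
    have close: "norm (v n i - x k t) \<le> (1/2)^n + (1/2)^k" if "t \<in> B n i" for n i k
      using elim(1) that xt[of k] unfolding x_def by blast
    have "Cauchy (\<lambda>n. x n t)"
    proof (rule metric_CauchyI)
      fix e :: real assume "e > 0"
      then obtain N where N: "(1/2)^N < e / 2" using real_arch_pow_inv[of "e/2" "1/2"] by auto
      have "dist (x m t) (x n t) < e" if "N \<le> m" "N \<le> n" for m n
      proof -
        have "(1/2)^m \<le> (1/2 :: real)^N" "(1/2)^n \<le> (1/2 :: real)^N"
          using that by (auto intro: power_decreasing)
        moreover have "norm (x m t - x n t) \<le> (1/2)^m + (1/2)^n"
          using close[OF xt, of m n] unfolding x_def .
        ultimately show ?thesis using N unfolding dist_norm by linarith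
      qed
      then show "\<exists>N. \<forall>m\<ge>N. \<forall>n\<ge>N. dist (x m t) (x n t) < e" by blast
    qed
    then obtain y where y: "(\<lambda>n. x n t) \<longlonglongrightarrow> y" using Cauchy_convergent_iff convergent_def by blast
    have "norm (y - v n i) \<le> (1/2)^n" if t: "t \<in> B n i" for n i
    proof -
      have "(\<lambda>k. norm (v n i - x k t)) \<longlonglongrightarrow> norm (v n i - y)"
        by (intro tendsto_norm tendsto_diff tendsto_const y)
      moreover have "(\<lambda>k. (1/2)^n + (1/2)^k :: real) \<longlonglongrightarrow> (1/2)^n + 0"
        by (intro tendsto_add tendsto_const half)
      ultimately have "norm (v n i - y) \<le> (1/2)^n + 0"
        by (rule LIMSEQ_le) (use close[OF t] in blast)
      then show ?thesis by (simp add: norm_minus_commute)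
    qed
    with y show ?case by blast
  qed
  define x' where "x' t = lim (\<lambda>n. x n t)" for t
  show ?thesis
  proof (rule that[of x' B v])
    show "strongly_measurable M x'"
      by (rule strongly_measurable_LIMSEQ[OF x]) (use ae in \<open>eventually_elim, auto simp: x'_def limI\<close>)
    from ae show "AE t in M. \<forall>n i. t \<in> B n i \<longrightarrow> norm (x' t - v n i) \<le> (1/2)^n"
      by eventually_elim (auto simp: x'_def limI)
  qed (use B in simp_all)
qed

context
  fixes x' :: "'t \<Rightarrow> 'x \<Rightarrow>\<^sub>L real" and B :: "nat \<Rightarrow> nat \<Rightarrow> 't set" and v :: "nat \<Rightarrow> nat \<Rightarrow> 'x \<Rightarrow>\<^sub>L real"
  assumes x': "strongly_measurable M x'"
    and B: "\<And>n. disjoint_family (B n)" "\<And>n i. nearly_constant_density ((1/2)^n) (B n i) (v n i)"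
      "\<And>n. AE t in M. \<exists>i. t \<in> B n i"
    and close: "AE t in M. \<forall>n i. t \<in> B n i \<longrightarrow> norm (x' t - v n i) \<le> (1/2)^n"
begin

lemma piece_fmeasurable: "B n i \<in> fmeasurable M"
  using B(2)[of n i] unfolding nearly_constant_density_def by simp

lemma integrable_density_piece:
  assumes D: "D \<in> sets M" "D \<subseteq> B n i"
  shows "integrable M (\<lambda>t. if t \<in> D then blinfun_apply (x' t) z else 0)"
proof (rule Bochner_Integration.integrable_bound[where f = "\<lambda>t. (norm (v n i) + 1) * norm z * indicator D t"])
  have "D \<in> fmeasurable M" by (rule fmeasurableI2[OF piece_fmeasurable D(2,1)])
  then show "integrable M (\<lambda>t. (norm (v n i) + 1) * norm z * indicator D t)" by (auto simp: fmeasurable_def)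
  show "(\<lambda>t. if t \<in> D then blinfun_apply (x' t) z else 0) \<in> borel_measurable M"
    using D(1) measurable_pairing[OF x' strongly_measurable_const, of z] by (intro measurable_If) auto
  from close show "AE t in M. norm (if t \<in> D then blinfun_apply (x' t) z else 0)
      \<le> norm ((norm (v n i) + 1) * norm z * indicator D t)"
  proof eventually_elim
    case (elim t)
    show ?case
    proof (cases "t \<in> D")
      case True
      then have "norm (x' t - v n i) \<le> (1/2)^n" using elim D(2) by blast
      also have "\<dots> \<le> (1::real)" by (rule power_le_one) auto
      finally have "norm (x' t) \<le> norm (v n i) + 1" using norm_triangle_sub[of "x' t" "v n i"] by linarith
      then have "norm (x' t) * norm z \<le> (norm (v n i) + 1) * norm z" by (rule mult_right_mono) simp
      then have "\<bar>blinfun_apply (x' t) z\<bar> \<le> (norm (v n i) + 1) * norm z"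
        using norm_blinfun[of "x' t" z] by simp
      then show ?thesis using True by simp
    qed simp
  qed
qed

lemma integral_density_piece:
  assumes D: "D \<in> sets M" "D \<subseteq> B n i"
  shows "\<bar>\<phi> (\<lambda>t. if t \<in> D then z else 0) - (\<integral>t. (if t \<in> D then blinfun_apply (x' t) z else 0) \<partial>M)\<bar>
    \<le> 2 * (1/2)^n * norm z * measure M D"
proof -
  have Df: "D \<in> fmeasurable M" by (rule fmeasurableI2[OF piece_fmeasurable D(2,1)])
  have iD: "integrable M (\<lambda>t. c * indicator D t)" for c :: real using Df by (auto simp: fmeasurable_def)
  let ?a = "\<lambda>t. if t \<in> D then blinfun_apply (x' t) z else 0"
  have ia: "integrable M ?a" by (rule integrable_density_piece[OF D])
  have "\<bar>\<integral>t. ?a t - blinfun_apply (v n i) z * indicator D t \<partial>M\<bar>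
      \<le> (\<integral>t. \<bar>?a t - blinfun_apply (v n i) z * indicator D t\<bar> \<partial>M)" by (rule integral_abs_bound)
  also have "\<dots> \<le> (\<integral>t. (1/2)^n * norm z * indicator D t \<partial>M)"
  proof (rule integral_mono_AE)
    show "integrable M (\<lambda>t. \<bar>?a t - blinfun_apply (v n i) z * indicator D t\<bar>)"
      by (intro integrable_abs Bochner_Integration.integrable_diff ia iD)
    from close show "AE t in M. \<bar>?a t - blinfun_apply (v n i) z * indicator D t\<bar> \<le> (1/2)^n * norm z * indicator D t"
    proof eventually_elim
      case (elim t)
      show ?case
      proof (cases "t \<in> D")
        case True
        then have "norm (x' t - v n i) \<le> (1/2)^n" using elim D(2) by blast
        then have "norm (x' t - v n i) * norm z \<le> (1/2)^n * norm z" by (rule mult_right_mono) simp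
        then have "\<bar>blinfun_apply (x' t - v n i) z\<bar> \<le> (1/2)^n * norm z"
          using norm_blinfun[of "x' t - v n i" z] by simp
        then show ?thesis using True by (simp add: blinfun.diff_left)
      qed simp
    qed
  qed (rule iD)
  finally have 1: "\<bar>(\<integral>t. ?a t \<partial>M) - blinfun_apply (v n i) z * measure M D\<bar> \<le> (1/2)^n * norm z * measure M D"
    using Df ia iD by (simp add: fmeasurable_def)
  have "norm (dual_measure D - measure M D *\<^sub>R v n i) \<le> (1/2)^n * measure M D"
    using B(2)[of n i] D unfolding nearly_constant_density_def by blast
  then have "norm (dual_measure D - measure M D *\<^sub>R v n i) * norm z \<le> (1/2)^n * measure M D * norm z"
    by (rule mult_right_mono) simp
  then have "\<bar>blinfun_apply (dual_measure D - measure M D *\<^sub>R v n i) z\<bar> \<le> (1/2)^n * measure M D * norm z"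
    using norm_blinfun[of "dual_measure D - measure M D *\<^sub>R v n i" z] by simp
  then have 2: "\<bar>\<phi> (\<lambda>t. if t \<in> D then z else 0) - blinfun_apply (v n i) z * measure M D\<bar> \<le> (1/2)^n * norm z * measure M D"
    by (simp add: blinfun.diff_left blinfun.scaleR_left dual_measure_apply[OF Df] mult_ac)
  have *: "2 * (1/2)^n * norm z * measure M D = (1/2)^n * norm z * measure M D + (1/2)^n * norm z * measure M D"
    by simp
  show ?thesis using 1 2 unfolding * by linarith
qed

text \<open>Cut \<open>E\<close> along the \<open>n\<close>-th partition. On each part the functional and the integral differ by at
  most \<open>2 * (1/2)^n * norm z\<close> times its measure; sum over the parts and let \<open>n\<close> tend to infinity. The
  set \<open>B 0 l\<close> serves as a set of finite measure on which \<open>x'\<close> is essentially bounded.\<close>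
lemma density_represents_step:
  assumes E: "E \<in> sets M" "E \<subseteq> B 0 l"
  shows "\<phi> (\<lambda>t. if t \<in> E then z else 0) = (\<integral>t. (if t \<in> E then blinfun_apply (x' t) z else 0) \<partial>M)"
proof -
  let ?a = "\<lambda>E t. if t \<in> E then blinfun_apply (x' t) z else 0"
  define X where "X = \<phi> (\<lambda>t. if t \<in> E then z else 0) - (\<integral>t. ?a E t \<partial>M)"
  have Ef: "E \<in> fmeasurable M" by (rule fmeasurableI2[OF piece_fmeasurable E(2,1)])
  have "\<bar>X\<bar> \<le> 2 * (1/2)^n * (norm z * measure M E)" for n
  proof -
    define D where "D j = E \<inter> B n j" for j
    have Bs: "B n j \<in> sets M" for j using piece_fmeasurable[of n j] by (simp add: fmeasurable_def)
    have D: "disjoint_family D" "\<And>j. D j \<in> sets M" "\<And>j. D j \<subseteq> E" "\<And>j. D j \<subseteq> B n j"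
      unfolding D_def using B(1)[of n] E(1) Bs by (auto simp: disjoint_family_on_def)
    have Us: "(\<Union>j. D j) \<in> sets M" "(\<Union>j. D j) \<subseteq> E" using D by auto
    have Uf: "(\<Union>j. D j) \<in> fmeasurable M" by (rule fmeasurableI2[OF Ef Us(2,1)])
    have aeU: "AE t in M. t \<in> (\<Union>j. D j) \<longleftrightarrow> t \<in> E" using B(3)[of n] by eventually_elim (auto simp: D_def)
    have eq: "\<phi> (\<lambda>t. if t \<in> (\<Union>j. D j) then z else 0) = \<phi> (\<lambda>t. if t \<in> E then z else 0)"
      by (rule Lp_dual_cong_AE[OF p \<phi> step_Lp[OF Uf] step_Lp[OF Ef]])
        (use aeU in \<open>eventually_elim, simp\<close>)
    have s1: "(\<lambda>j. \<phi> (\<lambda>t. if t \<in> D j then z else 0)) sums \<phi> (\<lambda>t. if t \<in> E then z else 0)"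
      using dual_measure_UN[OF Ef D(1,2,3), of z]
      unfolding dual_measure_apply[OF Uf] eq dual_measure_apply[OF fmeasurableI2[OF Ef D(3,2)]] .
    have i: "integrable M (?a (D j))" for j by (rule integrable_density_piece[OF D(2,4)])
    have "(\<lambda>m. \<integral>t. ?a (\<Union>j<m. D j) t \<partial>M) \<longlonglongrightarrow> (\<integral>t. ?a E t \<partial>M)"
    proof (rule integral_dominated_convergence[where w = "\<lambda>t. \<bar>?a E t\<bar>"])
      show "integrable M (\<lambda>t. \<bar>?a E t\<bar>)" by (intro integrable_abs integrable_density_piece[OF E])
      show "?a E \<in> borel_measurable M"
        using integrable_density_piece[OF E] by (rule borel_measurable_integrable)
      show "?a (\<Union>j<m. D j) \<in> borel_measurable M" for m
      proof (rule measurable_If)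
        have "(\<Union>j<m. D j) \<in> sets M" using D(2) by (intro sets.finite_UN) auto
        moreover have "{t \<in> space M. t \<in> (\<Union>j<m. D j)} = (\<Union>j<m. D j)" by auto
        ultimately show "{t \<in> space M. t \<in> (\<Union>j<m. D j)} \<in> sets M" by simp
      qed (use measurable_pairing[OF x' strongly_measurable_const, of z] in auto)
      show "AE t in M. norm (?a (\<Union>j<m. D j) t) \<le> \<bar>?a E t\<bar>" for m
        by (rule AE_I2) (use D(3) in auto)
      from aeU show "AE t in M. (\<lambda>m. ?a (\<Union>j<m. D j) t) \<longlonglongrightarrow> ?a E t"
      proof (eventually_elim, intro tendsto_eventually)
        fix t assume t: "t \<in> (\<Union>j. D j) \<longleftrightarrow> t \<in> E"
        show "\<forall>\<^sub>F m in sequentially. ?a (\<Union>j<m. D j) t = ?a E t"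
        proof (cases "t \<in> E")
          case True
          then obtain j where "t \<in> D j" using t by blast
          then have "\<forall>m\<ge>Suc j. ?a (\<Union>j<m. D j) t = ?a E t" using True by auto
          then show ?thesis unfolding eventually_sequentially by blast
        next
          case False
          then have "?a (\<Union>j<m. D j) t = ?a E t" for m using D(3) by auto
          then show ?thesis by simp
        qed
      qed
    qed
    moreover have "(\<integral>t. ?a (\<Union>j<m. D j) t \<partial>M) = (\<Sum>j<m. \<integral>t. ?a (D j) t \<partial>M)" for m
      unfolding sum_if_disjoint_family[OF D(1), symmetric] by (rule Bochner_Integration.integral_sum[OF i])
    ultimately have s2: "(\<lambda>j. \<integral>t. ?a (D j) t \<partial>M) sums (\<integral>t. ?a E t \<partial>M)" unfolding sums_def by simp
    have s3: "(\<lambda>j. \<phi> (\<lambda>t. if t \<in> D j then z else 0) - (\<integral>t. ?a (D j) t \<partial>M)) sums X"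
      unfolding X_def by (rule sums_diff[OF s1 s2])
    let ?K = "2 * (1/2)^n * norm z"
    have s4: "(\<lambda>j. ?K * measure M (D j)) sums (?K * measure M (\<Union>j. D j))"
      by (rule sums_mult[OF measure_UN_sums[OF Ef D(1,2,3)]])
    have b: "\<bar>\<phi> (\<lambda>t. if t \<in> D j then z else 0) - (\<integral>t. ?a (D j) t \<partial>M)\<bar> \<le> ?K * measure M (D j)" for j
      by (rule integral_density_piece[OF D(2,4)])
    have "X \<le> ?K * measure M (\<Union>j. D j)"
      by (rule sums_le[OF _ s3 s4]) (use b abs_le_D1 in blast)
    moreover have "- X \<le> ?K * measure M (\<Union>j. D j)"
      by (rule sums_le[OF _ sums_minus[OF s3] s4]) (use b abs_le_D2 in blast)
    moreover have "?K * measure M (\<Union>j. D j) \<le> ?K * measure M E"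
      by (intro mult_left_mono measure_mono_fmeasurable Us Ef) auto
    ultimately show ?thesis by (simp add: abs_le_iff mult_ac)
  qed
  moreover have "(\<lambda>n. 2 * (1/2)^n * (norm z * measure M E)) \<longlonglongrightarrow> 2 * 0 * (norm z * measure M E)"
    by (intro tendsto_mult tendsto_const LIMSEQ_power_zero) simp
  ultimately have "\<bar>X\<bar> \<le> 2 * 0 * (norm z * measure M E)" by (intro LIMSEQ_le_const) auto
  then show ?thesis unfolding X_def by simp
qed

lemma density_represents_simple:
  assumes w: "simple_function M w" and supp: "\<And>t. t \<notin> (\<Union>i<n. B 0 i) \<Longrightarrow> w t = 0"
  shows "w \<in> Lp M (ereal p) \<and> integrable M (\<lambda>t. blinfun_apply (x' t) (w t)) \<and>
    \<phi> w = (\<integral>t. blinfun_apply (x' t) (w t) \<partial>M)"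
proof -
  define Q where "Q = {..<n} \<times> range w"
  have Q: "finite Q" unfolding Q_def using w by (auto simp: simple_function_def)
  define E where "E q = B 0 (fst q) \<inter> w -` {snd q}" for q
  have Es: "E q \<in> sets M" "E q \<subseteq> B 0 (fst q)" for q
  proof -
    have "w -` {snd q} \<inter> space M \<in> sets M"
      by (rule measurable_sets[OF measurable_simple_function[OF w]]) simp
    then show "E q \<in> sets M" unfolding E_def using piece_fmeasurable[of 0 "fst q"] by (auto simp: fmeasurable_def)
    show "E q \<subseteq> B 0 (fst q)" unfolding E_def by simp
  qed
  have Ef: "E q \<in> fmeasurable M" for q by (rule fmeasurableI2[OF piece_fmeasurable Es(2,1)])
  have sumw: "(\<Sum>q\<in>Q. if t \<in> E q then snd q else 0) = w t" for t
  proof (cases "t \<in> (\<Union>i<n. B 0 i)")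
    case True
    then obtain i where i: "i < n" "t \<in> B 0 i" by blast
    have "t \<notin> B 0 j" if "j \<noteq> i" for j using B(1)[of 0] i(2) that unfolding disjoint_family_on_def by blast
    then have "t \<in> E q \<longleftrightarrow> q = (i, w t)" for q unfolding E_def using i(2) by (cases q) auto
    then have "(\<Sum>q\<in>Q. if t \<in> E q then snd q else 0) = (\<Sum>q\<in>Q. if q = (i, w t) then w t else 0)"
      by (intro sum.cong refl) auto
    then show ?thesis using Q i(1) by (simp add: Q_def)
  next
    case False
    then have "t \<notin> E q" if "q \<in> Q" for q using that unfolding E_def Q_def by auto
    then have "(\<Sum>q\<in>Q. if t \<in> E q then snd q else 0) = 0" by (intro sum.neutral) auto
    then show ?thesis using supp[OF False] by simp
  qed
  have sumx: "(\<Sum>q\<in>Q. if t \<in> E q then blinfun_apply (x' t) (snd q) else 0) = blinfun_apply (x' t) (w t)" for t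
  proof -
    have "blinfun_apply (x' t) (w t) = (\<Sum>q\<in>Q. blinfun_apply (x' t) (if t \<in> E q then snd q else 0))"
      unfolding sumw[symmetric] by (rule blinfun.sum_right)
    also have "\<dots> = (\<Sum>q\<in>Q. if t \<in> E q then blinfun_apply (x' t) (snd q) else 0)"
      by (intro sum.cong refl) auto
    finally show ?thesis ..
  qed
  have "(\<lambda>t. \<Sum>q\<in>Q. if t \<in> E q then snd q else 0) = w" using sumw by blast
  with Lp_dual_sum[OF p \<phi> Q, of "\<lambda>q t. if t \<in> E q then snd q else 0", OF step_Lp[OF Ef]]
  have 1: "w \<in> Lp M (ereal p)" "\<phi> w = (\<Sum>q\<in>Q. \<phi> (\<lambda>t. if t \<in> E q then snd q else 0))" by simp_all
  have i: "integrable M (\<lambda>t. if t \<in> E q then blinfun_apply (x' t) (snd q) else 0)" for q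
    by (rule integrable_density_piece[OF Es])
  have "integrable M (\<lambda>t. \<Sum>q\<in>Q. if t \<in> E q then blinfun_apply (x' t) (snd q) else 0)"
    by (rule Bochner_Integration.integrable_sum) (rule i)
  moreover have "(\<integral>t. (\<Sum>q\<in>Q. if t \<in> E q then blinfun_apply (x' t) (snd q) else 0) \<partial>M) = \<phi> w"
    unfolding 1(2) by (subst Bochner_Integration.integral_sum[OF i]) (simp add: density_represents_step[OF Es])
  ultimately show ?thesis using 1(1) unfolding sumx by simp
qed

text \<open>Simple functions that converge to \<open>y\<close> are set to 0 where their norm exceeds \<open>2 * norm (y t)\<close>.
  The convergence persists and becomes dominated, both for the functional and for the integral.\<close>
lemma density_represents:
  assumes y: "y \<in> Lp M (ereal p)" and i: "integrable M (\<lambda>t. norm (x' t) * norm (y t))"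
  shows "\<phi> y = (\<integral>t. blinfun_apply (x' t) (y t) \<partial>M)"
proof -
  have sy: "strongly_measurable M y" using y by (simp add: Lp_iff)
  obtain s where s: "\<And>n::nat. simple_function M (s n)" "AE t in M. (\<lambda>n. s n t) \<longlonglongrightarrow> y t"
    using sy unfolding strongly_measurable_def by blast
  define G where "G n = (\<Union>i<n. B 0 i)" for n
  have Gs: "G n \<in> sets M" for n unfolding G_def using piece_fmeasurable[of 0] by (auto simp: fmeasurable_def)
  define w where "w n t = (if t \<in> G n \<and> norm (s n t) \<le> 2 * norm (y t) then s n t else 0)" for n t
  have ws: "simple_function M (w n)" for n unfolding w_def
  proof (rule simple_function_If[OF s(1)])
    have m: "(\<lambda>t. norm (s n t)) \<in> borel_measurable M" "(\<lambda>t. 2 * norm (y t)) \<in> borel_measurable M"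
      using measurable_norm_strongly[OF strongly_measurable_simple[OF s(1)]] measurable_norm_strongly[OF sy]
      by (auto intro: borel_measurable_times)
    have "{t\<in>space M. norm (s n t) \<le> 2 * norm (y t)} \<in> sets M" by (rule borel_measurable_le[OF m])
    moreover have "{t\<in>space M. t \<in> G n \<and> norm (s n t) \<le> 2 * norm (y t)} = G n \<inter> {t\<in>space M. norm (s n t) \<le> 2 * norm (y t)}"
      by auto
    ultimately show "{t\<in>space M. t \<in> G n \<and> norm (s n t) \<le> 2 * norm (y t)} \<in> sets M" using Gs[of n] by auto
  qed simp
  have w: "w n \<in> Lp M (ereal p) \<and> integrable M (\<lambda>t. blinfun_apply (x' t) (w n t)) \<and>
    \<phi> (w n) = (\<integral>t. blinfun_apply (x' t) (w n t) \<partial>M)" for n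
    by (rule density_represents_simple[OF ws, of n]) (simp add: w_def G_def)
  have le: "norm (w n t) \<le> 2 * norm (y t)" for n t unfolding w_def by simp
  have lim: "AE t in M. (\<lambda>n. w n t) \<longlonglongrightarrow> y t"
    using s(2) B(3)[of 0]
  proof eventually_elim
    case (elim t)
    show ?case
    proof (cases "y t = 0")
      case True
      then have "w n t = 0" for n using le[of n t] by simp
      then show ?thesis using True by simp
    next
      case False
      obtain i where "t \<in> B 0 i" using elim(2) by blast
      then have "\<forall>n\<ge>Suc i. t \<in> G n" unfolding G_def by auto
      then have e1: "\<forall>\<^sub>F n in sequentially. t \<in> G n" unfolding eventually_sequentially by blast
      have "(\<lambda>n. norm (s n t)) \<longlonglongrightarrow> norm (y t)" using elim(1) by (rule tendsto_norm)
      moreover have "norm (y t) < 2 * norm (y t)" using False by simp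
      ultimately have "\<forall>\<^sub>F n in sequentially. norm (s n t) < 2 * norm (y t)" by (rule order_tendstoD)
      with e1 have "\<forall>\<^sub>F n in sequentially. s n t = w n t" by eventually_elim (simp add: w_def)
      then show ?thesis by (rule Lim_transform_eventually[OF elim(1)])
    qed
  qed
  have "(\<lambda>n. \<phi> (w n)) \<longlonglongrightarrow> \<phi> y"
    by (rule Lp_dual_tendsto(2)[OF p \<phi> y strongly_measurable_simple[OF ws] _ lim, of 2]) (simp add: le)
  moreover have "(\<lambda>n. \<integral>t. blinfun_apply (x' t) (w n t) \<partial>M) \<longlonglongrightarrow> (\<integral>t. blinfun_apply (x' t) (y t) \<partial>M)"
  proof (rule integral_dominated_convergence[where w = "\<lambda>t. 2 * (norm (x' t) * norm (y t))"])
    show "(\<lambda>t. blinfun_apply (x' t) (y t)) \<in> borel_measurable M" by (rule measurable_pairing[OF x' sy])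
    show "(\<lambda>t. blinfun_apply (x' t) (w n t)) \<in> borel_measurable M" for n
      by (rule measurable_pairing[OF x' strongly_measurable_simple[OF ws]])
    show "integrable M (\<lambda>t. 2 * (norm (x' t) * norm (y t)))" using i by simp
    from lim show "AE t in M. (\<lambda>n. blinfun_apply (x' t) (w n t)) \<longlonglongrightarrow> blinfun_apply (x' t) (y t)"
      by eventually_elim (rule bounded_linear.tendsto[OF blinfun.bounded_linear_right])
    show "AE t in M. norm (blinfun_apply (x' t) (w n t)) \<le> 2 * (norm (x' t) * norm (y t))" for n
    proof (rule AE_I2)
      fix t
      have "norm (blinfun_apply (x' t) (w n t)) \<le> norm (x' t) * norm (w n t)" by (rule norm_blinfun)
      also have "\<dots> \<le> norm (x' t) * (2 * norm (y t))" by (rule mult_left_mono[OF le]) simp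
      finally show "norm (blinfun_apply (x' t) (w n t)) \<le> 2 * (norm (x' t) * norm (y t))" by simp
    qed
  qed
  ultimately show ?thesis using w by (intro LIMSEQ_unique[of "\<lambda>n. \<phi> (w n)"]) auto
qed

end

end

section \<open>The dual of a Lebesgue-Bochner space\<close>
lemma lindelof_measurable_UNIV: "lindelof_measurable M (\<lambda>_. UNIV)"
  unfolding lindelof_measurable_def
proof (intro conjI allI impI)
  fix V :: "'b set" show "{t. UNIV \<inter> V \<noteq> {}} \<in> sets M"
    using sets.top[of M] by (cases "V = {}") auto
next
  fix \<V> :: "'b set set"
  show "\<exists>\<V>'\<subseteq>\<V>. countable \<V>' \<and> (AE t in M. (\<exists>V\<in>\<V>. UNIV \<inter> V \<noteq> {}) \<longrightarrow> (\<exists>V\<in>\<V>'. UNIV \<inter> V \<noteq> {}))"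
  proof (cases "\<exists>V\<in>\<V>. V \<noteq> {}")
    case True
    then obtain V where "V \<in> \<V>" "V \<noteq> {}" by blast
    then show ?thesis by (intro exI[of _ "{V}"]) auto
  qed (intro exI[of _ "{}"], auto)
qed

text \<open>Allowing the norm 2 instead of 1 leaves room for an exact inequality. It also makes the set of
  admissible pairs \<open>(x' t, v t)\<close> open, so that \<open>v\<close> is a measurable selection.\<close>
lemma exists_norming:
  fixes x' :: "'t \<Rightarrow> 'x::banach \<Rightarrow>\<^sub>L real"
  assumes x': "strongly_measurable M x'"
  obtains v where "strongly_measurable M v" "\<And>t. norm (v t) \<le> 2" "AE t in M. norm (x' t) \<le> blinfun_apply (x' t) (v t)"
proof -
  define W where "W = {w :: ('x \<Rightarrow>\<^sub>L real) \<times> 'x. norm (fst w) < blinfun_apply (fst w) (snd w)} \<inter> {w. norm (snd w) < 2}"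
  have W: "open W" unfolding W_def
    by (intro open_Int open_Collect_less continuous_on_const continuous_on_norm blinfun.continuous_on
        continuous_on_fst continuous_on_snd continuous_on_id)
  define E where "E = {t. x' t \<noteq> 0}"
  have E: "E \<in> sets M"
  proof -
    have "(\<lambda>t. norm (x' t)) -` {0<..} \<inter> space M \<in> sets M"
      by (rule measurable_sets[OF measurable_norm_strongly[OF x']]) simp
    moreover have "(\<lambda>t. norm (x' t)) -` {0<..} \<inter> space M = E" unfolding E_def by auto
    ultimately show ?thesis by simp
  qed
  have "\<exists>z. (a, z) \<in> W" if "a \<noteq> 0" for a :: "'x \<Rightarrow>\<^sub>L real"
  proof -
    \<comment> \<open>A vector of norm at most 1 at which \<open>a\<close> exceeds 3/4 of its norm is scaled by 3/2.\<close>
    have "3/4 * norm a < norm a" "0 \<le> 3/4 * norm a" using that by auto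
    then obtain z where z: "norm z \<le> 1" "3/4 * norm a < blinfun_apply a z" using norm_blinfun_attained by metis
    have "norm a < 3/2 * blinfun_apply a z" using z(2) norm_ge_zero[of a] by linarith
    then have "(a, (3/2) *\<^sub>R z) \<in> W" unfolding W_def using z(1) by (simp add: blinfun.scaleR_right)
    then show ?thesis ..
  qed
  then have ne: "AE t in M. t \<in> E \<longrightarrow> (\<exists>z\<in>UNIV. (x' t, z) \<in> W)" unfolding E_def by (intro AE_I2) auto
  obtain z where z: "strongly_measurable M z" "AE t in M. t \<in> E \<longrightarrow> z t \<in> UNIV \<and> (x' t, z t) \<in> W"
    by (rule lindelof_measurable_selection[OF lindelof_measurable_UNIV closed_UNIV x' W E ne])
  define v where "v t = (if t \<in> E \<and> norm (z t) \<le> 2 then z t else 0)" for t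
  show ?thesis
  proof
    show "strongly_measurable M v" unfolding v_def
    proof (rule strongly_measurable_If[OF z(1) strongly_measurable_const])
      have "(\<lambda>t. norm (z t)) -` {..2} \<inter> space M \<in> sets M"
        by (rule measurable_sets[OF measurable_norm_strongly[OF z(1)]]) simp
      moreover have "{t \<in> space M. t \<in> E \<and> norm (z t) \<le> 2} = E \<inter> ((\<lambda>t. norm (z t)) -` {..2} \<inter> space M)" by auto
      ultimately show "{t \<in> space M. t \<in> E \<and> norm (z t) \<le> 2} \<in> sets M" using E by auto
    qed
    show "norm (v t) \<le> 2" for t unfolding v_def by simp
    from z(2) show "AE t in M. norm (x' t) \<le> blinfun_apply (x' t) (v t)"
    proof eventually_elim
      case (elim t)
      show ?case
      proof (cases "t \<in> E")
        case True
        then have "norm (x' t) < blinfun_apply (x' t) (z t)" "norm (z t) < 2" using elim unfolding W_def by auto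
        then show ?thesis unfolding v_def using True by simp
      qed (simp add: E_def)
    qed
  qed
qed

text \<open>For \<open>p > 1\<close> the test function \<open>norm (x' t) powr (r - 1) *\<^sub>R v t\<close>, restricted to a set \<open>A n\<close> on
  which \<open>x'\<close> is bounded, gives \<open>I \<le> 2 * C * I powr (1 / p)\<close> for the integral \<open>I\<close> of the \<open>r\<close>-th power
  of the norm over \<open>A n\<close>, a bound for \<open>I\<close> that does not depend on \<open>n\<close>. For \<open>p = 1\<close> the test function \<open>v\<close> on the set
  where the norm of \<open>x'\<close> exceeds \<open>2 * C\<close> shows that this set is null.\<close>
lemma Lq_if_pairing_bounded:
  fixes x' :: "'t \<Rightarrow> 'x::banach \<Rightarrow>\<^sub>L real"
  assumes p: "1 \<le> p" and q: "q = (if p = 1 then \<infinity> else ereal (p / (p - 1)))" and x': "strongly_measurable M x'"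
    and C: "0 \<le> C" "\<And>y. y \<in> Lp M (ereal p) \<Longrightarrow> integrable M (\<lambda>t. norm (x' t) * norm (y t)) \<Longrightarrow>
      (\<integral>t. blinfun_apply (x' t) (y t) \<partial>M) \<le> C * (\<integral>t. norm (y t) powr p \<partial>M) powr (1 / p)"
  shows "x' \<in> Lp M q"
proof -
  obtain v where v: "strongly_measurable M v" "\<And>t. norm (v t) \<le> 2"
    "AE t in M. norm (x' t) \<le> blinfun_apply (x' t) (v t)" using exists_norming[OF x'] by metis
  obtain A :: "nat \<Rightarrow> 't set" where A: "\<And>n. A n \<in> fmeasurable M" "incseq A" "(\<Union>n. A n) = UNIV"
    "\<And>n t. t \<in> A n \<Longrightarrow> norm (x' t) \<le> real n" using bounded_exhaustion[OF x'] by metis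
  have nm: "(\<lambda>t. norm (x' t)) \<in> borel_measurable M" by (rule measurable_norm_strongly[OF x'])
  \<comment> \<open>Multiples of \<open>v\<close> by bounded scalar functions, cut off to a subset of \<open>A n\<close>, are test functions.\<close>
  have test: "(\<lambda>t. if t \<in> D then c t *\<^sub>R v t else 0) \<in> Lp M (ereal p) \<and>
      integrable M (\<lambda>t. norm (x' t) * norm (if t \<in> D then c t *\<^sub>R v t else 0))"
    if D: "D \<in> sets M" "D \<subseteq> A n" and c: "c \<in> borel_measurable M" "\<And>t. t \<in> D \<Longrightarrow> \<bar>c t\<bar> \<le> K" for D n c K
  proof -
    let ?y = "\<lambda>t. if t \<in> D then c t *\<^sub>R v t else 0"
    have Df: "D \<in> fmeasurable M" by (rule fmeasurableI2[OF A(1) D(2,1)])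
    have y: "strongly_measurable M ?y"
      using strongly_measurable_scaleR[OF c(1) v(1)] D(1) by (intro strongly_measurable_If) auto
    have le: "norm (?y t) \<le> K * 2 * indicator D t" for t
    proof (cases "t \<in> D")
      case True
      have "\<bar>c t\<bar> * norm (v t) \<le> K * 2" using c(2)[OF True] v(2)[of t] by (intro mult_mono) auto
      then show ?thesis using True by simp
    qed simp
    have "?y \<in> Lp M (ereal p)"
      by (rule Lp_bounded_finite_support[OF y, of D "K * 2"]) (use Df le p in \<open>auto simp: fmeasurable_def\<close>)
    moreover have "integrable M (\<lambda>t. norm (x' t) * norm (?y t))"
    proof (rule Bochner_Integration.integrable_bound[where f = "\<lambda>t. real n * (K * 2) * indicator D t"])
      show "integrable M (\<lambda>t. real n * (K * 2) * indicator D t)" using Df by (auto simp: fmeasurable_def)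
      show "(\<lambda>t. norm (x' t) * norm (?y t)) \<in> borel_measurable M"
        by (rule borel_measurable_times[OF nm measurable_norm_strongly[OF y]])
      show "AE t in M. norm (norm (x' t) * norm (?y t)) \<le> norm (real n * (K * 2) * indicator D t)"
      proof (rule AE_I2)
        fix t
        show "norm (norm (x' t) * norm (?y t)) \<le> norm (real n * (K * 2) * indicator D t)"
        proof (cases "t \<in> D")
          case True
          have "norm (x' t) * norm (?y t) \<le> real n * (K * 2)"
            using A(4)[of t n] D(2) True le[of t] by (intro mult_mono) auto
          moreover have "0 \<le> K" using c(2)[OF True] by linarith
          ultimately show ?thesis using True by (simp add: abs_mult)
        qed simp
      qed
    qed
    ultimately show ?thesis ..
  qed
  show ?thesis
  proof (cases "p = 1")
    case True
    have "AE t in M. \<not> (t \<in> A n \<and> 2 * C < norm (x' t))" for n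
    proof -
      define D where "D = A n \<inter> {t. 2 * C < norm (x' t)}"
      have "(\<lambda>t. norm (x' t)) -` {2 * C<..} \<inter> space M \<in> sets M" by (rule measurable_sets[OF nm]) simp
      moreover have "D = A n \<inter> ((\<lambda>t. norm (x' t)) -` {2 * C<..} \<inter> space M)" unfolding D_def by auto
      ultimately have D: "D \<in> sets M" "D \<subseteq> A n" using A(1)[of n] by (auto simp: fmeasurable_def)
      have Df: "D \<in> fmeasurable M" by (rule fmeasurableI2[OF A(1) D(2,1)])
      have iD: "integrable M (\<lambda>t. c * indicator D t)" for c :: real using Df by (auto simp: fmeasurable_def)
      define y where "y t = (if t \<in> D then 1 *\<^sub>R v t else 0)" for t
      have y: "y \<in> Lp M (ereal p)" "integrable M (\<lambda>t. norm (x' t) * norm (y t))"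
        using test[OF D, of "\<lambda>_. 1" 1] unfolding y_def by auto
      have iy: "integrable M (\<lambda>t. blinfun_apply (x' t) (y t))"
        by (rule integrable_pairing[OF x' _ y(2)]) (use y(1) in \<open>simp add: Lp_iff\<close>)
      have ix: "integrable M (\<lambda>t. norm (x' t) * indicator D t)"
      proof (rule Bochner_Integration.integrable_bound[OF iD[of "real n"]])
        show "(\<lambda>t. norm (x' t) * indicator D t) \<in> borel_measurable M"
          using D(1) by (intro borel_measurable_times[OF nm]) auto
        show "AE t in M. norm (norm (x' t) * indicator D t) \<le> norm (real n * indicator D t)"
          by (rule AE_I2) (use A(4)[of _ n] D(2) in \<open>auto simp: indicator_def\<close>)
      qed
      have "(\<integral>t. norm (x' t) * indicator D t \<partial>M) \<le> (\<integral>t. blinfun_apply (x' t) (y t) \<partial>M)"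
        by (rule integral_mono_AE[OF ix iy]) (use v(3) in \<open>eventually_elim, simp add: y_def indicator_def\<close>)
      also have "\<dots> \<le> C * (\<integral>t. norm (y t) \<partial>M)" using C(2)[OF y] True by (simp add: integral_nonneg_AE)
      also have "\<dots> \<le> C * (\<integral>t. 2 * indicator D t \<partial>M)"
        using y(1) iD[of 2] v(2) C(1) True by (intro mult_left_mono integral_mono) (auto simp: Lp_iff y_def indicator_def)
      also have "\<dots> = (\<integral>t. 2 * C * indicator D t \<partial>M)" using Df by (simp add: fmeasurable_def)
      finally have le0: "(\<integral>t. norm (x' t) * indicator D t - 2 * C * indicator D t \<partial>M) \<le> 0"
        using ix iD by simp
      have nn: "AE t in M. 0 \<le> norm (x' t) * indicator D t - 2 * C * indicator D t"
        by (rule AE_I2) (auto simp: D_def indicator_def)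
      have "(\<integral>t. norm (x' t) * indicator D t - 2 * C * indicator D t \<partial>M) = 0"
        using le0 integral_nonneg_AE[OF nn] by linarith
      then have "AE t in M. norm (x' t) * indicator D t - 2 * C * indicator D t = 0"
        using integral_nonneg_eq_0_iff_AE[OF Bochner_Integration.integrable_diff[OF ix iD] nn] by blast
      then show ?thesis by eventually_elim (auto simp: D_def indicator_def split: if_splits)
    qed
    then have "AE t in M. \<forall>n. \<not> (t \<in> A n \<and> 2 * C < norm (x' t))" unfolding AE_all_countable by simp
    then have "AE t in M. norm (x' t) \<le> 2 * C"
    proof eventually_elim
      case (elim t)
      obtain n where "t \<in> A n" using A(3) by blast
      then show ?case using elim by (meson not_le)
    qed
    then show ?thesis unfolding Lp_def q using True x' by auto
  next
    case False
    define r where "r = p / (p - 1)"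
    have p1: "p > 1" using p False by simp
    have r: "1 < r" "1 / r + 1 / p = 1" using conjugate_exponent[OF p1] unfolding r_def by auto
    have rp: "(r - 1) * p = r" unfolding r_def using p1 by (simp add: field_simps)
    define g where "g n t = (if t \<in> A n then norm (x' t) powr r else 0)" for n t
    have gm: "g n \<in> borel_measurable M" for n
      unfolding g_def using nm A(1)[of n] by (intro measurable_If) (auto simp: fmeasurable_def)
    have g: "integrable M (g n)" for n
    proof (rule Bochner_Integration.integrable_bound[OF _ gm])
      show "integrable M (\<lambda>t. real n powr r * indicator (A n) t)" using A(1)[of n] by (auto simp: fmeasurable_def)
      show "AE t in M. norm (g n t) \<le> norm (real n powr r * indicator (A n) t)"
        by (rule AE_I2) (use A(4)[of _ n] r in \<open>auto simp: g_def intro!: powr_mono2\<close>)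
    qed
    have bound: "(\<integral>t. g n t \<partial>M) \<le> (2 * C) powr r" for n
    proof -
      define I where "I = (\<integral>t. g n t \<partial>M)"
      have I0: "0 \<le> I" unfolding I_def by (rule integral_nonneg_AE) (simp add: g_def)
      define y where "y t = (if t \<in> A n then norm (x' t) powr (r - 1) *\<^sub>R v t else 0)" for t
      have As: "A n \<in> sets M" using A(1)[of n] by (simp add: fmeasurable_def)
      have y: "y \<in> Lp M (ereal p)" "integrable M (\<lambda>t. norm (x' t) * norm (y t))"
      proof -
        have "(\<lambda>t. norm (x' t) powr (r - 1)) \<in> borel_measurable M" using nm by measurable
        moreover have "\<bar>norm (x' t) powr (r - 1)\<bar> \<le> real n powr (r - 1)" if "t \<in> A n" for t
          using powr_mono2[of "r - 1" "norm (x' t)" "real n"] A(4)[OF that] r(1) by simp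
        ultimately show "y \<in> Lp M (ereal p)" "integrable M (\<lambda>t. norm (x' t) * norm (y t))"
          using test[OF As order_refl, of "\<lambda>t. norm (x' t) powr (r - 1)" "real n powr (r - 1)"]
          unfolding y_def by blast+
      qed
      have iy: "integrable M (\<lambda>t. blinfun_apply (x' t) (y t))"
        by (rule integrable_pairing[OF x' _ y(2)]) (use y(1) in \<open>simp add: Lp_iff\<close>)
      have "I \<le> (\<integral>t. blinfun_apply (x' t) (y t) \<partial>M)" unfolding I_def
      proof (rule integral_mono_AE[OF g iy])
        from v(3) show "AE t in M. g n t \<le> blinfun_apply (x' t) (y t)"
        proof eventually_elim
          case (elim t)
          have "norm (x' t) powr r = norm (x' t) powr (r - 1) * norm (x' t)"
          proof (cases "x' t = 0")
            case False then show ?thesis by (simp add: powr_diff)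
          qed simp
          also have "\<dots> \<le> norm (x' t) powr (r - 1) * blinfun_apply (x' t) (v t)" by (rule mult_left_mono[OF elim]) simp
          finally show ?case unfolding g_def y_def by (simp add: blinfun.scaleR_right)
        qed
      qed
      also have "\<dots> \<le> C * (\<integral>t. norm (y t) powr p \<partial>M) powr (1 / p)" by (rule C(2)[OF y])
      also have "\<dots> \<le> C * (2 powr p * I) powr (1 / p)"
      proof (intro mult_left_mono powr_mono2 C(1))
        have "(\<integral>t. norm (y t) powr p \<partial>M) \<le> (\<integral>t. 2 powr p * g n t \<partial>M)"
        proof (rule integral_mono)
          fix t
          have "norm (v t) powr p \<le> 2 powr p" using v(2)[of t] p by (intro powr_mono2) auto
          then have "norm (x' t) powr r * norm (v t) powr p \<le> norm (x' t) powr r * 2 powr p" by (rule mult_left_mono) simp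
          moreover have "(norm (x' t) powr (r - 1) * norm (v t)) powr p = norm (x' t) powr r * norm (v t) powr p"
            by (simp add: powr_mult powr_powr rp)
          ultimately show "norm (y t) powr p \<le> 2 powr p * g n t" unfolding y_def g_def by (simp add: mult.commute)
        qed (use y(1) g in \<open>auto simp: Lp_iff\<close>)
        also have "\<dots> = 2 powr p * I" unfolding I_def by simp
        finally show "(\<integral>t. norm (y t) powr p \<partial>M) \<le> 2 powr p * I" .
      qed (use p in \<open>auto intro: integral_nonneg_AE\<close>)
      also have "\<dots> = 2 * C * I powr (1 / p)" using I0 p by (simp add: powr_mult powr_powr)
      finally have le: "I \<le> 2 * C * I powr (1 / p)" .
      show ?thesis
      proof (cases "I = 0")
        case True then show ?thesis unfolding I_def by simp
      next
        case False
        then have pos: "0 < I" using I0 by simp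
        have "I powr (1 / r) * I powr (1 / p) = I" using pos r(2) by (simp add: powr_add[symmetric])
        then have "I powr (1 / r) * I powr (1 / p) \<le> 2 * C * I powr (1 / p)" using le by simp
        then have "I powr (1 / r) \<le> 2 * C" using pos by (simp add: mult_le_cancel_right)
        then have "(I powr (1 / r)) powr r \<le> (2 * C) powr r" using r by (intro powr_mono2) auto
        then show ?thesis using r pos unfolding I_def[symmetric] by (simp add: powr_powr)
      qed
    qed
    have mono: "mono (\<lambda>n. g n t)" for t
    proof (rule incseq_SucI)
      fix n show "g n t \<le> g (Suc n) t" using incseq_SucD[OF A(2), of n] unfolding g_def by auto
    qed
    have "incseq (\<lambda>n. \<integral>t. g n t \<partial>M)"
      by (rule incseq_SucI, rule integral_mono[OF g g]) (use mono in \<open>auto dest: incseq_SucD\<close>)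
    then obtain L where L: "(\<lambda>n. \<integral>t. g n t \<partial>M) \<longlonglongrightarrow> L"
      using incseq_convergent[of "\<lambda>n. \<integral>t. g n t \<partial>M" "(2 * C) powr r"] bound by blast
    have "integrable M (\<lambda>t. norm (x' t) powr r)"
    proof (rule integrable_monotone_convergence[OF g _ _ L])
      show "AE t in M. mono (\<lambda>n. g n t)" using mono by simp
      show "AE t in M. (\<lambda>n. g n t) \<longlonglongrightarrow> norm (x' t) powr r"
      proof (rule AE_I2, rule tendsto_eventually)
        fix t
        obtain i where "t \<in> A i" using A(3) by blast
        then have "t \<in> A n" if "n \<ge> i" for n using A(2) that unfolding incseq_def by blast
        then have "g n t = norm (x' t) powr r" if "n \<ge> i" for n using that unfolding g_def by simp
        then show "\<forall>\<^sub>F n in sequentially. g n t = norm (x' t) powr r" unfolding eventually_sequentially by blast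
      qed
      show "(\<lambda>t. norm (x' t) powr r) \<in> borel_measurable M" using nm by measurable
    qed
    then show ?thesis unfolding q r_def[symmetric] using False x' by (simp add: Lp_iff)
  qed
qed

text \<open>The density of the vector measure represents the functional, first on step functions and then
  by continuity; that it belongs to \<open>L\<^sup>q\<close> expresses the boundedness of the functional.\<close>
theorem Lp_dual_representation:
  fixes \<phi> :: "('t \<Rightarrow> 'x::banach) \<Rightarrow> real"
  assumes asp: "asplund_space TYPE('x)" and p: "1 \<le> p"
    and q: "q = (if p = 1 then \<infinity> else ereal (p / (p - 1)))" and \<phi>: "\<phi> \<in> Lp_dual M p"
  shows "\<exists>x'\<in>Lp M q. \<phi> = Lp_functional M p x'"
proof -
  obtain x' B v where x': "strongly_measurable M x'"
    and B: "\<forall>n. disjoint_family (B n :: nat \<Rightarrow> 't set)"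
      "\<forall>n i. nearly_constant_density \<phi> ((1/2)^n) (B n i) (v n i)" "\<forall>n. AE t in M. \<exists>i. t \<in> B n i"
    and close: "AE t in M. \<forall>n i. t \<in> B n i \<longrightarrow> norm (x' t - v n i) \<le> (1/2)^n"
    by (rule exists_density[OF p \<phi> asp])
  note rep = density_represents[OF p \<phi> x' B[rule_format] close]
  obtain C where C: "0 \<le> C" "\<And>x. x \<in> Lp M (ereal p) \<Longrightarrow> \<bar>\<phi> x\<bar> \<le> C * (\<integral>t. norm (x t) powr p \<partial>M) powr (1 / p)"
    using Lp_dual_bound[OF p \<phi>] by blast
  have x'q: "x' \<in> Lp M q"
  proof (rule Lq_if_pairing_bounded[OF p q x' C(1)])
    fix y :: "'t \<Rightarrow> 'x" assume y: "y \<in> Lp M (ereal p)" "integrable M (\<lambda>t. norm (x' t) * norm (y t))"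
    show "(\<integral>t. blinfun_apply (x' t) (y t) \<partial>M) \<le> C * (\<integral>t. norm (y t) powr p \<partial>M) powr (1 / p)"
      using C(2)[OF y(1)] unfolding rep[OF y] by linarith
  qed
  have "\<phi> = Lp_functional M p x'"
  proof (rule extensionalityI)
    show "\<phi> \<in> extensional (Lp M (ereal p))" using \<phi> unfolding Lp_dual_def by blast
    show "Lp_functional M p x' \<in> extensional (Lp M (ereal p))" unfolding Lp_functional_def by simp
    fix y :: "'t \<Rightarrow> 'x" assume y: "y \<in> Lp M (ereal p)"
    obtain K where "\<And>x::'t \<Rightarrow> 'x. x \<in> Lp M (ereal p) \<Longrightarrow>
      integrable M (\<lambda>t. norm (x' t) * norm (x t)) \<and> (\<integral>t. norm (x' t) * norm (x t) \<partial>M) \<le> K * Lp_norm M p x"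
      by (rule Lp_pairing_bound[OF p q x'q, where 'z='x]) blast
    then have "integrable M (\<lambda>t. norm (x' t) * norm (y t))" using y by blast
    then show "\<phi> y = Lp_functional M p x' y" using rep[OF y] y unfolding Lp_functional_def by simp
  qed
  with x'q show ?thesis by blast
qed

end

section \<open>Integral functionals of admissible integrands\<close>
theorem corollary6p6:
  fixes M :: "'t::metric_space measure"
    and f :: "'t \<Rightarrow> 'x::banach \<Rightarrow> ereal"
    and p :: real and q :: ereal
  assumes "asplund_space TYPE('x)"
    and "space M = UNIV"
    and "sets borel \<subseteq> sets M"
    and "complete_measure M"
    and "sigma_finite_measure M"
    and "inner_regular M"
    and "1 \<le> p"
    and "q = (if p = 1 then \<infinity> else ereal (p / (p - 1)))"
    and "admissible_integrand M f"
    and "\<exists>u\<in>Lp M (ereal p). integral_functional M f u < \<infinity>"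
  shows "(\<forall>x'\<in>Lp M q.
            Lp_conjugate M p (integral_functional M f) (Lp_functional M p x') =
              integral_functional M (\<lambda>t. conjugate (f t)) x') \<and>
         (\<forall>\<epsilon>\<ge>0. \<forall>x\<in>Lp M (ereal p). \<bar>integral_functional M f x\<bar> \<noteq> \<infinity> \<longrightarrow>
            Lp_eps_subdifferential M p (integral_functional M f) \<epsilon> x =
              Lp_functional M p `
                (\<Union>\<eta>\<in>error_functions M \<epsilon>.
                   {x'\<in>Lp M q. AE t in M. x' t \<in> eps_subdifferential (f t) (\<eta> t) (x t)}))"
proof (intro conjI ballI allI impI)
  interpret sigma_finite_measure M by fact
  interpret complete_measure M by fact
  interpret complete_Radon_measure M
    by unfold_locales (use assms in auto)
  have f: "lindelof_measurable M (\<lambda>t. epi (f t))" "\<And>t. closed (epi (f t))"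
    using admissible_integrand_epi[OF \<open>admissible_integrand M f\<close>] by simp_all
  note pq = \<open>1 \<le> p\<close> \<open>q = (if p = 1 then \<infinity> else ereal (p / (p - 1)))\<close>
  show "Lp_conjugate M p (integral_functional M f) (Lp_functional M p x') =
      integral_functional M (\<lambda>t. conjugate (f t)) x'" if x': "x' \<in> Lp M q" for x'
    using Lp_conjugate_integral_functional[OF f pq x'] assms(10) by blast
  fix \<epsilon> :: real and x :: "'t \<Rightarrow> 'x"
  assume x: "x \<in> Lp M (ereal p)" "\<bar>integral_functional M f x\<bar> \<noteq> \<infinity>"
  let ?\<Psi> = "integral_functional M f" and ?J = "Lp_functional M p"
  have sub_iff: "?J x' \<in> Lp_eps_subdifferential M p ?\<Psi> \<epsilon> x \<longleftrightarrow>
      (\<exists>\<eta>\<in>error_functions M \<epsilon>. AE t in M. x' t \<in> eps_subdifferential (f t) (\<eta> t) (x t))"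
    if x': "x' \<in> Lp M q" for x'
    using Lp_functional_eps_subgradient_iff[OF f pq x' x] Lp_functional_in_dual[OF pq x'] x(2)
    unfolding Lp_eps_subdifferential_def by simp
  show "Lp_eps_subdifferential M p ?\<Psi> \<epsilon> x =
      ?J ` (\<Union>\<eta>\<in>error_functions M \<epsilon>.
        {x'\<in>Lp M q. AE t in M. x' t \<in> eps_subdifferential (f t) (\<eta> t) (x t)})"
  proof (intro equalityI subsetI)
    fix \<phi> assume \<phi>: "\<phi> \<in> Lp_eps_subdifferential M p ?\<Psi> \<epsilon> x"
    then have "\<phi> \<in> Lp_dual M p" using x(2) unfolding Lp_eps_subdifferential_def by simp
    then obtain x' where x': "x' \<in> Lp M q" "\<phi> = ?J x'"
      using Lp_dual_representation[OF assms(1) pq] by blast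
    then obtain \<eta> where "\<eta> \<in> error_functions M \<epsilon>"
      "AE t in M. x' t \<in> eps_subdifferential (f t) (\<eta> t) (x t)"
      using \<phi> sub_iff[OF x'(1)] by blast
    with x' show "\<phi> \<in> ?J ` (\<Union>\<eta>\<in>error_functions M \<epsilon>.
        {x'\<in>Lp M q. AE t in M. x' t \<in> eps_subdifferential (f t) (\<eta> t) (x t)})" by blast
  next
    fix \<phi> assume "\<phi> \<in> ?J ` (\<Union>\<eta>\<in>error_functions M \<epsilon>.
        {x'\<in>Lp M q. AE t in M. x' t \<in> eps_subdifferential (f t) (\<eta> t) (x t)})"
    then obtain x' \<eta> where "\<phi> = ?J x'" "x' \<in> Lp M q" "\<eta> \<in> error_functions M \<epsilon>"
      "AE t in M. x' t \<in> eps_subdifferential (f t) (\<eta> t) (x t)" by blast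
    then show "\<phi> \<in> Lp_eps_subdifferential M p ?\<Psi> \<epsilon> x" using sub_iff by blast
  qed
qed

end
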